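(* Let $p\ge 3$ be a prime and let $F$ be a field of characteristic $p$. Let $\lambda=(\lambda_1,\dots,\lambda_r)\vdash n$ be a James partition of length $r\ge 2$ (all $\lambda_i>0$), and let $N$ be the number of $p$-segments of $\{1,\dots,r\}$ (with respect to $\lambda$). 1. If $l_p(\lambda_1)=l_p(\lambda_2)$, then $\dim_F H^1(\mathcal{S}_n,S^\lambda)\le N$. 2. If $l_p(\lambda_1)>l_p(\lambda_2)$, then $\dim_F H^1(\mathcal{S}_n,S^\lambda)\le N-1$.
   Context: $\mathcal{S}_n$ is the symmetric group, $S^\lambda$ is the Specht module over $F$ in James' convention (the submodule of the permutation module $M^\lambda$ on $\lambda$-tabloids spanned by the polytabloids), and $H^1(\mathcal{S}_n,S^\lambda)=\mathrm{Ext}^1_{F\mathcal{S}_n}(F,S^\lambda)$ with $F$ the trivial module. For a positive integer $x$ with base $p$ expansion $\sum_{i=0}^{\alpha}x_ip^i$, $x_\alpha\neq0$, put $l_p(x)=\alpha$, and let $\mathrm{val}_p(x)$ be the least $i$ with $x_i\ne0$. $\lambda=(\lambda_1,\dots,\lambda_r)$ is a James partition if $\binom{\lambda_i+j}{j}\equiv 0 \pmod p$ for all $1\le i<r$ and $1\le j\le\lambda_{i+1}$; equivalently $\mathrm{val}_p(\lambda_i+1)>l_p(\lambda_{i+1})$ for all $1\le i<r$. The segments of $\lambda$ are the equivalence classes on $\{1,\dots,r\}$ of the relation $s\sim t$ if $l_p(\lambda_s)=l_p(\lambda_t)$. Two integers $1\le s,t\le r$ are called adjacent if they lie in the same segment,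 or if $1<s<r$, $t=s+1$, $t$ is the only element in its segment, and $\lambda_s=p^{\mathrm{val}_p(\lambda_{s-1}+1)}-1$. The $p$-segments of $\lambda$ are the equivalence classes on $\{1,\dots,r\}$ of the equivalence relation generated by adjacency. *)

theory Defs
  imports
    Complex_Main
    "HOL-Algebra.Sym_Groups"
    "HOL-Library.Function_Algebras"
    "HOL-Computational_Algebra.Primes"
begin

section \<open>Vector spaces of functions\<close>

definition fscale :: "'f::field \<Rightarrow> ('a \<Rightarrow> 'f) \<Rightarrow> ('a \<Rightarrow> 'f)" where
  "fscale c v = (\<lambda>x. c * v x)"

interpretation fun_space: vector_space fscale
  by unfold_locales (auto simp: fscale_def fun_eq_iff algebra_simps)

definition hscale :: "'f::field \<Rightarrow> ('v \<Rightarrow> 'a \<Rightarrow> 'f) \<Rightarrow> ('v \<Rightarrow> 'a \<Rightarrow> 'f)" where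
  "hscale c \<phi> = (\<lambda>v. fscale c (\<phi> v))"

interpretation hom_space: vector_space hscale
  by unfold_locales (auto simp: hscale_def fscale_def fun_eq_iff algebra_simps)

text \<open>The vector space with basis \<open>X\<close>, used for finite \<open>X\<close> only.\<close>

definition free_space :: "'a set \<Rightarrow> ('a \<Rightarrow> 'f::field) set" where
  "free_space X = {v. \<forall>x. x \<notin> X \<longrightarrow> v x = 0}"

definition delta :: "'a \<Rightarrow> 'a \<Rightarrow> 'f::field" where
  "delta x = (\<lambda>y. if y = x then 1 else 0)"

definition lin_ext :: "'a set \<Rightarrow> ('a \<Rightarrow> 'b \<Rightarrow> 'f::field) \<Rightarrow> ('a \<Rightarrow> 'f) \<Rightarrow> ('b \<Rightarrow> 'f)" where
  "lin_ext X b v = (\<Sum>x\<in>X. fscale (v x) (b x))"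


section \<open>Extensions of the trivial module\<close>

text \<open>
  A module for the group algebra of \<open>G\<close> is given by a subspace \<open>V\<close> of a function space
  and an action \<open>\<rho>\<close> of \<open>G\<close> on it. Homomorphisms are normalised to be \<open>0\<close> outside \<open>V\<close>, so that
  they form a subspace of the space of all functions.
\<close>

definition FG_hom ::
  "('g, 'm) monoid_scheme \<Rightarrow> ('a \<Rightarrow> 'f::field) set \<Rightarrow> ('g \<Rightarrow> ('a \<Rightarrow> 'f) \<Rightarrow> ('a \<Rightarrow> 'f))
    \<Rightarrow> ('b \<Rightarrow> 'f) set \<Rightarrow> ('g \<Rightarrow> ('b \<Rightarrow> 'f) \<Rightarrow> ('b \<Rightarrow> 'f)) \<Rightarrow> (('a \<Rightarrow> 'f) \<Rightarrow> ('b \<Rightarrow> 'f)) set" where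
  "FG_hom G V \<rho> W \<sigma> = {\<phi>.
     (\<forall>v\<in>V. \<phi> v \<in> W) \<and>
     (\<forall>v\<in>V. \<forall>w\<in>V. \<phi> (v + w) = \<phi> v + \<phi> w) \<and>
     (\<forall>c. \<forall>v\<in>V. \<phi> (fscale c v) = fscale c (\<phi> v)) \<and>
     (\<forall>g\<in>carrier G. \<forall>v\<in>V. \<phi> (\<rho> g v) = \<sigma> g (\<phi> v)) \<and>
     (\<forall>v. v \<notin> V \<longrightarrow> \<phi> v = 0)}"

text \<open>
  The standard (homogeneous bar) resolution of the trivial module of a finite group: in degree
  \<open>k\<close> it is the free module on the \<open>(k + 1)\<close>-tuples of group elements, with diagonal action and
  \<open>\<partial>(g\<^sub>0, \<dots>, g\<^sub>k)\<close> the alternating sum of the tuples obtained by omitting \<open>g\<^sub>i\<close>. The augmentation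
  sends each 1-tuple to 1.
\<close>

definition bar_basis :: "('g, 'm) monoid_scheme \<Rightarrow> nat \<Rightarrow> 'g list set" where
  "bar_basis G k = {xs. length xs = Suc k \<and> set xs \<subseteq> carrier G}"

definition bar_space :: "('g, 'm) monoid_scheme \<Rightarrow> nat \<Rightarrow> ('g list \<Rightarrow> 'f::field) set" where
  "bar_space G k = free_space (bar_basis G k)"

definition bar_act ::
  "('g, 'm) monoid_scheme \<Rightarrow> nat \<Rightarrow> 'g \<Rightarrow> ('g list \<Rightarrow> 'f::field) \<Rightarrow> ('g list \<Rightarrow> 'f)" where
  "bar_act G k g = lin_ext (bar_basis G k) (\<lambda>xs. delta (map (\<lambda>h. g \<otimes>\<^bsub>G\<^esub> h) xs))"

definition bar_diff ::
  "('g, 'm) monoid_scheme \<Rightarrow> nat \<Rightarrow> ('g list \<Rightarrow> 'f::field) \<Rightarrow> ('g list \<Rightarrow> 'f)" where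
  "bar_diff G k = lin_ext (bar_basis G k)
     (\<lambda>xs. \<Sum>i\<le>k. fscale ((-1) ^ i) (delta (take i xs @ drop (Suc i) xs)))"

definition ext1_cocycles ::
  "('g, 'm) monoid_scheme \<Rightarrow> ('b \<Rightarrow> 'f::field) set \<Rightarrow> ('g \<Rightarrow> ('b \<Rightarrow> 'f) \<Rightarrow> ('b \<Rightarrow> 'f))
    \<Rightarrow> (('g list \<Rightarrow> 'f) \<Rightarrow> ('b \<Rightarrow> 'f)) set" where
  "ext1_cocycles G W \<sigma> =
     {\<phi> \<in> FG_hom G (bar_space G 1) (bar_act G 1) W \<sigma>.
        \<forall>v\<in>bar_space G 2. \<phi> (bar_diff G 2 v) = 0}"

definition ext1_coboundaries ::
  "('g, 'm) monoid_scheme \<Rightarrow> ('b \<Rightarrow> 'f::field) set \<Rightarrow> ('g \<Rightarrow> ('b \<Rightarrow> 'f) \<Rightarrow> ('b \<Rightarrow> 'f))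
    \<Rightarrow> (('g list \<Rightarrow> 'f) \<Rightarrow> ('b \<Rightarrow> 'f)) set" where
  "ext1_coboundaries G W \<sigma> =
     (\<lambda>\<psi> v. if v \<in> bar_space G 1 then \<psi> (bar_diff G 1 v) else 0) `
       FG_hom G (bar_space G 0) (bar_act G 0) W \<sigma>"

text \<open>
  The dimension of \<open>Ext\<^sup>1(F, W)\<close>, the quotient of cocycles by coboundaries. Subtracting dimensions
  is legitimate when \<open>G\<close> is finite and \<open>W\<close> is finite-dimensional; see the lemmas below.
\<close>

definition H1_dim ::
  "('g, 'm) monoid_scheme \<Rightarrow> ('b \<Rightarrow> 'f::field) set \<Rightarrow> ('g \<Rightarrow> ('b \<Rightarrow> 'f) \<Rightarrow> ('b \<Rightarrow> 'f)) \<Rightarrow> nat" where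
  "H1_dim G W \<sigma> =
     hom_space.dim (ext1_cocycles G W \<sigma>) - hom_space.dim (ext1_coboundaries G W \<sigma>)"

subsection \<open>The coboundaries form a subspace of the finite-dimensional space of cocycles\<close>

lemma lin_ext_add: "lin_ext X b (v + w) = lin_ext X b v + lin_ext X b w"
  by (simp add: lin_ext_def fun_space.scale_left_distrib sum.distrib)

lemma lin_ext_scale: "lin_ext X b (fscale c v) = fscale c (lin_ext X b v)"
  unfolding lin_ext_def fun_space.scale_sum_right
  by (intro sum.cong refl) (auto simp: fscale_def mult.assoc)

lemma lin_ext_zero: "lin_ext X b 0 = 0"
  by (simp add: lin_ext_def)

lemma lin_ext_diff: "lin_ext X b (v - w) = lin_ext X b v - lin_ext X b w"
  by (simp add: lin_ext_def fun_space.scale_left_diff_distrib sum_subtractf)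

lemma lin_ext_sum: "lin_ext X b (sum h I) = (\<Sum>i\<in>I. lin_ext X b (h i))"
proof (induction I rule: infinite_finite_induct)
  case (infinite I)
  show ?case unfolding sum.infinite[OF infinite] by (rule lin_ext_zero)
next
  case empty
  show ?case unfolding sum.empty by (rule lin_ext_zero)
next
  case (insert i I)
  show ?case unfolding sum.insert[OF insert.hyps] lin_ext_add insert.IH ..
qed

lemma lin_ext_delta: "finite X \<Longrightarrow> x \<in> X \<Longrightarrow> lin_ext X b (delta x) = b x"
  unfolding lin_ext_def delta_def
  by (subst sum.remove[of _ x]) (auto intro!: sum.neutral)

lemma lin_ext_cong: "(\<And>x. x \<in> X \<Longrightarrow> b x = b' x) \<Longrightarrow> lin_ext X b v = lin_ext X b' v"
  by (simp add: lin_ext_def)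

lemma lin_ext_comp: "lin_ext Y c (lin_ext X b v) = lin_ext X (\<lambda>x. lin_ext Y c (b x)) v"
  unfolding lin_ext_def[of X] lin_ext_sum lin_ext_scale ..

lemma subspace_free_space: "fun_space.subspace (free_space X)"
  by (auto simp: fun_space.subspace_def free_space_def fscale_def)

lemma delta_free_space: "x \<in> X \<Longrightarrow> delta x \<in> free_space X"
  by (auto simp: delta_def free_space_def)

lemma lin_ext_free_space:
  "(\<And>x. x \<in> X \<Longrightarrow> b x \<in> free_space Y) \<Longrightarrow> lin_ext X b v \<in> free_space Y"
  unfolding lin_ext_def
  by (intro fun_space.subspace_sum fun_space.subspace_scale subspace_free_space)

lemma free_space_expand:
  assumes "finite X" "v \<in> free_space X"
  shows "v = lin_ext X delta v"
proof
  fix y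
  have "lin_ext X delta v y = (\<Sum>x\<in>X. if x = y then v x else 0)"
    unfolding lin_ext_def using \<open>finite X\<close>
    by (induction X rule: finite_induct) (auto simp: fscale_def delta_def)
  with assms show "v y = lin_ext X delta v y"
    by (auto simp: free_space_def)
qed

lemma finite_bar_basis: "finite (carrier G) \<Longrightarrow> finite (bar_basis G k)"
  using finite_lists_length_eq[of "carrier G" "Suc k"]
  by (simp add: bar_basis_def conj_commute)

lemma bar_basis_del:
  "xs \<in> bar_basis G (Suc k) \<Longrightarrow> i \<le> Suc k \<Longrightarrow> take i xs @ drop (Suc i) xs \<in> bar_basis G k"
  by (auto simp: bar_basis_def dest: in_set_takeD in_set_dropD)

lemma (in group) bar_basis_map:
  "xs \<in> bar_basis G k \<Longrightarrow> g \<in> carrier G \<Longrightarrow> map (\<lambda>h. g \<otimes> h) xs \<in> bar_basis G k"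
  by (auto simp: bar_basis_def)

lemma bar_diff_space: "bar_diff G (Suc k) v \<in> bar_space G k"
  unfolding bar_diff_def bar_space_def
  by (intro lin_ext_free_space fun_space.subspace_sum fun_space.subspace_scale
        subspace_free_space delta_free_space bar_basis_del) auto

lemma (in group) bar_act_space: "g \<in> carrier G \<Longrightarrow> bar_act G k g v \<in> bar_space G k"
  unfolding bar_act_def bar_space_def
  by (intro lin_ext_free_space delta_free_space bar_basis_map)

lemma (in group) bar_diff_act:
  assumes "finite (carrier G)" "g \<in> carrier G"
  shows "bar_diff G (Suc k) (bar_act G (Suc k) g v) = bar_act G k g (bar_diff G (Suc k) v)"
  unfolding bar_diff_def bar_act_def lin_ext_comp
proof (rule lin_ext_cong)
  fix xs assume xs: "xs \<in> bar_basis G (Suc k)"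
  show "lin_ext (bar_basis G (Suc k))
          (\<lambda>xs. \<Sum>i\<le>Suc k. fscale ((-1) ^ i) (delta (take i xs @ drop (Suc i) xs)))
          (delta (map ((\<otimes>) g) xs)) =
        lin_ext (bar_basis G k) (\<lambda>xs. delta (map ((\<otimes>) g) xs))
          (\<Sum>i\<le>Suc k. fscale ((-1) ^ i) (delta (take i xs @ drop (Suc i) xs)))"
    unfolding lin_ext_delta[OF finite_bar_basis[OF assms(1)] bar_basis_map[OF xs assms(2)]]
      lin_ext_sum lin_ext_scale
    by (intro sum.cong refl, subst lin_ext_delta[OF finite_bar_basis[OF assms(1)] bar_basis_del[OF xs]])
      (auto simp: take_map drop_map)
qed

lemma bar_diff_diff:
  assumes "finite (carrier G)"
  shows "bar_diff G 1 (bar_diff G 2 v) = 0"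
proof -
  have "bar_diff G 1 (bar_diff G 2 v) = lin_ext (bar_basis G 2) (\<lambda>_. 0) v"
    unfolding bar_diff_def lin_ext_comp
  proof (rule lin_ext_cong)
    fix xs assume xs: "xs \<in> bar_basis G 2"
    have "length xs = 3" using xs by (simp add: bar_basis_def)
    then obtain a b c where abc: "xs = [a, b, c]"
      by (auto simp: length_Suc_conv eval_nat_numeral)
    have "[b, c] \<in> bar_basis G 1" "[a, c] \<in> bar_basis G 1" "[a, b] \<in> bar_basis G 1"
      using xs by (auto simp: abc bar_basis_def)
    then show "lin_ext (bar_basis G 1)
          (\<lambda>xs. \<Sum>i\<le>1. fscale ((-1) ^ i) (delta (take i xs @ drop (Suc i) xs)))
          (\<Sum>i\<le>2. fscale ((-1) ^ i) (delta (take i xs @ drop (Suc i) xs))) = 0"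
      by (simp add: abc eval_nat_numeral lin_ext_add lin_ext_diff
            lin_ext_delta[OF finite_bar_basis[OF assms]]) (simp add: fun_eq_iff)
  qed
  then show ?thesis by (simp add: lin_ext_def)
qed

lemma (in group) ext1_coboundaries_subset:
  assumes "finite (carrier G)"
  shows "ext1_coboundaries G W \<sigma> \<subseteq> ext1_cocycles G W \<sigma>"
proof
  fix \<phi> assume "\<phi> \<in> ext1_coboundaries G W \<sigma>"
  then obtain \<psi> where \<psi>: "\<psi> \<in> FG_hom G (bar_space G 0) (bar_act G 0) W \<sigma>"
    and \<phi>: "\<phi> = (\<lambda>v. if v \<in> bar_space G 1 then \<psi> (bar_diff G 1 v) else 0)"
    by (auto simp: ext1_coboundaries_def)
  have sub: "fun_space.subspace (bar_space G 1 :: ('a list \<Rightarrow> 'c) set)"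
    by (simp add: bar_space_def subspace_free_space)
  have diff: "bar_diff G 1 v \<in> bar_space G 0" for v :: "'a list \<Rightarrow> 'c"
    using bar_diff_space[of G 0 v] by simp
  have add: "bar_diff G 1 (v + w) = bar_diff G 1 v + bar_diff G 1 w" for v w :: "'a list \<Rightarrow> 'c"
    by (simp add: bar_diff_def lin_ext_add)
  have scale: "bar_diff G 1 (fscale c v) = fscale c (bar_diff G 1 v)" for c and v :: "'a list \<Rightarrow> 'c"
    by (simp add: bar_diff_def lin_ext_scale)
  have act: "bar_diff G 1 (bar_act G 1 g v) = bar_act G 0 g (bar_diff G 1 v)"
    if "g \<in> carrier G" for g and v :: "'a list \<Rightarrow> 'c"
    using bar_diff_act[OF assms that, of 0 v] by simp
  have "\<psi> 0 = 0"
  proof -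
    have "0 \<in> bar_space G 0" by (simp add: bar_space_def free_space_def)
    then have "\<psi> (0 + 0) = \<psi> 0 + \<psi> 0" using \<psi> unfolding FG_hom_def by blast
    then show ?thesis by simp
  qed
  have in1: "v \<in> bar_space G 1 \<Longrightarrow> \<phi> v = \<psi> (bar_diff G 1 v)" for v
    by (simp add: \<phi>)
  have *: "\<forall>v\<in>bar_space G 0. \<psi> v \<in> W"
    "\<forall>v\<in>bar_space G 0. \<forall>w\<in>bar_space G 0. \<psi> (v + w) = \<psi> v + \<psi> w"
    "\<forall>c. \<forall>v\<in>bar_space G 0. \<psi> (fscale c v) = fscale c (\<psi> v)"
    "\<forall>g\<in>carrier G. \<forall>v\<in>bar_space G 0. \<psi> (bar_act G 0 g v) = \<sigma> g (\<psi> v)"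
    using \<psi> unfolding FG_hom_def by blast+
  show "\<phi> \<in> ext1_cocycles G W \<sigma>"
    unfolding ext1_cocycles_def FG_hom_def mem_Collect_eq
  proof (intro conjI ballI allI impI)
    show "\<phi> v \<in> W" if "v \<in> bar_space G 1" for v
      using * diff in1[OF that] by metis
    show "\<phi> (v + w) = \<phi> v + \<phi> w" if "v \<in> bar_space G 1" "w \<in> bar_space G 1" for v w
      using *(2) diff unfolding in1[OF that(1)] in1[OF that(2)]
        in1[OF fun_space.subspace_add[OF sub that]] add by blast
    show "\<phi> (fscale c v) = fscale c (\<phi> v)" if "v \<in> bar_space G 1" for c v
      using *(3) diff unfolding in1[OF that]
        in1[OF fun_space.subspace_scale[OF sub that]] scale by blast
    show "\<phi> (bar_act G 1 g v) = \<sigma> g (\<phi> v)" if "g \<in> carrier G" "v \<in> bar_space G 1" for g v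
      using *(4) that(1) diff unfolding in1[OF that(2)] in1[OF bar_act_space[OF that(1)]]
        act[OF that(1)] by blast
    show "\<phi> v = 0" if "v \<notin> bar_space G 1" for v
      using that by (simp add: \<phi>)
    show "\<phi> (bar_diff G 2 v) = 0" for v
      using \<open>\<psi> 0 = 0\<close> bar_diff_diff[OF assms, of v] by (simp add: \<phi> del: One_nat_def)
  qed
qed

lemma subspace_FG_hom:
  assumes "fun_space.subspace W"
    and "\<And>g v w. g \<in> carrier G \<Longrightarrow> \<sigma> g (v + w) = \<sigma> g v + \<sigma> g w"
    and "\<And>g c v. g \<in> carrier G \<Longrightarrow> \<sigma> g (fscale c v) = fscale c (\<sigma> g v)"
  shows "hom_space.subspace (FG_hom G V \<rho> W \<sigma>)"
proof -
  have "\<sigma> g 0 = 0" if "g \<in> carrier G" for g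
    using assms(3)[OF that, of 0 0] by simp
  then show ?thesis
    using fun_space.subspace_0[OF assms(1)] fun_space.subspace_add[OF assms(1)]
      fun_space.subspace_scale[OF assms(1)]
    by (auto simp: hom_space.subspace_def FG_hom_def assms(2,3) hscale_def
        fun_space.scale_right_distrib fun_space.scale_left_commute algebra_simps)
qed

lemma subspace_ext1_cocycles:
  assumes "fun_space.subspace W"
    and "\<And>g v w. g \<in> carrier G \<Longrightarrow> \<sigma> g (v + w) = \<sigma> g v + \<sigma> g w"
    and "\<And>g c v. g \<in> carrier G \<Longrightarrow> \<sigma> g (fscale c v) = fscale c (\<sigma> g v)"
  shows "hom_space.subspace (ext1_cocycles G W \<sigma>)"
proof -
  have "hom_space.subspace (FG_hom G (bar_space G 1) (bar_act G 1) W \<sigma>)"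
    by (rule subspace_FG_hom) (simp_all add: assms)
  then show ?thesis
    by (auto simp: hom_space.subspace_def ext1_cocycles_def hscale_def)
qed

lemma subspace_ext1_coboundaries:
  fixes G :: "('g, 'm) monoid_scheme" and W :: "('b \<Rightarrow> 'f::field) set"
  assumes "fun_space.subspace W"
    and "\<And>g v w. g \<in> carrier G \<Longrightarrow> \<sigma> g (v + w) = \<sigma> g v + \<sigma> g w"
    and "\<And>g c v. g \<in> carrier G \<Longrightarrow> \<sigma> g (fscale c v) = fscale c (\<sigma> g v)"
  shows "hom_space.subspace (ext1_coboundaries G W \<sigma>)"
proof -
  let ?H = "FG_hom G (bar_space G 0) (bar_act G 0) W \<sigma>"
  define d :: "(('g list \<Rightarrow> 'f) \<Rightarrow> 'b \<Rightarrow> 'f) \<Rightarrow> (('g list \<Rightarrow> 'f) \<Rightarrow> 'b \<Rightarrow> 'f)"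
    where "d = (\<lambda>\<psi> v. if v \<in> bar_space G 1 then \<psi> (bar_diff G 1 v) else 0)"
  have H: "hom_space.subspace ?H"
    by (rule subspace_FG_hom) (simp_all add: assms)
  have d_lin: "d 0 = 0" "d (\<psi> + \<psi>') = d \<psi> + d \<psi>'" "d (hscale c \<psi>) = hscale c (d \<psi>)" for \<psi> \<psi>' c
    by (auto simp: d_def fun_eq_iff hscale_def fscale_def)
  have "hom_space.subspace (d ` ?H)"
    unfolding hom_space.subspace_def
  proof (intro conjI ballI allI)
    show "0 \<in> d ` ?H"
      using d_lin(1) hom_space.subspace_0[OF H] by (intro image_eqI[where x = 0]) simp_all
  next
    fix \<phi> \<phi>' assume "\<phi> \<in> d ` ?H" "\<phi>' \<in> d ` ?H"
    then obtain \<psi> \<psi>' where *: "\<psi> \<in> ?H" "\<phi> = d \<psi>" "\<psi>' \<in> ?H" "\<phi>' = d \<psi>'"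
      by (elim imageE)
    show "\<phi> + \<phi>' \<in> d ` ?H"
      unfolding *(2,4)
      using d_lin(2) hom_space.subspace_add[OF H *(1,3)]
      by (intro image_eqI[where x = "\<psi> + \<psi>'"]) simp_all
  next
    fix c \<phi> assume "\<phi> \<in> d ` ?H"
    then obtain \<psi> where *: "\<psi> \<in> ?H" "\<phi> = d \<psi>"
      by (elim imageE)
    show "hscale c \<phi> \<in> d ` ?H"
      unfolding *(2)
      using d_lin(3) hom_space.subspace_scale[OF H *(1)]
      by (intro image_eqI[where x = "hscale c \<psi>"]) simp_all
  qed
  then show ?thesis
    by (simp only: ext1_coboundaries_def d_def)
qed

lemma ext1_cocycles_finite_dim:
  assumes "finite (carrier G)" "finite X" "W \<subseteq> free_space X"
  shows "\<exists>B. finite B \<and> ext1_cocycles G W \<sigma> \<subseteq> hom_space.span B"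
proof -
  let ?Y = "bar_basis G 1"
  define E :: "'a list \<times> 'c \<Rightarrow> ('a list \<Rightarrow> 'd) \<Rightarrow> 'c \<Rightarrow> 'd" where
    "E = (\<lambda>(y, x) v. if v \<in> bar_space G 1 then fscale (v y) (delta x) else 0)"
  have fin: "finite ?Y" by (rule finite_bar_basis[OF assms(1)])
  have "ext1_cocycles G W \<sigma> \<subseteq> hom_space.span (E ` (?Y \<times> X))"
  proof
    fix \<phi> assume "\<phi> \<in> ext1_cocycles G W \<sigma>"
    then have \<phi>: "\<phi> \<in> FG_hom G (bar_space G 1) (bar_act G 1) W \<sigma>"
      by (simp add: ext1_cocycles_def)
    have sub: "fun_space.subspace (bar_space G 1)"
      by (simp add: bar_space_def subspace_free_space)
    have add: "\<phi> (v + w) = \<phi> v + \<phi> w" if "v \<in> bar_space G 1" "w \<in> bar_space G 1" for v w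
      using \<phi> that by (simp add: FG_hom_def)
    have scale: "\<phi> (fscale c v) = fscale c (\<phi> v)" if "v \<in> bar_space G 1" for c v
      using \<phi> that by (simp add: FG_hom_def)
    have zero: "\<phi> 0 = 0"
      using scale[OF fun_space.subspace_0[OF sub], of 0] by simp
    have sum: "\<phi> (sum h I) = (\<Sum>i\<in>I. \<phi> (h i))" if "\<And>i. i \<in> I \<Longrightarrow> h i \<in> bar_space G 1" for h and I :: "'a list set"
      using that
    proof (induction I rule: infinite_finite_induct)
      case (infinite I)
      show ?case unfolding sum.infinite[OF infinite(1)] by (rule zero)
    next
      case empty
      show ?case unfolding sum.empty by (rule zero)
    next
      case (insert i I)
      have "\<phi> (sum h (insert i I)) = \<phi> (h i) + \<phi> (sum h I)"
        unfolding sum.insert[OF insert.hyps]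
        by (rule add[OF insert.prems[OF insertI1] fun_space.subspace_sum[OF sub]])
          (rule insert.prems, rule insertI2)
      also have "\<phi> (sum h I) = (\<Sum>i\<in>I. \<phi> (h i))"
        by (rule insert.IH) (rule insert.prems, rule insertI2)
      finally show ?case unfolding sum.insert[OF insert.hyps] .
    qed
    have dl: "delta y \<in> bar_space G 1" if "y \<in> ?Y" for y
      using that by (simp add: bar_space_def delta_free_space)
    have exp: "\<phi> v = lin_ext ?Y (\<lambda>y. lin_ext X delta (\<phi> (delta y))) v" if v: "v \<in> bar_space G 1" for v
    proof -
      have "v = (\<Sum>y\<in>?Y. fscale (v y) (delta y))"
        using free_space_expand[OF fin v[unfolded bar_space_def]] unfolding lin_ext_def .
      then have "\<phi> v = \<phi> (\<Sum>y\<in>?Y. fscale (v y) (delta y))" by (rule arg_cong)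
      also have "\<dots> = (\<Sum>y\<in>?Y. fscale (v y) (\<phi> (delta y)))"
        by (subst sum, rule fun_space.subspace_scale[OF sub dl], assumption)
          (rule sum.cong[OF refl scale[OF dl]])
      also have "\<dots> = (\<Sum>y\<in>?Y. fscale (v y) (lin_ext X delta (\<phi> (delta y))))"
      proof (intro sum.cong refl arg_cong2[of _ _ _ _ fscale] free_space_expand assms(2))
        fix y assume "y \<in> ?Y"
        then show "\<phi> (delta y) \<in> free_space X"
          using \<phi> dl assms(3) by (auto simp: FG_hom_def)
      qed
      finally show ?thesis by (simp add: lin_ext_def)
    qed
    have sum_app: "sum h I v = (\<Sum>i\<in>I. h i v)"
      for h :: "'i \<Rightarrow> ('a list \<Rightarrow> 'd) \<Rightarrow> 'c \<Rightarrow> 'd" and I v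
      by (induction I rule: infinite_finite_induct) auto
    have "\<phi> = (\<Sum>y\<in>?Y. \<Sum>x\<in>X. hscale (\<phi> (delta y) x) (E (y, x)))"
    proof
      fix v
      show "\<phi> v = (\<Sum>y\<in>?Y. \<Sum>x\<in>X. hscale (\<phi> (delta y) x) (E (y, x))) v"
      proof (cases "v \<in> bar_space G 1")
        case True
        then have E: "hscale c (E (y, x)) v = fscale (v y) (fscale c (delta x))" for c y x
          by (simp only: E_def hscale_def prod.case if_True fun_space.scale_left_commute[of c])
        show ?thesis
          unfolding exp[OF True] sum_app E
          by (simp only: lin_ext_def fun_space.scale_sum_right)
      next
        case False
        then show ?thesis
          using \<phi> by (simp add: sum_app E_def hscale_def FG_hom_def)
      qed
    qed
    also have "\<dots> \<in> hom_space.span (E ` (?Y \<times> X))"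
      by (rule hom_space.span_sum, rule hom_space.span_sum, rule hom_space.span_scale,
          rule hom_space.span_base) simp
    finally show "\<phi> \<in> hom_space.span (E ` (?Y \<times> X))" .
  qed
  moreover have "finite (E ` (?Y \<times> X))"
    using fin assms(2) by (intro finite_imageI finite_cartesian_product)
  ultimately show ?thesis by (intro exI conjI)
qed


section \<open>Specht modules\<close>

text \<open>
  A partition \<open>(\<lambda>\<^sub>1, \<dots>, \<lambda>\<^sub>r)\<close> is the list of its (positive) parts; \<open>part\<close> gives access to the parts
  with indices starting from 1.
\<close>

definition partition_of :: "nat \<Rightarrow> nat list \<Rightarrow> bool" where
  "partition_of n lam \<longleftrightarrow> sum_list lam = n \<and> sorted_wrt (\<ge>) lam \<and> (\<forall>x\<in>set lam. x > 0)"

definition part :: "nat list \<Rightarrow> nat \<Rightarrow> nat" where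
  "part lam i = lam ! (i - 1)"

definition diagram :: "nat list \<Rightarrow> (nat \<times> nat) set" where
  "diagram lam = {(i, j). i \<in> {1..length lam} \<and> j \<in> {1..part lam i}}"

text \<open>
  Tableaux take the value 0 outside the diagram. Since permutations of \<open>{1..n}\<close> fix 0,
  the symmetric group acts on them by composition.
\<close>

definition tableaux :: "nat list \<Rightarrow> (nat \<times> nat \<Rightarrow> nat) set" where
  "tableaux lam = {t. bij_betw t (diagram lam) {1..sum_list lam} \<and> (\<forall>x. x \<notin> diagram lam \<longrightarrow> t x = 0)}"

definition row_entries :: "nat list \<Rightarrow> (nat \<times> nat \<Rightarrow> nat) \<Rightarrow> nat \<Rightarrow> nat set" where
  "row_entries lam t i = {t (i, j) |j. (i, j) \<in> diagram lam}"

definition col_entries :: "nat list \<Rightarrow> (nat \<times> nat \<Rightarrow> nat) \<Rightarrow> nat \<Rightarrow> nat set" where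
  "col_entries lam t j = {t (i, j) |i. (i, j) \<in> diagram lam}"

definition row_equiv :: "nat list \<Rightarrow> ((nat \<times> nat \<Rightarrow> nat) \<times> (nat \<times> nat \<Rightarrow> nat)) set" where
  "row_equiv lam = {(s, t). s \<in> tableaux lam \<and> t \<in> tableaux lam \<and>
     (\<forall>i. row_entries lam s i = row_entries lam t i)}"

type_synonym tabloid = "(nat \<times> nat \<Rightarrow> nat) set"

definition tabloids :: "nat list \<Rightarrow> tabloid set" where
  "tabloids lam = tableaux lam // row_equiv lam"

definition tabloid_of :: "nat list \<Rightarrow> (nat \<times> nat \<Rightarrow> nat) \<Rightarrow> tabloid" where
  "tabloid_of lam t = row_equiv lam `` {t}"

definition column_stabilizer :: "nat list \<Rightarrow> (nat \<times> nat \<Rightarrow> nat) \<Rightarrow> (nat \<Rightarrow> nat) set" where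
  "column_stabilizer lam t =
     {\<pi> \<in> carrier (sym_group (sum_list lam)). \<forall>j. \<pi> ` col_entries lam t j = col_entries lam t j}"

definition perm_module :: "nat list \<Rightarrow> (tabloid \<Rightarrow> 'f::field) set" where
  "perm_module lam = free_space (tabloids lam)"

definition perm_module_act ::
  "nat list \<Rightarrow> (nat \<Rightarrow> nat) \<Rightarrow> (tabloid \<Rightarrow> 'f::field) \<Rightarrow> (tabloid \<Rightarrow> 'f)" where
  "perm_module_act lam \<pi> = lin_ext (tabloids lam) (\<lambda>T. delta ((\<lambda>t. \<pi> \<circ> t) ` T))"

definition polytabloid :: "nat list \<Rightarrow> (nat \<times> nat \<Rightarrow> nat) \<Rightarrow> (tabloid \<Rightarrow> 'f::field)" where
  "polytabloid lam t =
     (\<Sum>\<pi>\<in>column_stabilizer lam t. fscale (of_int (sign \<pi>)) (delta (tabloid_of lam (\<pi> \<circ> t))))"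

definition specht_module :: "nat list \<Rightarrow> (tabloid \<Rightarrow> 'f::field) set" where
  "specht_module lam = fun_space.span (polytabloid lam ` tableaux lam)"


section \<open>James partitions and their segments\<close>

definition digit :: "nat \<Rightarrow> nat \<Rightarrow> nat \<Rightarrow> nat" where
  "digit p x i = x div p ^ i mod p"

definition lp :: "nat \<Rightarrow> nat \<Rightarrow> nat" where
  "lp p x = (GREATEST i. digit p x i \<noteq> 0)"

definition valp :: "nat \<Rightarrow> nat \<Rightarrow> nat" where
  "valp p x = (LEAST i. digit p x i \<noteq> 0)"

definition james_partition :: "nat \<Rightarrow> nat list \<Rightarrow> bool" where
  "james_partition p lam \<longleftrightarrow>
     (\<forall>i j. 1 \<le> i \<longrightarrow> i < length lam \<longrightarrow> 1 \<le> j \<longrightarrow> j \<le> part lam (i + 1) \<longrightarrow>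
        p dvd ((part lam i + j) choose j))"

definition segment :: "nat \<Rightarrow> nat list \<Rightarrow> nat \<Rightarrow> nat set" where
  "segment p lam s = {t \<in> {1..length lam}. lp p (part lam s) = lp p (part lam t)}"

definition adjacent :: "nat \<Rightarrow> nat list \<Rightarrow> nat \<Rightarrow> nat \<Rightarrow> bool" where
  "adjacent p lam s t \<longleftrightarrow> s \<in> {1..length lam} \<and> t \<in> {1..length lam} \<and>
     (t \<in> segment p lam s \<or>
      1 < s \<and> s < length lam \<and> t = s + 1 \<and> segment p lam t = {t} \<and>
      part lam s = p ^ valp p (part lam (s - 1) + 1) - 1)"

definition p_segments :: "nat \<Rightarrow> nat list \<Rightarrow> nat set set" where
  "p_segments p lam = {1..length lam} //
     {(s, t). s \<in> {1..length lam} \<and> t \<in> {1..length lam} \<and> equivclp (adjacent p lam) s t}"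

end

theory Submission
  imports Defs
begin

text \<open>
  A cocycle with values in \<open>S\<^sup>\<lambda> \<subseteq> M\<^sup>\<lambda>\<close> becomes a coboundary in \<open>M\<^sup>\<lambda>\<close>: the stabiliser of a tabloid is
  generated by transpositions, so it has no nonzero homomorphism to a field in which \<open>2 \<noteq> 0\<close>. Hence
  the cocycle is \<open>\<pi> \<mapsto> \<pi> m - m\<close> for some \<open>m \<in> M\<^sup>\<lambda>\<close>, which can be chosen linearly in the cocycle
  (\<open>primitive\<close>). By James' kernel intersection theorem (\<open>kernel_intersection_subset\<close>,
  \<open>raise_specht\<close>), \<open>S\<^sup>\<lambda>\<close> consists of the vectors killed by all the maps \<open>E\<^sub>i\<^sup>(\<^sup>a\<^sup>)\<close> with \<open>i, a > 0\<close> that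
  move \<open>a\<close> points from row \<open>i + 1\<close> to row \<open>i\<close> in all possible ways. Since \<open>\<pi> m - m\<close> lies in \<open>S\<^sup>\<lambda>\<close>,
  the image \<open>E\<^sub>i\<^sup>(\<^sup>a\<^sup>) m\<close> is fixed by the symmetric group, so it is a scalar \<open>c\<^sub>i(a)\<close> times the sum of all
  tabloids of the new shape; and if all these scalars vanish, then \<open>m \<in> S\<^sup>\<lambda>\<close> and the cocycle is a
  coboundary. Therefore the dimension of \<open>H\<^sup>1\<close> is at most the number of scalars \<open>c\<^sub>i(a)\<close> whose
  vanishing forces all of them to vanish (\<open>H1_dim_specht_le\<close>).

  The scalars satisfy relations coming from products of the operators. The identity
  \<open>E\<^sub>i\<^sup>(\<^sup>a\<^sup>) E\<^sub>i\<^sup>(\<^sup>b\<^sup>) = (a + b choose a) E\<^sub>i\<^sup>(\<^sup>a\<^sup>+\<^sup>b\<^sup>)\<close> gives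
  \<open>(a + b choose a) c\<^sub>i(a + b) = (\<lambda>\<^sub>i + a + b choose a) c\<^sub>i(b)\<close>. For a James partition,
  \<open>p\<^sup>l\<^sup>+\<^sup>1\<close> divides \<open>\<lambda>\<^sub>i + 1\<close> with \<open>l = l\<^sub>p(\<lambda>\<^sub>i\<^sub>+\<^sub>1)\<close>, and then \<open>c\<^sub>i\<close> is determined by \<open>c\<^sub>i(p\<^sup>l)\<close>:
  each of the rows \<open>2, \<dots>, r\<close> contributes one parameter. Commuting \<open>E\<^sub>i\<close> past \<open>E\<^sub>i\<^sub>+\<^sub>1\<close> relates the
  parameters of rows \<open>i + 1\<close> and \<open>i + 2\<close> when \<open>\<lambda>\<^sub>i\<^sub>+\<^sub>1 + 1 = p\<^sup>v\<close>. If the two rows lie in the same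
  segment, vanishing of the lower parameter implies vanishing of the upper one
  (\<open>val_zero_same_segment\<close>); if they do not, but \<open>v = val\<^sub>p(\<lambda>\<^sub>i + 1)\<close>, the lower parameter is zero
  (\<open>val_zero_special\<close>), and this second condition is the one in the definition of adjacency. So it
  suffices to keep the parameters of the last rows of the segments, leaving out the single-row
  segments attached to the row above (\<open>free_row\<close>). Different free rows lie in different
  \<open>p\<close>-segments; and if \<open>l\<^sub>p(\<lambda>\<^sub>1) > l\<^sub>p(\<lambda>\<^sub>2)\<close>, the \<open>p\<close>-segment of row 1 contains no free row, which
  improves the bound by one.
\<close>

section \<open>Binomial coefficients modulo a prime\<close>

lemma prime_dvd_prime_power_choose:
  fixes p :: nat
  assumes "prime p" "0 < i" "i < p ^ k"
  shows "p dvd (p ^ k choose i)"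
proof (rule ccontr)
  assume "\<not> p dvd (p ^ k choose i)"
  with assms(1) have "coprime (p ^ k) (p ^ k choose i)"
    by (simp add: prime_imp_coprime coprime_commute)
  moreover have "p ^ k dvd i * (p ^ k choose i)"
    using binomial_absorption[of "i - 1" "p ^ k"] assms(2) by simp
  ultimately have "p ^ k dvd i"
    by (simp add: coprime_dvd_mult_left_iff)
  with assms(2,3) show False by (auto dest: dvd_imp_le)
qed

text \<open>
  The only instance of Lucas' theorem that occurs below. Raising the upper index by \<open>p\<^sup>k\<close> adds 1
  to the binomial coefficient, because in Vandermonde's identity all inner terms vanish modulo \<open>p\<close>.
\<close>

lemma choose_prime_power:
  fixes p :: nat
  assumes p: "prime p" "CHAR('f::field) = p"
  shows "(of_nat (N choose p ^ k) :: 'f) = of_nat (N div p ^ k)"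
proof (induction N rule: less_induct)
  case (less N)
  let ?q = "p ^ k"
  have q: "?q > 0" using p(1) by (simp add: prime_gt_0_nat)
  show ?case
  proof (cases "N < ?q")
    case True
    then show ?thesis by (simp add: binomial_eq_0)
  next
    case False
    define M where "M = N - ?q"
    have N: "N = M + ?q" using False by (simp add: M_def)
    have zero: "(of_nat ((M choose i) * (?q choose (?q - i))) :: 'f) = 0" if "0 < i" "i < ?q" for i
      using prime_dvd_prime_power_choose[OF p(1), of "?q - i" k] that p(2)
      by (subst of_nat_eq_0_iff_char_dvd) simp
    have "(of_nat (N choose ?q) :: 'f) = (\<Sum>i\<le>?q. of_nat ((M choose i) * (?q choose (?q - i))))"
      unfolding N vandermonde[of M ?q ?q, symmetric] of_nat_sum ..
    also have "\<dots> = (\<Sum>i\<in>{0, ?q}. of_nat ((M choose i) * (?q choose (?q - i))))"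
      by (rule sum.mono_neutral_right) (use zero in \<open>auto simp del: of_nat_mult\<close>)
    also have "\<dots> = 1 + of_nat (M choose ?q)" using q by simp
    also have "\<dots> = of_nat (N div ?q)"
      using less.IH[of M] q by (simp add: N)
    finally show ?thesis .
  qed
qed

section \<open>Dimension and linear functionals\<close>

context vector_space
begin

lemma dim_le_dim_kernel:
  assumes Z: "subspace Z" and fin: "finite T" "Z \<subseteq> span T"
    and add: "\<And>x y. x \<in> Z \<Longrightarrow> y \<in> Z \<Longrightarrow> L (x + y) = L x + L y"
    and scale: "\<And>c x. x \<in> Z \<Longrightarrow> L (c *s x) = c * L x"
  shows "dim Z \<le> dim {z \<in> Z. L z = 0} + 1"
proof -
  let ?K = "{z \<in> Z. L z = 0}"
  obtain A where A: "A \<subseteq> ?K" "independent A" "?K \<subseteq> span A" "card A = dim ?K"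
    by (rule basis_exists)
  have finA: "finite A"
    using independent_span_bound[OF fin(1) A(2)] A(1) fin(2) by auto
  show ?thesis
  proof (cases "\<forall>z\<in>Z. L z = 0")
    case True
    then have "?K = Z" by auto
    then show ?thesis by simp
  next
    case False
    then obtain z0 where z0: "z0 \<in> Z" "L z0 \<noteq> 0" by auto
    have "Z \<subseteq> span (insert z0 A)"
    proof
      fix z assume z: "z \<in> Z"
      let ?c = "L z / L z0"
      have "z + (- ?c) *s z0 \<in> ?K"
        using z z0 Z by (auto simp: add scale subspace_add subspace_scale simp del: scale_minus_left)
      then have "z + (- ?c) *s z0 \<in> span (insert z0 A)"
        using A(3) span_mono[of A "insert z0 A"] by blast
      moreover have "?c *s z0 \<in> span (insert z0 A)"
        by (intro span_scale span_base) simp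
      ultimately have "(z + (- ?c) *s z0) + ?c *s z0 \<in> span (insert z0 A)"
        by (rule span_add)
      then show "z \<in> span (insert z0 A)" by simp
    qed
    then have "dim Z \<le> card (insert z0 A)"
      by (rule dim_le_card) (use finA in simp)
    also have "\<dots> \<le> dim ?K + 1" using A(4) by (metis Suc_eq_plus1 card_insert_le_m1 card_insert_disjoint finA insert_absorb le_add1 order.refl)
    finally show ?thesis .
  qed
qed

text \<open>
  The functionals embed the quotient \<open>Z / B\<close> into the space of functions on \<open>R\<close>.
\<close>

lemma dim_le_dim_plus_functionals:
  assumes "finite R" and Z: "subspace Z" and fin: "finite T" "Z \<subseteq> span T"
    and B: "B \<subseteq> Z"
    and add: "\<And>t x y. t \<in> R \<Longrightarrow> x \<in> Z \<Longrightarrow> y \<in> Z \<Longrightarrow> L t (x + y) = L t x + L t y"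
    and scale: "\<And>t c x. t \<in> R \<Longrightarrow> x \<in> Z \<Longrightarrow> L t (c *s x) = c * L t x"
    and ker: "\<And>z. z \<in> Z \<Longrightarrow> (\<And>t. t \<in> R \<Longrightarrow> L t z = 0) \<Longrightarrow> z \<in> B"
  shows "dim Z \<le> dim B + card R"
  using assms
proof (induction R arbitrary: Z B rule: finite_induct)
  case empty
  then have "B = Z" by auto
  then show ?case by simp
next
  case (insert t R)
  let ?K = "{z \<in> Z. L t z = 0}"
  let ?B = "{z \<in> B. L t z = 0}"
  have L0: "L t 0 = 0"
    using insert.prems(6)[of t 0 0] subspace_0[OF insert.prems(1)] by simp
  have sub: "subspace ?K"
    using insert.prems(1,5,6) L0 by (auto simp: subspace_def)
  have "dim ?K \<le> dim ?K + card R" by simp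
  have "dim Z \<le> dim ?K + 1"
    by (rule dim_le_dim_kernel[OF insert.prems(1-3)]) (use insert.prems(5,6) in auto)
  also have "dim ?K \<le> dim (B \<inter> ?K) + card R"
  proof (rule insert.IH[OF sub insert.prems(2)])
    show "?K \<subseteq> span T" using insert.prems(3) by auto
    show "B \<inter> ?K \<subseteq> ?K" by auto
    show "z \<in> B \<inter> ?K" if "z \<in> ?K" "\<And>t. t \<in> R \<Longrightarrow> L t z = 0" for z
      using that insert.prems(7)[of z] by auto
  qed (use insert.prems(5,6) in auto)
  also have "dim (B \<inter> ?K) \<le> dim B"
  proof -
    obtain A where A: "A \<subseteq> B" "independent A" "B \<subseteq> span A" "card A = dim B"
      by (rule basis_exists)
    have "finite A"
      using independent_span_bound[OF fin(1) A(2)] A(1) insert.prems(3,4) fin(1)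
        independent_span_bound[OF insert.prems(2) A(2)] by blast
    then show ?thesis using dim_le_card[of "B \<inter> ?K" A] A(3,4) by auto
  qed
  finally show ?case using insert.hyps by simp
qed

end

section \<open>Divided powers of the raising operators on colourings\<close>

text \<open>
  A tabloid with point set \<open>X\<close> is encoded by the colouring \<open>g\<close> that sends each point to the number
  of its row, and points outside \<open>X\<close> to 0. Every tabloid is then represented by one function, and
  the tabloids of all shapes live in one type.
\<close>

definition row :: "nat set \<Rightarrow> (nat \<Rightarrow> nat) \<Rightarrow> nat \<Rightarrow> nat set" where
  "row X g i = {x \<in> X. g x = i}"

definition recolor :: "nat set \<Rightarrow> nat \<Rightarrow> (nat \<Rightarrow> nat) \<Rightarrow> (nat \<Rightarrow> nat)" where
  "recolor S j g = (\<lambda>x. if x \<in> S then j else g x)"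

definition subsets :: "'a set \<Rightarrow> nat \<Rightarrow> 'a set set" where
  "subsets Y a = {S. S \<subseteq> Y \<and> card S = a}"

text \<open>
  The operator \<open>E\<^sub>i\<^sup>(\<^sup>a\<^sup>)\<close> in coordinates: \<open>m\<close> is a linear combination of tabloids, given by its
  coefficients, and the tabloids that contribute to the coefficient of \<open>g\<close> arise from \<open>g\<close> by
  returning a set \<open>S\<close> of \<open>a\<close> points from row \<open>i\<close> to row \<open>i + 1\<close>.
\<close>

definition raise :: "nat set \<Rightarrow> nat \<Rightarrow> nat \<Rightarrow> ((nat \<Rightarrow> nat) \<Rightarrow> 'f::field) \<Rightarrow> (nat \<Rightarrow> nat) \<Rightarrow> 'f" where
  "raise X i a m g = (\<Sum>S\<in>subsets (row X g i) a. m (recolor S (Suc i) g))"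

definition colorings :: "nat set \<Rightarrow> (nat \<Rightarrow> nat) \<Rightarrow> (nat \<Rightarrow> nat) set" where
  "colorings X \<mu> = {g. (\<forall>x. x \<notin> X \<longrightarrow> g x = 0) \<and> (\<forall>i. card (row X g i) = \<mu> i)}"

lemma finite_row: "finite X \<Longrightarrow> finite (row X g i)"
  by (simp add: row_def)

lemma finite_subsets: "finite Y \<Longrightarrow> finite (subsets Y a)"
  by (simp add: subsets_def)

lemma card_subsets: "finite Y \<Longrightarrow> card (subsets Y a) = card Y choose a"
  by (simp add: subsets_def n_subsets)

lemma row_recolor_source:
  "i \<noteq> j \<Longrightarrow> row X (recolor S j g) i = row X g i - S"
  by (auto simp: row_def recolor_def)

lemma row_recolor_target:
  "S \<subseteq> X \<Longrightarrow> row X (recolor S j g) j = row X g j \<union> S"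
  by (auto simp: row_def recolor_def)

lemma recolor_recolor: "recolor T j (recolor S j g) = recolor (S \<union> T) j g"
  by (auto simp: recolor_def)

lemma raise_diff: "raise X i a (\<lambda>f. m f - m' f) g = raise X i a m g - raise X i a m' g"
  by (simp add: raise_def sum_subtractf)

lemma raise_add: "raise X i a (\<lambda>f. m f + m' f) g = raise X i a m g + raise X i a m' g"
  by (simp add: raise_def sum.distrib)

lemma raise_scale: "raise X i a (\<lambda>f. c * m f) g = c * raise X i a m g"
  by (simp add: raise_def sum_distrib_left)

lemma sum_disjoint_subsets:
  fixes F :: "'a set \<Rightarrow> 'f::field"
  assumes Y: "finite Y"
  shows "(\<Sum>S\<in>subsets Y a. \<Sum>T\<in>subsets (Y - S) b. F (S \<union> T)) =
    of_nat ((a + b) choose a) * (\<Sum>U\<in>subsets Y (a + b). F U)"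
proof -
  have fin: "finite S" if "S \<subseteq> Y" for S using Y that by (rule rev_finite_subset)
  have "(\<Sum>S\<in>subsets Y a. \<Sum>T\<in>subsets (Y - S) b. F (S \<union> T)) =
      (\<Sum>(S, T)\<in>(SIGMA S:subsets Y a. subsets (Y - S) b). F (S \<union> T))"
    by (rule sum.Sigma) (use Y in \<open>auto simp: finite_subsets\<close>)
  also have "\<dots> = (\<Sum>(U, S)\<in>(SIGMA U:subsets Y (a + b). subsets U a). F U)"
  proof (rule sum.reindex_bij_witness[of _ "\<lambda>(U, S). (S, U - S)" "\<lambda>(S, T). (S \<union> T, S)"])
    fix x assume x: "x \<in> (SIGMA S:subsets Y a. subsets (Y - S) b)"
    obtain S T where ST: "x = (S, T)" by (cases x)
    from x have *: "S \<subseteq> Y" "T \<subseteq> Y - S" "card S = a" "card T = b" by (auto simp: ST subsets_def)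
    then have "card (S \<union> T) = a + b" by (subst card_Un_disjoint) (auto intro: fin)
    with * show "(case x of (S, T) \<Rightarrow> (S \<union> T, S)) \<in> (SIGMA U:subsets Y (a + b). subsets U a)"
      by (auto simp: ST subsets_def)
  next
    fix x assume x: "x \<in> (SIGMA U:subsets Y (a + b). subsets U a)"
    obtain U S where ST: "x = (U, S)" by (cases x)
    from x have *: "U \<subseteq> Y" "S \<subseteq> U" "card S = a" "card U = a + b" by (auto simp: ST subsets_def)
    then have "card (U - S) = b" by (subst card_Diff_subset) (auto intro: fin)
    with * show "(case x of (U, S) \<Rightarrow> (S, U - S)) \<in> (SIGMA S:subsets Y a. subsets (Y - S) b)"
      by (auto simp: ST subsets_def)
  qed (auto simp: subsets_def Un_absorb1)
  also have "\<dots> = (\<Sum>U\<in>subsets Y (a + b). \<Sum>S\<in>subsets U a. F U)"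
    by (rule sum.Sigma[symmetric]) (use Y fin in \<open>auto simp: finite_subsets subsets_def\<close>)
  also have "\<dots> = (\<Sum>U\<in>subsets Y (a + b). of_nat ((a + b) choose a) * F U)"
    using fin by (intro sum.cong) (auto simp: subsets_def n_subsets)
  finally show ?thesis by (simp add: sum_distrib_left)
qed

lemma raise_raise_same:
  assumes "finite X"
  shows "raise X i a (raise X i b m) g = of_nat ((a + b) choose a) * raise X i (a + b) m g"
  unfolding raise_def
  by (simp add: row_recolor_source recolor_recolor
      sum_disjoint_subsets[OF finite_row[OF assms], where F = "\<lambda>S. m (recolor S (Suc i) g)"])

text \<open>
  The commutation rule for neighbouring operators. On the left, the points \<open>S\<close> go from row \<open>i\<close> to
  \<open>i + 1\<close>, and then the points \<open>T\<close> go from row \<open>i + 1\<close> to \<open>i + 2\<close>. On the right, the points of \<open>T\<close>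
  go to row \<open>i + 2\<close> first, those of \<open>S \<inter> T\<close> directly from row \<open>i\<close>, and \<open>S - T\<close> remains to be moved
  to row \<open>i + 1\<close>. Since \<open>b \<le> a\<close>, the truncated difference is an honest one.
\<close>

lemma raise_raise_next:
  assumes X: "finite X" and ba: "b \<le> a"
  shows "raise X i a (raise X (Suc i) b m) g =
    (\<Sum>T\<in>subsets (row X g i \<union> row X g (Suc i)) b.
       raise X i (a - card (T \<inter> row X g i)) m (recolor T (Suc (Suc i)) g))"
proof -
  define Y1 Y2 where "Y1 = row X g i" and "Y2 = row X g (Suc i)"
  have finY: "finite Y1" "finite Y2" using X by (simp_all add: Y1_def Y2_def finite_row)
  have disj: "Y1 \<inter> Y2 = {}" by (auto simp: Y1_def Y2_def row_def)
  have fin: "finite S" if "S \<subseteq> Y1 \<union> Y2" for S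
    using finY that by (auto intro: finite_subset[of _ "Y1 \<union> Y2"])
  have row2: "row X (recolor S (Suc i) g) (Suc i) = Y2 \<union> S" if "S \<subseteq> Y1" for S
    using that by (subst row_recolor_target) (auto simp: Y1_def Y2_def row_def)
  have row1: "row X (recolor T (Suc (Suc i)) g) i = Y1 - T" for T
    by (simp add: row_recolor_source Y1_def)
  let ?m = "\<lambda>S T. m (recolor T (Suc (Suc i)) (recolor S (Suc i) g))"
  have "raise X i a (raise X (Suc i) b m) g = (\<Sum>S\<in>subsets Y1 a. \<Sum>T\<in>subsets (Y2 \<union> S) b. ?m S T)"
    unfolding raise_def Y1_def[symmetric]
    by (intro sum.cong refl arg_cong2[of _ _ _ _ subsets] row2) (auto simp: subsets_def)
  also have "\<dots> = (\<Sum>(S, T)\<in>(SIGMA S:subsets Y1 a. subsets (Y2 \<union> S) b). ?m S T)"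
    by (rule sum.Sigma) (use finY in \<open>auto intro!: finite_subsets fin simp: subsets_def[of Y1]\<close>)
  also have "\<dots> = (\<Sum>(T, S)\<in>(SIGMA T:subsets (Y1 \<union> Y2) b. subsets (Y1 - T) (a - card (T \<inter> Y1))).
      m (recolor S (Suc i) (recolor T (Suc (Suc i)) g)))"
  proof (rule sum.reindex_bij_witness[of _ "\<lambda>(T, S). (S \<union> (T \<inter> Y1), T)" "\<lambda>(S, T). (T, S - T)"])
    fix x assume x: "x \<in> (SIGMA S:subsets Y1 a. subsets (Y2 \<union> S) b)"
    obtain S T where ST: "x = (S, T)" by (cases x)
    from x have *: "S \<subseteq> Y1" "T \<subseteq> Y2 \<union> S" "card S = a" "card T = b" by (auto simp: ST subsets_def)
    have TY: "T \<inter> Y1 = S \<inter> T" using * disj by auto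
    have "card (S - T) = a - card (T \<inter> Y1)"
      using * unfolding TY by (subst card_Diff_subset_Int) (auto intro: fin)
    with * show "(case x of (S, T) \<Rightarrow> (T, S - T)) \<in>
        (SIGMA T:subsets (Y1 \<union> Y2) b. subsets (Y1 - T) (a - card (T \<inter> Y1)))"
      by (auto simp: ST subsets_def)
    show "(case case x of (S, T) \<Rightarrow> (T, S - T) of (T, S) \<Rightarrow> (S \<union> T \<inter> Y1, T)) = x"
      using * disj by (auto simp: ST)
    have "recolor (S - T) (Suc i) (recolor T (Suc (Suc i)) g) =
        recolor T (Suc (Suc i)) (recolor S (Suc i) g)"
      by (auto simp: recolor_def)
    then show "(case case x of (S, T) \<Rightarrow> (T, S - T) of (T, S) \<Rightarrow>
          m (recolor S (Suc i) (recolor T (Suc (Suc i)) g))) = (case x of (S, T) \<Rightarrow> ?m S T)"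
      by (simp add: ST)
  next
    fix x assume x: "x \<in> (SIGMA T:subsets (Y1 \<union> Y2) b. subsets (Y1 - T) (a - card (T \<inter> Y1)))"
    obtain S T where ST: "x = (T, S)" by (cases x)
    from x have *: "S \<subseteq> Y1 - T" "T \<subseteq> Y1 \<union> Y2" "card S = a - card (T \<inter> Y1)" "card T = b"
      by (auto simp: ST subsets_def)
    have "card (T \<inter> Y1) \<le> card T" using *(2) by (intro card_mono fin) auto
    then have le: "card (T \<inter> Y1) \<le> a" using * ba by simp
    have "card (S \<union> T \<inter> Y1) = card S + card (T \<inter> Y1)"
      using * by (intro card_Un_disjoint) (auto intro: fin)
    then have "card (S \<union> T \<inter> Y1) = a" using le *(3) by simp
    with * show "(case x of (T, S) \<Rightarrow> (S \<union> T \<inter> Y1, T)) \<in> (SIGMA S:subsets Y1 a. subsets (Y2 \<union> S) b)"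
      by (auto simp: ST subsets_def)
    show "(case case x of (T, S) \<Rightarrow> (S \<union> T \<inter> Y1, T) of (S, T) \<Rightarrow> (T, S - T)) = x"
      using * by (auto simp: ST)
  qed
  also have "\<dots> = (\<Sum>T\<in>subsets (Y1 \<union> Y2) b. \<Sum>S\<in>subsets (Y1 - T) (a - card (T \<inter> Y1)).
      m (recolor S (Suc i) (recolor T (Suc (Suc i)) g)))"
    by (rule sum.Sigma[symmetric]) (use finY fin in \<open>auto simp: finite_subsets\<close>)
  finally show ?thesis
    by (simp add: raise_def row1 Y1_def Y2_def row_recolor_source)
qed

lemma raise_permute:
  assumes \<pi>: "\<pi> permutes X"
  shows "raise X i a m (g \<circ> \<pi>) = raise X i a (\<lambda>f. m (f \<circ> \<pi>)) g"
proof -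
  have inj: "inj \<pi>" using \<pi> by (rule permutes_inj)
  have row: "\<pi> ` row X (g \<circ> \<pi>) i = row X g i"
  proof
    show "\<pi> ` row X (g \<circ> \<pi>) i \<subseteq> row X g i"
      using permutes_in_image[OF \<pi>] by (auto simp: row_def)
    show "row X g i \<subseteq> \<pi> ` row X (g \<circ> \<pi>) i"
    proof
      fix x assume x: "x \<in> row X g i"
      then obtain y where "x = \<pi> y" using permutes_surj[OF \<pi>] by (metis surjD)
      with x show "x \<in> \<pi> ` row X (g \<circ> \<pi>) i"
        using permutes_in_image[OF \<pi>] by (auto simp: row_def)
    qed
  qed
  have "bij_betw ((`) \<pi>) (subsets (row X (g \<circ> \<pi>) i) a) (subsets (row X g i) a)"
    unfolding bij_betw_def
  proof
    show "inj_on ((`) \<pi>) (subsets (row X (g \<circ> \<pi>) i) a)"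
      using inj by (simp add: inj_on_def inj_image_eq_iff)
    show "(`) \<pi> ` subsets (row X (g \<circ> \<pi>) i) a = subsets (row X g i) a"
      unfolding row[symmetric]
      by (auto simp: subsets_def subset_image_iff card_image[OF inj_on_subset[OF inj]])
  qed
  from sum.reindex_bij_betw[OF this, of "\<lambda>S. m (recolor S (Suc i) g \<circ> \<pi>)"]
  have "raise X i a (\<lambda>f. m (f \<circ> \<pi>)) g =
      (\<Sum>S\<in>subsets (row X (g \<circ> \<pi>) i) a. m (recolor (\<pi> ` S) (Suc i) g \<circ> \<pi>))"
    by (simp add: raise_def)
  also have "\<dots> = raise X i a m (g \<circ> \<pi>)"
    unfolding raise_def
  proof (intro sum.cong refl arg_cong[of _ _ m])
    show "recolor (\<pi> ` S) (Suc i) g \<circ> \<pi> = recolor S (Suc i) (g \<circ> \<pi>)" for S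
      using inj by (auto simp: recolor_def fun_eq_iff inj_image_mem_iff)
  qed
  finally show ?thesis ..
qed

text \<open>
  Inclusion and exclusion, organised as an induction: excluding one more point \<open>u\<close> changes the sum
  by the terms with \<open>u \<in> S\<close>, which form a sum of the same kind with \<open>u\<close> already moved to row
  \<open>i + 1\<close> and \<open>d\<close> lowered by one. These are the Garnir relations in dual form.
\<close>

lemma sum_avoiding_subsets_zero:
  assumes X: "finite X"
    and m: "\<And>h d. d > 0 \<Longrightarrow> raise X i d m h = 0"
    and U: "finite U" "U \<subseteq> row X h i" "card U < d"
  shows "(\<Sum>S\<in>subsets (row X h i - U) d. m (recolor S (Suc i) h)) = 0"
  using U
proof (induction U arbitrary: h d rule: finite_induct)
  case empty
  then show ?case using m[of d h] by (simp add: raise_def)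
next
  case (insert u U)
  let ?Y = "row X h i - U"
  let ?h = "recolor {u} (Suc i) h"
  obtain e where d: "d = Suc e" using insert.prems by (cases d) auto
  have u: "u \<in> ?Y" using insert by auto
  have finY: "finite ?Y" using X by (simp add: finite_row)
  have split: "subsets ?Y d = subsets (?Y - {u}) d \<union> insert u ` subsets (?Y - {u}) e"
  proof (intro equalityI subsetI)
    fix S assume S: "S \<in> subsets ?Y d"
    show "S \<in> subsets (?Y - {u}) d \<union> insert u ` subsets (?Y - {u}) e"
    proof (cases "u \<in> S")
      case True
      then have "S = insert u (S - {u})" by auto
      moreover have "S - {u} \<in> subsets (?Y - {u}) e"
        using S True by (auto simp: subsets_def d)
      ultimately show ?thesis by blast
    qed (use S in \<open>auto simp: subsets_def\<close>)
  next
    fix S assume S: "S \<in> subsets (?Y - {u}) d \<union> insert u ` subsets (?Y - {u}) e"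
    have "finite T" if "T \<subseteq> ?Y" for T using finY that by (rule rev_finite_subset)
    with S u show "S \<in> subsets ?Y d"
      by (auto simp: subsets_def d card_insert_if subset_Diff_insert)
  qed
  have "0 = (\<Sum>S\<in>subsets ?Y d. m (recolor S (Suc i) h))"
    using insert by simp
  also have "\<dots> = (\<Sum>S\<in>subsets (?Y - {u}) d. m (recolor S (Suc i) h)) +
      (\<Sum>S\<in>insert u ` subsets (?Y - {u}) e. m (recolor S (Suc i) h))"
    unfolding split
    by (rule sum.union_disjoint) (use finY in \<open>auto simp: finite_subsets subsets_def\<close>)
  also have "(\<Sum>S\<in>insert u ` subsets (?Y - {u}) e. m (recolor S (Suc i) h)) =
      (\<Sum>S\<in>subsets (?Y - {u}) e. m (recolor (insert u S) (Suc i) h))"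
  proof (rule sum.reindex[unfolded o_def])
    show "inj_on (insert u) (subsets (?Y - {u}) e)"
      unfolding inj_on_def subsets_def by (metis (no_types, lifting) Diff_insert_absorb mem_Collect_eq subset_Diff_insert)
  qed
  also have "\<dots> = (\<Sum>S\<in>subsets (row X ?h i - U) e. m (recolor S (Suc i) ?h))"
    by (simp add: row_recolor_source recolor_recolor Diff_insert2[symmetric] Diff_insert[symmetric])
  also have "\<dots> = 0"
    using insert by (intro insert.IH) (auto simp: row_recolor_source d)
  finally show ?case by (simp add: Diff_insert[symmetric])
qed

section \<open>Colourings of given content\<close>

lemma colorings_conjugate:
  assumes X: "finite X" and fg: "f \<in> colorings X \<mu>" "g \<in> colorings X \<mu>"
  obtains \<pi> where "\<pi> permutes X" "f \<circ> \<pi> = g"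
proof -
  have "image_mset g (mset_set X) = image_mset f (mset_set X)"
  proof (rule multiset_eqI)
    fix i
    have "count (image_mset h (mset_set X)) i = card (row X h i)" for h
      using X by (simp add: count_image_mset' row_def eq_commute conj_commute)
    then show "count (image_mset g (mset_set X)) i = count (image_mset f (mset_set X)) i"
      using fg by (simp add: colorings_def)
  qed
  from image_mset_eq_implies_permutes[OF X this]
  obtain \<pi> where \<pi>: "\<pi> permutes X" "\<forall>x\<in>X. g x = f (\<pi> x)" .
  have "f (\<pi> x) = g x" for x
    using \<pi> fg permutes_not_in[OF \<pi>(1)] by (cases "x \<in> X") (auto simp: colorings_def)
  then show thesis using \<pi>(1) by (intro that) auto
qed

lemma recolor_colorings:
  assumes X: "finite X" and g: "g \<in> colorings X \<mu>" and S: "S \<subseteq> row X g j" and ij: "i \<noteq> j"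
  shows "recolor S i g \<in> colorings X (\<mu>(i := \<mu> i + card S, j := \<mu> j - card S))"
  unfolding colorings_def
proof (intro CollectI conjI allI impI)
  have SX: "S \<subseteq> X" using S by (auto simp: row_def)
  then have finS: "finite S" using X by (rule finite_subset)
  show "recolor S i g x = 0" if "x \<notin> X" for x
    using that g SX by (auto simp: recolor_def colorings_def)
  have card: "card (row X g k) = \<mu> k" for k using g by (simp add: colorings_def)
  show "card (row X (recolor S i g) k) = (\<mu>(i := \<mu> i + card S, j := \<mu> j - card S)) k" for k
  proof -
    consider "k = i" | "k = j" | "k \<noteq> i" "k \<noteq> j" by blast
    then show ?thesis
    proof cases
      case 1
      have "card (row X g i \<union> S) = card (row X g i) + card S"
        by (rule card_Un_disjoint) (use X finS S ij in \<open>auto simp: row_def\<close>)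
      then show ?thesis using 1 ij card by (simp add: row_recolor_target[OF SX])
    next
      case 2
      then show ?thesis
        using ij card S finS by (simp add: row_recolor_source card_Diff_subset)
    next
      case 3
      then have "row X (recolor S i g) k = row X g k"
        using S by (auto simp: row_def recolor_def)
      then show ?thesis using 3 card by simp
    qed
  qed
qed

definition shift :: "nat \<Rightarrow> nat \<Rightarrow> (nat \<Rightarrow> nat) \<Rightarrow> nat \<Rightarrow> nat" where
  "shift i a \<mu> = \<mu>(i := \<mu> i + a, Suc i := \<mu> (Suc i) - a)"

lemma colorings_move_nonempty:
  assumes "finite X" "colorings X \<mu> \<noteq> {}" "i \<noteq> j" "a \<le> \<mu> j"
  shows "colorings X (\<mu>(i := \<mu> i + a, j := \<mu> j - a)) \<noteq> {}"
proof -
  obtain g where g: "g \<in> colorings X \<mu>" using assms(2) by blast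
  then have "a \<le> card (row X g j)" using assms(4) by (simp add: colorings_def)
  then obtain S where "S \<subseteq> row X g j" "card S = a"
    by (meson obtain_subset_with_card_n)
  then show ?thesis using recolor_colorings[OF assms(1) g, of S j i] assms(3) by auto
qed

lemma shift_nonempty:
  "finite X \<Longrightarrow> colorings X \<mu> \<noteq> {} \<Longrightarrow> a \<le> \<mu> (Suc i) \<Longrightarrow> colorings X (shift i a \<mu>) \<noteq> {}"
  unfolding shift_def by (rule colorings_move_nonempty) auto

text \<open>
  The scalar \<open>c\<^sub>i(a)\<close>. It is meaningful when \<open>raise X i a m\<close> is constant on the colourings of content
  \<open>shift i a \<mu>\<close> and there are such colourings, that is, when \<open>a \<le> \<mu> (i + 1)\<close>.
\<close>

definition raise_value ::
  "nat set \<Rightarrow> (nat \<Rightarrow> nat) \<Rightarrow> nat \<Rightarrow> nat \<Rightarrow> ((nat \<Rightarrow> nat) \<Rightarrow> 'f::field) \<Rightarrow> 'f" where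
  "raise_value X \<mu> i a m = raise X i a m (SOME g. g \<in> colorings X (shift i a \<mu>))"

section \<open>Sequences satisfying the one-row relation\<close>

text \<open>
  Here \<open>A\<close> and \<open>B\<close> are the lengths of two consecutive rows, and \<open>c a\<close> is the scalar \<open>c\<^sub>i(a)\<close>. In
  characteristic 0 and with \<open>A = -1\<close> the relation would say that \<open>a c(a)\<close> is constant.
\<close>

locale row_sequence =
  fixes p A B l :: nat and c :: "nat \<Rightarrow> 'f::field"
  assumes p: "prime p" and char: "CHAR('f) = p"
    and A: "p ^ Suc l dvd A + 1" and B: "p ^ l \<le> B" "B < p ^ Suc l"
    and rel: "\<And>a b. 0 < a \<Longrightarrow> 0 < b \<Longrightarrow> a + b \<le> B \<Longrightarrow>
      of_nat ((a + b) choose a) * c (a + b) = of_nat ((A + a + b) choose a) * c b"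
begin

lemma of_nat_zero_iff: "(of_nat k :: 'f) = 0 \<longleftrightarrow> p dvd k"
  by (simp add: of_nat_eq_0_iff_char_dvd char)

lemma p_pow_pos: "p ^ j > 0"
  using p by (simp add: prime_gt_0_nat)

text \<open>
  The relation for \<open>a = p\<^sup>j\<close> and \<open>b = u p\<^sup>j\<close>. Since \<open>A \<equiv> -1\<close> modulo \<open>p\<^sup>j\<^sup>+\<^sup>1\<close>, both coefficients are
  determined by \<open>u\<close>.
\<close>

lemma step:
  assumes j: "j \<le> l" and u: "u > 0" "Suc u * p ^ j \<le> B"
  shows "of_nat (Suc u) * c (Suc u * p ^ j) = of_nat u * c (u * p ^ j)"
proof -
  have "p ^ Suc j dvd A + 1"
    using A j by (meson Suc_le_mono dvd_trans le_imp_power_dvd)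
  then obtain w where w: "A + 1 = p ^ Suc j * w" by (rule dvdE)
  then have "A + p ^ j = p ^ Suc j * w + (p ^ j - 1)"
    using p_pow_pos[of j] by linarith
  then have "A + p ^ j + u * p ^ j = p ^ j * (p * w + u) + (p ^ j - 1)"
    by (simp add: algebra_simps)
  also have "\<dots> div p ^ j = p * w + u"
    using p_pow_pos[of j] by (subst div_mult_self4) simp_all
  finally have "(of_nat ((A + p ^ j + u * p ^ j) choose p ^ j) :: 'f) = of_nat (p * w + u)"
    by (simp only: choose_prime_power[OF p char])
  also have "\<dots> = of_nat u" using of_nat_zero_iff[of p] by simp
  finally have 1: "(of_nat ((A + p ^ j + u * p ^ j) choose p ^ j) :: 'f) = of_nat u" .
  have 2: "(of_nat ((p ^ j + u * p ^ j) choose p ^ j) :: 'f) = of_nat (Suc u)"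
    using p_pow_pos[of j]
    by (simp only: choose_prime_power[OF p char]) (simp add: div_mult_self4)
  show ?thesis
    using rel[of "p ^ j" "u * p ^ j"] u p_pow_pos[of j] unfolding 1 2 by simp
qed

lemma descend:
  assumes "j \<le> l" "0 < u" "u < p" "u * p ^ j \<le> B" "c (u * p ^ j) = 0"
  shows "c (p ^ j) = 0"
  using assms(2-)
proof (induction u)
  case (Suc u)
  show ?case
  proof (cases "u = 0")
    case False
    have "of_nat u * c (u * p ^ j) = 0"
      using step[of j u] assms(1) False Suc.prems by simp
    moreover have "(of_nat u :: 'f) \<noteq> 0"
      using False Suc.prems by (auto simp: of_nat_zero_iff dest: dvd_imp_le)
    ultimately show ?thesis using Suc False by (auto simp: algebra_simps)
  qed (use Suc in simp)
qed simp

text \<open>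
  If \<open>p\<^sup>j\<^sup>+\<^sup>1 \<le> B\<close>, the last possible step, from \<open>u = p - 1\<close> to \<open>p\<close>, has left-hand side 0. This kills
  \<open>c ((p - 1) p\<^sup>j)\<close>, and from there \<open>descend\<close> leads to \<open>c (p\<^sup>j)\<close>.
\<close>

lemma zero_below:
  assumes "j < l"
  shows "c (p ^ j) = 0"
proof -
  have p2: "p \<ge> 2" using p by (rule prime_ge_2_nat)
  have "p ^ Suc j \<le> p ^ l" using assms p_pow_pos[of 1] by (intro power_increasing) auto
  then have le: "Suc (p - 1) * p ^ j \<le> B" using B p2 by simp
  have "of_nat (p - 1) * c ((p - 1) * p ^ j) = of_nat (Suc (p - 1)) * c (Suc (p - 1) * p ^ j)"
    using step[of j "p - 1"] assms le p2 by simp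
  also have "\<dots> = 0" using p2 of_nat_zero_iff[of p] by simp
  finally have "of_nat (p - 1) * c ((p - 1) * p ^ j) = 0" .
  moreover have "\<not> p dvd p - 1"
    using p2 by (auto dest: dvd_imp_le)
  ultimately have "c ((p - 1) * p ^ j) = 0"
    by (simp only: mult_eq_0_iff of_nat_zero_iff simp_thms)
  moreover have "(p - 1) * p ^ j \<le> B"
    using le by (rule order.trans[rotated]) simp
  ultimately show ?thesis
    using descend[of j "p - 1"] assms p2 by simp
qed

text \<open>
  The relation with \<open>b = p\<^sup>j\<close> expresses \<open>w c(q)\<close> through \<open>c (p\<^sup>j)\<close>, because
  \<open>(q choose p\<^sup>j) \<equiv> w\<close> modulo \<open>p\<close>.
\<close>

lemma zero_if_leading_zero:
  assumes q: "q \<le> B" "q = p ^ j * w" "\<not> p dvd w" and c: "c (p ^ j) = 0"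
  shows "c q = 0"
proof (cases "w = 1")
  case False
  have w: "w > 1" using False q(3) by (cases w) auto
  have le: "p ^ j < q" using w p_pow_pos[of j] by (simp add: q(2))
  have "of_nat (q choose (q - p ^ j)) * c q = 0"
    using rel[of "q - p ^ j" "p ^ j"] le q(1) c p_pow_pos[of j] by simp
  moreover have "(of_nat (q choose (q - p ^ j)) :: 'f) = of_nat w"
  proof -
    have "q choose (q - p ^ j) = q choose p ^ j"
      using binomial_symmetric[of "p ^ j" q] le by simp
    moreover have "q div p ^ j = w" using p_pow_pos[of j] by (simp add: q(2))
    ultimately show ?thesis by (simp only: choose_prime_power[OF p char])
  qed
  ultimately show ?thesis using q(3) of_nat_zero_iff by auto
qed (use assms in simp)

lemma zero_off_multiples:
  assumes q: "q > 0" "q \<le> B" "\<not> p ^ l dvd q"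
  shows "c q = 0"
proof -
  define j where "j = multiplicity p q"
  have pq: "\<not> is_unit p" using p by auto
  obtain w where w: "q = p ^ j * w" "\<not> p dvd w"
    using multiplicity_decompose'[of q p] q(1) pq unfolding j_def by blast
  have "j < l"
    using q(3) w(1) by (metis dvd_triv_left le_imp_power_dvd dvd_trans not_le)
  then show ?thesis by (intro zero_if_leading_zero[OF q(2) w] zero_below)
qed

lemma all_zero:
  assumes c: "c (p ^ l) = 0" and q: "0 < q" "q \<le> B"
  shows "c q = 0"
proof (cases "p ^ l dvd q")
  case True
  then obtain w where w: "q = p ^ l * w" by (rule dvdE)
  have "\<not> p dvd w"
  proof
    assume "p dvd w"
    then have "p ^ Suc l dvd q" by (simp add: w mult.commute mult_dvd_mono)
    then show False using q B(2) by (auto dest: dvd_imp_le)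
  qed
  then show ?thesis using zero_if_leading_zero[OF q(2) w] c by simp
qed (use zero_off_multiples q in simp)

end

section \<open>Vectors with invariant images\<close>

text \<open>
  The vector \<open>m\<close> need not be invariant, but all its images under the operators are.
\<close>

locale invariant_images =
  fixes X :: "nat set" and \<mu> :: "nat \<Rightarrow> nat" and m :: "(nat \<Rightarrow> nat) \<Rightarrow> 'f::field"
  assumes X: "finite X" and nonempty: "colorings X \<mu> \<noteq> {}"
    and invariant: "\<And>i a \<pi> g. 0 < i \<Longrightarrow> 0 < a \<Longrightarrow> \<pi> permutes X \<Longrightarrow>
      raise X i a m (g \<circ> \<pi>) = raise X i a m g"
begin

abbreviation val :: "nat \<Rightarrow> nat \<Rightarrow> 'f" where
  "val i a \<equiv> raise_value X \<mu> i a m"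

lemma raise_eq_val:
  assumes "0 < i" "0 < a" "g \<in> colorings X (shift i a \<mu>)"
  shows "raise X i a m g = val i a"
proof -
  have "(SOME g. g \<in> colorings X (shift i a \<mu>)) \<in> colorings X (shift i a \<mu>)"
    using assms(3) by (rule someI[of "\<lambda>g. g \<in> _"])
  from colorings_conjugate[OF X assms(3) this]
  obtain \<pi> where "\<pi> permutes X" "g \<circ> \<pi> = (SOME g. g \<in> colorings X (shift i a \<mu>))" .
  then show ?thesis
    using invariant[OF assms(1,2), of \<pi> g] unfolding raise_value_def by simp
qed

text \<open>
  Both sides are the coefficient of \<open>E\<^sub>i\<^sup>(\<^sup>a\<^sup>) E\<^sub>i\<^sup>(\<^sup>b\<^sup>) m\<close> at a colouring with \<open>\<mu> i + a + b\<close> points in row \<open>i\<close>.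
\<close>

lemma one_row_relation:
  assumes i: "0 < i" and ab: "0 < a" "0 < b" "a + b \<le> \<mu> (Suc i)"
  shows "of_nat ((a + b) choose a) * val i (a + b) = of_nat ((\<mu> i + a + b) choose a) * val i b"
proof -
  obtain g where g: "g \<in> colorings X (shift i (a + b) \<mu>)"
    using shift_nonempty[OF X nonempty ab(3)] by blast
  have "raise X i b m (recolor S (Suc i) g) = val i b" if S: "S \<in> subsets (row X g i) a" for S
  proof (rule raise_eq_val[OF i ab(2)])
    have "recolor S (Suc i) g \<in> colorings X ((shift i (a + b) \<mu>)
        (Suc i := shift i (a + b) \<mu> (Suc i) + card S, i := shift i (a + b) \<mu> i - card S))"
      using S by (intro recolor_colorings[OF X g]) (auto simp: subsets_def)
    also have "(shift i (a + b) \<mu>)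
        (Suc i := shift i (a + b) \<mu> (Suc i) + card S, i := shift i (a + b) \<mu> i - card S)
        = shift i b \<mu>"
      using S ab by (auto simp: shift_def subsets_def fun_eq_iff)
    finally show "recolor S (Suc i) g \<in> colorings X (shift i b \<mu>)" .
  qed
  then have "raise X i a (raise X i b m) g = of_nat (card (subsets (row X g i) a)) * val i b"
    by (subst raise_def) simp
  also have "card (subsets (row X g i) a) = (\<mu> i + a + b) choose a"
    using g by (simp add: card_subsets finite_row[OF X] colorings_def shift_def add.assoc)
  finally show ?thesis
    using raise_eq_val[OF i _ g] ab by (simp add: raise_raise_same[OF X])
qed

text \<open>
  The commutation rule for \<open>a = B + 1\<close>, where \<open>B = \<mu> (i + 1)\<close>, evaluated at a colouring with only
  \<open>b - 1\<close> points in row \<open>i + 1\<close>. This value of \<open>a\<close> exceeds the length of row \<open>i + 1\<close>, so the term in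
  which no point moves from row \<open>i\<close> to \<open>i + 2\<close> is absent: \<open>T\<close> has \<open>b\<close> points and must meet
  row \<open>i\<close>. The terms in which \<open>T\<close> meets row \<open>i\<close> in fewer than \<open>b\<close> points vanish by hypothesis.
\<close>

lemma two_row_relation:
  assumes i: "0 < i"
    and B: "B = \<mu> (Suc i)" and b: "0 < b" "b \<le> B" "b \<le> \<mu> (Suc (Suc i))"
    and zero: "\<And>k. 0 < k \<Longrightarrow> k < b \<Longrightarrow> val i (Suc B - k) = 0"
  shows "of_nat ((\<mu> i + Suc B) choose Suc B) * val (Suc i) b =
    of_nat ((\<mu> i + Suc B) choose b) * val i (Suc B - b)"
proof -
  define \<nu> where "\<nu> = \<mu>(i := \<mu> i + Suc B, Suc i := b - 1, Suc (Suc i) := \<mu> (Suc (Suc i)) - b)"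
  \<comment> \<open>starting from content \<open>\<mu>\<close>, all of row \<open>i + 1\<close> moves up, then \<open>b\<close> points of row \<open>i + 2\<close>,
    all but one of them to row \<open>i + 1\<close> and the last one to row \<open>i\<close>\<close>
  have "colorings X \<nu> \<noteq> {}"
  proof -
    let ?\<mu>1 = "shift i B \<mu>"
    let ?\<mu>2 = "shift (Suc i) (b - 1) ?\<mu>1"
    let ?\<mu>3 = "?\<mu>2(i := ?\<mu>2 i + 1, Suc (Suc i) := ?\<mu>2 (Suc (Suc i)) - 1)"
    have "colorings X ?\<mu>1 \<noteq> {}" by (rule shift_nonempty[OF X nonempty]) (simp add: B)
    then have "colorings X ?\<mu>2 \<noteq> {}"
      by (rule shift_nonempty[OF X]) (use b in \<open>simp add: shift_def\<close>)
    then have "colorings X ?\<mu>3 \<noteq> {}"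
      by (rule colorings_move_nonempty[OF X]) (use b in \<open>auto simp: shift_def\<close>)
    also have "?\<mu>3 = \<nu>" using b by (auto simp: shift_def \<nu>_def fun_eq_iff B)
    finally show ?thesis .
  qed
  then obtain g where g: "g \<in> colorings X \<nu>" by blast
  define Y1 Y2 where "Y1 = row X g i" and "Y2 = row X g (Suc i)"
  have fin: "finite Y1" "finite Y2" by (simp_all add: Y1_def Y2_def finite_row[OF X])
  have disj: "Y1 \<inter> Y2 = {}" by (auto simp: Y1_def Y2_def row_def)
  have card: "card Y1 = \<mu> i + Suc B" "card Y2 = b - 1"
    using g by (simp_all add: Y1_def Y2_def colorings_def \<nu>_def)
  have "raise X (Suc i) b m (recolor S (Suc i) g) = val (Suc i) b" if S: "S \<in> subsets Y1 (Suc B)" for S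
  proof (rule raise_eq_val)
    have "recolor S (Suc i) g \<in> colorings X
        (\<nu>(Suc i := \<nu> (Suc i) + card S, i := \<nu> i - card S))"
      using S by (intro recolor_colorings[OF X g]) (auto simp: subsets_def Y1_def)
    also have "\<nu>(Suc i := \<nu> (Suc i) + card S, i := \<nu> i - card S) = shift (Suc i) b \<mu>"
      using S b by (auto simp: shift_def subsets_def \<nu>_def fun_eq_iff B)
    finally show "recolor S (Suc i) g \<in> colorings X (shift (Suc i) b \<mu>)" .
  qed (use b in auto)
  then have "raise X i (Suc B) (raise X (Suc i) b m) g =
      of_nat (card (subsets Y1 (Suc B))) * val (Suc i) b"
    by (subst raise_def) (simp add: Y1_def)
  then have lhs: "raise X i (Suc B) (raise X (Suc i) b m) g =
      of_nat ((\<mu> i + Suc B) choose Suc B) * val (Suc i) b"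
    by (simp add: card_subsets fin card)
  have "raise X i (Suc B) (raise X (Suc i) b m) g =
      (\<Sum>T\<in>subsets (Y1 \<union> Y2) b. val i (Suc B - card (T \<inter> Y1)))"
    unfolding Y1_def Y2_def
  proof (subst raise_raise_next[OF X])
    show "b \<le> Suc B" using b by simp
    show "(\<Sum>T\<in>subsets (row X g i \<union> row X g (Suc i)) b.
        raise X i (Suc B - card (T \<inter> row X g i)) m (recolor T (Suc (Suc i)) g)) =
      (\<Sum>T\<in>subsets (row X g i \<union> row X g (Suc i)) b. val i (Suc B - card (T \<inter> row X g i)))"
      unfolding Y1_def[symmetric] Y2_def[symmetric]
    proof (rule sum.cong[OF refl])
      fix T assume T: "T \<in> subsets (Y1 \<union> Y2) b"
      define T1 T2 where "T1 = T \<inter> Y1" and "T2 = T \<inter> Y2"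
      have TU: "T = T1 \<union> T2" using T by (auto simp: T1_def T2_def subsets_def)
      have finT: "finite T1" "finite T2" using fin by (auto simp: T1_def T2_def)
      have cardT: "card T1 + card T2 = b"
      proof -
        have "T1 \<inter> T2 = {}" using disj by (auto simp: T1_def T2_def)
        from card_Un_disjoint[OF finT this] show ?thesis
          using T unfolding TU[symmetric] by (simp add: subsets_def)
      qed
      have "card T2 \<le> b - 1"
        unfolding card(2)[symmetric] by (rule card_mono) (use fin in \<open>auto simp: T2_def\<close>)
      then have T1: "card T1 > 0" "card T1 \<le> b" using cardT b by auto
      have "recolor T1 (Suc (Suc i)) g \<in> colorings X
          (\<nu>(Suc (Suc i) := \<nu> (Suc (Suc i)) + card T1, i := \<nu> i - card T1))" (is "?g \<in> colorings X ?\<nu>")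
        by (rule recolor_colorings[OF X g]) (auto simp: T1_def Y1_def)
      then have "recolor T2 (Suc (Suc i)) ?g \<in> colorings X
          (?\<nu>(Suc (Suc i) := ?\<nu> (Suc (Suc i)) + card T2, Suc i := ?\<nu> (Suc i) - card T2))"
        by (rule recolor_colorings[OF X])
          (use disj in \<open>auto simp: T1_def T2_def Y1_def Y2_def row_def recolor_def\<close>)
      also have "?\<nu>(Suc (Suc i) := ?\<nu> (Suc (Suc i)) + card T2, Suc i := ?\<nu> (Suc i) - card T2)
          = shift i (Suc B - card T1) \<mu>"
        using T1 cardT b by (auto simp: shift_def \<nu>_def fun_eq_iff B)
      also have "recolor T2 (Suc (Suc i)) ?g = recolor T (Suc (Suc i)) g"
        by (simp add: TU recolor_recolor)
      finally show "raise X i (Suc B - card (T \<inter> Y1)) m (recolor T (Suc (Suc i)) g) =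
          val i (Suc B - card (T \<inter> Y1))"
        using T1 b by (intro raise_eq_val[OF i]) (auto simp: T1_def)
    qed
  qed
  also have "\<dots> = (\<Sum>T\<in>subsets Y1 b. val i (Suc B - card (T \<inter> Y1)))"
  proof (rule sum.mono_neutral_right)
    show "finite (subsets (Y1 \<union> Y2) b)" using fin by (simp add: finite_subsets)
    show "subsets Y1 b \<subseteq> subsets (Y1 \<union> Y2) b" by (auto simp: subsets_def)
    show "\<forall>T\<in>subsets (Y1 \<union> Y2) b - subsets Y1 b. val i (Suc B - card (T \<inter> Y1)) = 0"
    proof
      fix T assume T: "T \<in> subsets (Y1 \<union> Y2) b - subsets Y1 b"
      then have finT: "finite T" using fin by (auto simp: subsets_def intro: finite_subset[of _ "Y1 \<union> Y2"])
      have "T \<inter> Y1 \<subset> T" using T by (auto simp: subsets_def)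
      then have lt: "card (T \<inter> Y1) < b"
        using T psubset_card_mono[OF finT] by (auto simp: subsets_def)
      have "T = (T \<inter> Y1) \<union> (T \<inter> Y2)" using T by (auto simp: subsets_def)
      then have "b \<le> card (T \<inter> Y1) + card (T \<inter> Y2)"
        using T card_Un_le[of "T \<inter> Y1" "T \<inter> Y2"] by (simp add: subsets_def)
      moreover have "card (T \<inter> Y2) \<le> b - 1"
        unfolding card(2)[symmetric] by (rule card_mono) (use fin in auto)
      ultimately have "card (T \<inter> Y1) > 0" using b by auto
      then show "val i (Suc B - card (T \<inter> Y1)) = 0" using zero lt by blast
    qed
  qed
  also have "\<dots> = (\<Sum>T\<in>subsets Y1 b. val i (Suc B - b))"
    by (intro sum.cong) (auto simp: subsets_def Int_absorb2)
  also have "\<dots> = of_nat ((\<mu> i + Suc B) choose b) * val i (Suc B - b)"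
    by (simp add: card_subsets fin card)
  finally show ?thesis unfolding lhs .
qed

context
  fixes p :: nat
  assumes p: "prime p" and char: "CHAR('f) = p"
begin

lemma row_sequence_val:
  assumes "0 < i" "p ^ Suc l dvd \<mu> i + 1" "p ^ l \<le> \<mu> (Suc i)" "\<mu> (Suc i) < p ^ Suc l"
  shows "row_sequence p (\<mu> i) (\<mu> (Suc i)) l (val i)"
  using assms one_row_relation[OF assms(1)] p char by unfold_locales auto

text \<open>
  Rows \<open>i + 1\<close> and \<open>i + 2\<close> lie in the same segment. Of the scalars \<open>c\<^sub>i(p\<^sup>l\<^sup>+\<^sup>1 - k)\<close> with
  \<open>1 \<le> k \<le> p\<^sup>l\<close>, only the one for \<open>k = p\<^sup>l\<close> can be nonzero, since its argument is a multiple of \<open>p\<^sup>l\<close>.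
  So \<open>two_row_relation\<close> makes \<open>- c\<^sub>i((p - 1) p\<^sup>l)\<close> a multiple of \<open>c\<^sub>i\<^sub>+\<^sub>1(p\<^sup>l)\<close>.
\<close>

lemma val_zero_same_segment:
  assumes i: "0 < i" and Al: "p ^ Suc l dvd \<mu> i + 1" and B: "\<mu> (Suc i) + 1 = p ^ Suc l"
    and C: "p ^ l \<le> \<mu> (Suc (Suc i))"
    and zero: "val (Suc i) (p ^ l) = 0"
  shows "val i (p ^ l) = 0"
proof -
  have p2: "p \<ge> 2" using p by (rule prime_ge_2_nat)
  have pos: "p ^ l > 0" using p2 by simp
  have S: "Suc (\<mu> (Suc i)) = p ^ Suc l" using B by simp
  have ge: "2 * p ^ l \<le> p ^ Suc l" using p2 by simp
  then have Bl: "p ^ l \<le> \<mu> (Suc i)" using B pos by linarith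
  interpret row_sequence p "\<mu> i" "\<mu> (Suc i)" l "val i"
    by (rule row_sequence_val[OF i Al Bl]) (use B in linarith)
  have "of_nat ((\<mu> i + Suc (\<mu> (Suc i))) choose Suc (\<mu> (Suc i))) * val (Suc i) (p ^ l) =
      of_nat ((\<mu> i + Suc (\<mu> (Suc i))) choose (p ^ l)) * val i (Suc (\<mu> (Suc i)) - p ^ l)"
  proof (rule two_row_relation[OF i refl pos Bl C])
    fix k assume k: "0 < k" "k < p ^ l"
    show "val i (Suc (\<mu> (Suc i)) - k) = 0"
    proof (rule zero_off_multiples)
      show "\<not> p ^ l dvd Suc (\<mu> (Suc i)) - k"
      proof
        assume "p ^ l dvd Suc (\<mu> (Suc i)) - k"
        moreover have "p ^ l dvd Suc (\<mu> (Suc i))" using S by simp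
        ultimately have "p ^ l dvd k"
          using k Bl by (metis dvd_diffD1 le_SucI less_imp_le_nat order.trans)
        then show False using k by (auto dest: dvd_imp_le)
      qed
    qed (use k Bl in auto)
  qed
  then have "of_nat ((\<mu> i + p ^ Suc l) choose (p ^ l)) * val i (p ^ Suc l - p ^ l) = 0"
    using zero unfolding S by simp
  moreover have "(of_nat ((\<mu> i + p ^ Suc l) choose (p ^ l)) :: 'f) \<noteq> 0"
  proof -
    from Al obtain w where w: "\<mu> i + 1 = p ^ Suc l * w" by (rule dvdE)
    have "p ^ Suc l = p ^ l * (p - 1) + p ^ l" using p2 by (cases p) simp_all
    then have "\<mu> i + p ^ Suc l = p ^ Suc l * w + p ^ l * (p - 1) + (p ^ l - 1)"
      using w pos by linarith
    also have "\<dots> = p ^ l * (p * w + (p - 1)) + (p ^ l - 1)"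
      by (simp add: distrib_left mult_ac)
    also have "\<dots> div p ^ l = p * w + (p - 1)"
      using pos by (subst div_mult_self4) simp_all
    finally have "(of_nat ((\<mu> i + p ^ Suc l) choose (p ^ l)) :: 'f) = of_nat (p * w + (p - 1))"
      by (simp only: choose_prime_power[OF p char])
    moreover have "\<not> p dvd p * w + (p - 1)"
    proof
      assume "p dvd p * w + (p - 1)"
      then have "p dvd p - 1" using dvd_add_right_iff[of p "p * w" "p - 1"] by simp
      then show False using p2 by (auto dest: dvd_imp_le)
    qed
    ultimately show ?thesis by (simp only: of_nat_zero_iff not_False_eq_True)
  qed
  ultimately have "val i ((p - 1) * p ^ l) = 0"
    by (simp add: diff_mult_distrib)
  moreover have "(p - 1) * p ^ l \<le> \<mu> (Suc i)"
  proof -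
    have "p ^ Suc l - p ^ l \<le> \<mu> (Suc i)" using S pos by linarith
    then show ?thesis by (simp add: diff_mult_distrib)
  qed
  ultimately show ?thesis
    using descend[of l "p - 1"] p2 by simp
qed

text \<open>
  Row \<open>i + 1\<close> has length \<open>p\<^sup>v - 1\<close>, and row \<open>i + 2\<close> belongs to a later segment. Now
  \<open>p\<^sup>v - k\<close> is not a multiple of \<open>p\<^sup>v\<^sup>-\<^sup>1\<close> for any \<open>1 \<le> k \<le> p\<^sup>l\<close>, so the right-hand side of
  \<open>two_row_relation\<close> is 0, while the coefficient on the left is the class of \<open>(\<mu> i + 1) / p\<^sup>v\<close>,
  which is not divisible by \<open>p\<close>.
\<close>

lemma val_zero_special:
  assumes i: "0 < i" and Av: "p ^ v dvd \<mu> i + 1" "\<not> p ^ Suc v dvd \<mu> i + 1"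
    and B: "\<mu> (Suc i) + 1 = p ^ v"
    and C: "p ^ l \<le> \<mu> (Suc (Suc i))" and l: "Suc l < v"
  shows "val (Suc i) (p ^ l) = 0"
proof -
  have p2: "p \<ge> 2" using p by (rule prime_ge_2_nat)
  have pos: "p ^ j > 0" for j using p2 by simp
  have S: "Suc (\<mu> (Suc i)) = p ^ v" using B by simp
  obtain k where v: "v = Suc k" and lk: "l < k" using l by (cases v) auto
  have ll: "p ^ l < p ^ k" using lk p2 by simp
  have "2 * p ^ k \<le> p ^ v" using p2 by (simp add: v)
  then have Bk: "p ^ k \<le> \<mu> (Suc i)" "p ^ l \<le> \<mu> (Suc i)" using B pos[of k] ll by linarith+
  interpret row_sequence p "\<mu> i" "\<mu> (Suc i)" k "val i"
    by (rule row_sequence_val[OF i Av(1)[unfolded v] Bk(1)]) (use B[unfolded v] in linarith)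
  have zero: "val i (Suc (\<mu> (Suc i)) - j) = 0" if j: "0 < j" "j \<le> p ^ l" for j
  proof (rule zero_off_multiples)
    show "\<not> p ^ k dvd Suc (\<mu> (Suc i)) - j"
    proof
      assume "p ^ k dvd Suc (\<mu> (Suc i)) - j"
      moreover have "p ^ k dvd Suc (\<mu> (Suc i))" using S by (simp add: v)
      ultimately have "p ^ k dvd j"
        using j Bk(2) by (metis dvd_diffD1 le_SucI order.trans)
      then show False using j ll by (auto dest: dvd_imp_le)
    qed
  qed (use j Bk in auto)
  have "of_nat ((\<mu> i + Suc (\<mu> (Suc i))) choose Suc (\<mu> (Suc i))) * val (Suc i) (p ^ l) =
      of_nat ((\<mu> i + Suc (\<mu> (Suc i))) choose (p ^ l)) * val i (Suc (\<mu> (Suc i)) - p ^ l)"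
    by (rule two_row_relation[OF i refl pos Bk(2) C]) (use zero in auto)
  also have "\<dots> = 0" using zero[of "p ^ l"] pos[of l] by simp
  finally have "of_nat ((\<mu> i + p ^ v) choose p ^ v) * val (Suc i) (p ^ l) = 0" unfolding S .
  moreover have "(of_nat ((\<mu> i + p ^ v) choose p ^ v) :: 'f) \<noteq> 0"
  proof -
    from Av(1) obtain w where w: "\<mu> i + 1 = p ^ v * w" by (rule dvdE)
    then have "\<mu> i + p ^ v = p ^ v * w + (p ^ v - 1)"
      using pos[of v] by linarith
    also have "\<dots> div p ^ v = w"
      using pos[of v] by (subst div_mult_self4) simp_all
    finally have "(of_nat ((\<mu> i + p ^ v) choose (p ^ v)) :: 'f) = of_nat w"
      by (simp only: choose_prime_power[OF p char])
    moreover have "\<not> p dvd w"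
      using Av(2) w by (auto simp: mult.commute)
    ultimately show ?thesis by (simp only: of_nat_zero_iff not_False_eq_True)
  qed
  ultimately show ?thesis by simp
qed

end

end

section \<open>Tabloids as colourings\<close>

definition content :: "nat list \<Rightarrow> nat \<Rightarrow> nat" where
  "content lam i = (if i \<in> {1..length lam} then part lam i else 0)"

definition points :: "nat list \<Rightarrow> nat set" where
  "points lam = {1..sum_list lam}"

lemma points [simp]: "finite (points lam)" "card (points lam) = sum_list lam" "0 \<notin> points lam"
  by (simp_all add: points_def)

abbreviation tabloid_colorings :: "nat list \<Rightarrow> (nat \<Rightarrow> nat) set" where
  "tabloid_colorings lam \<equiv> colorings (points lam) (content lam)"

definition row_of :: "nat list \<Rightarrow> (nat \<times> nat \<Rightarrow> nat) \<Rightarrow> nat \<Rightarrow> nat" where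
  "row_of lam t x = (if x \<in> points lam then fst (inv_into (diagram lam) t x) else 0)"

definition tabloid_with :: "nat list \<Rightarrow> (nat \<Rightarrow> nat) \<Rightarrow> tabloid" where
  "tabloid_with lam f = {t \<in> tableaux lam. row_of lam t = f}"

text \<open>
  An element of \<open>M\<^sup>\<lambda>\<close> as a function on colourings, so that the operators \<open>raise\<close> apply to it.
\<close>

definition coords :: "nat list \<Rightarrow> (tabloid \<Rightarrow> 'f::field) \<Rightarrow> (nat \<Rightarrow> nat) \<Rightarrow> 'f" where
  "coords lam v f = (if f \<in> tabloid_colorings lam then v (tabloid_with lam f) else 0)"

lemma tableaux_bij: "t \<in> tableaux lam \<Longrightarrow> bij_betw t (diagram lam) (points lam)"
  by (simp add: tableaux_def points_def)

lemma tableaux_point: "t \<in> tableaux lam \<Longrightarrow> q \<in> diagram lam \<Longrightarrow> t q \<in> points lam"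
  by (rule bij_betw_apply[OF tableaux_bij])

lemma row_of_entry:
  assumes "t \<in> tableaux lam" "(i, j) \<in> diagram lam"
  shows "row_of lam t (t (i, j)) = i"
  using tableaux_point[OF assms] bij_betw_inv_into_left[OF tableaux_bij[OF assms(1)] assms(2)]
  by (simp add: row_of_def del: atLeastAtMost_iff)

lemma row_of_outside: "x \<notin> points lam \<Longrightarrow> row_of lam t x = 0"
  by (simp add: row_of_def del: atLeastAtMost_iff)

lemma tableaux_entryE:
  assumes "t \<in> tableaux lam" "x \<in> points lam"
  obtains i j where "(i, j) \<in> diagram lam" "t (i, j) = x"
  using bij_betw_imp_surj_on[OF tableaux_bij[OF assms(1)]] assms(2)
  by (metis imageE surj_pair)

lemma row_row_of:
  assumes "t \<in> tableaux lam"
  shows "row (points lam) (row_of lam t) i = row_entries lam t i"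
proof (intro equalityI subsetI)
  fix x assume x: "x \<in> row (points lam) (row_of lam t) i"
  then obtain k j where kj: "(k, j) \<in> diagram lam" "t (k, j) = x"
    using tableaux_entryE[OF assms] by (auto simp: row_def)
  with x row_of_entry[OF assms kj(1)] show "x \<in> row_entries lam t i"
    by (auto simp: row_entries_def row_def)
next
  fix x assume "x \<in> row_entries lam t i"
  then obtain j where "(i, j) \<in> diagram lam" "x = t (i, j)" by (auto simp: row_entries_def)
  then show "x \<in> row (points lam) (row_of lam t) i"
    using row_of_entry[OF assms] tableaux_point[OF assms] by (auto simp: row_def)
qed

lemma row_of_colorings:
  assumes t: "t \<in> tableaux lam"
  shows "row_of lam t \<in> tabloid_colorings lam"
  unfolding colorings_def
proof (intro CollectI conjI allI impI)
  fix i
  have "row_entries lam t i = (\<lambda>j. t (i, j)) ` {j. (i, j) \<in> diagram lam}"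
    by (auto simp: row_entries_def)
  also have "card \<dots> = card {j. (i, j) \<in> diagram lam}"
    using bij_betw_imp_inj_on[OF tableaux_bij[OF t]]
    by (intro card_image) (auto simp: inj_on_def)
  also have "{j. (i, j) \<in> diagram lam} = {1..content lam i}"
    by (auto simp: diagram_def content_def)
  finally show "card (row (points lam) (row_of lam t) i) = content lam i"
    by (simp add: row_row_of[OF t])
qed (rule row_of_outside)

lemma row_equiv_iff:
  "(s, t) \<in> row_equiv lam \<longleftrightarrow> s \<in> tableaux lam \<and> t \<in> tableaux lam \<and> row_of lam s = row_of lam t"
proof -
  have "row_of lam s = row_of lam t" if st: "s \<in> tableaux lam" "t \<in> tableaux lam"
    and eq: "\<And>i. row_entries lam s i = row_entries lam t i"
  proof
    fix x
    show "row_of lam s x = row_of lam t x"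
    proof (cases "x \<in> points lam")
      case True
      then have "x \<in> row (points lam) (row_of lam s) (row_of lam s x)" by (simp add: row_def)
      then have "x \<in> row (points lam) (row_of lam t) (row_of lam s x)"
        using eq st by (simp add: row_row_of)
      then show ?thesis by (simp add: row_def)
    qed (simp add: row_of_outside)
  qed
  moreover have "row_entries lam s i = row_entries lam t i"
    if "s \<in> tableaux lam" "t \<in> tableaux lam" "row_of lam s = row_of lam t" for i
    using that row_row_of by metis
  ultimately show ?thesis by (auto simp: row_equiv_def)
qed

lemma tabloid_of_eq: "t \<in> tableaux lam \<Longrightarrow> tabloid_of lam t = tabloid_with lam (row_of lam t)"
  by (auto simp: tabloid_of_def tabloid_with_def row_equiv_iff)

subsection \<open>The tableau with increasing rows\<close>

definition rank :: "nat set \<Rightarrow> (nat \<Rightarrow> nat) \<Rightarrow> nat \<Rightarrow> nat" where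
  "rank X g x = card {y \<in> X. y \<le> x \<and> g y = g x}"

text \<open>
  The tableau of the tabloid \<open>g\<close> whose rows increase: the point \<open>x\<close> stands in row \<open>g x\<close>, in the
  column given by its rank among the points of that row.
\<close>

definition row_sorted_tableau :: "nat list \<Rightarrow> (nat \<Rightarrow> nat) \<Rightarrow> nat \<times> nat \<Rightarrow> nat" where
  "row_sorted_tableau lam g q = (if q \<in> diagram lam
     then inv_into (points lam) (\<lambda>x. (g x, rank (points lam) g x)) q else 0)"

lemma rank_less:
  assumes "finite X" "x \<in> X" "y < x" "g y = g x"
  shows "rank X g y < rank X g x"
proof -
  let ?A = "\<lambda>x. {z \<in> X. z \<le> x \<and> g z = g x}"
  have "?A y \<subseteq> ?A x" using assms by auto
  moreover have "x \<in> ?A x - ?A y" using assms by auto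
  ultimately have "?A y \<subset> ?A x" by blast
  then show ?thesis unfolding rank_def using assms(1) by (intro psubset_card_mono) auto
qed

lemma finite_diagram: "finite (diagram lam)"
  and card_diagram: "card (diagram lam) = sum_list lam"
proof -
  have eq: "diagram lam = (SIGMA i:{1..length lam}. {1..part lam i})"
    by (auto simp: diagram_def)
  show "finite (diagram lam)" unfolding eq by simp
  have "card (diagram lam) = (\<Sum>i\<in>{1..length lam}. part lam i)"
    unfolding eq by simp
  also have "\<dots> = (\<Sum>i<length lam. lam ! i)"
    by (rule sum.reindex_bij_witness[of _ Suc "\<lambda>i. i - 1"]) (auto simp: part_def)
  finally show "card (diagram lam) = sum_list lam"
    by (simp add: sum_list_sum_nth atLeast0LessThan)
qed

lemma row_sorted_bij:
  assumes g: "g \<in> tabloid_colorings lam"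
  shows "bij_betw (\<lambda>x. (g x, rank (points lam) g x)) (points lam) (diagram lam)"
proof -
  let ?X = "points lam" and ?P = "\<lambda>x. (g x, rank (points lam) g x)"
  have inj: "inj_on ?P ?X"
  proof (rule inj_onI)
    fix x y assume xy: "x \<in> ?X" "y \<in> ?X" "?P x = ?P y"
    then show "x = y"
      using rank_less[of ?X x y g] rank_less[of ?X y x g] by (metis points(1) less_irrefl linorder_neqE_nat prod.inject)
  qed
  have sub: "?P ` ?X \<subseteq> diagram lam"
  proof
    fix q assume "q \<in> ?P ` ?X"
    then obtain x where x: "x \<in> ?X" "q = ?P x" by blast
    have "rank ?X g x \<le> card (row ?X g (g x))"
      unfolding rank_def row_def by (intro card_mono) auto
    also have "\<dots> = content lam (g x)" using g by (simp add: colorings_def)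
    finally have le: "rank ?X g x \<le> content lam (g x)" .
    have "x \<in> {y \<in> ?X. y \<le> x \<and> g y = g x}" using x by simp
    then have "rank ?X g x > 0"
      unfolding rank_def by (subst card_gt_0_iff) auto
    then show "q \<in> diagram lam"
      using le x(2) by (auto simp: diagram_def content_def split: if_splits)
  qed
  have "?P ` ?X = diagram lam"
    by (rule card_subset_eq[OF finite_diagram sub]) (simp add: card_image[OF inj] card_diagram)
  then show ?thesis using inj by (simp add: bij_betw_def)
qed

lemma row_sorted_tableau:
  assumes g: "g \<in> tabloid_colorings lam"
  shows "row_sorted_tableau lam g \<in> tableaux lam"
    and "x \<in> points lam \<Longrightarrow> row_sorted_tableau lam g (g x, rank (points lam) g x) = x"
    and "x \<in> points lam \<Longrightarrow> (g x, rank (points lam) g x) \<in> diagram lam"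
    and "row_of lam (row_sorted_tableau lam g) = g"
proof -
  let ?X = "points lam" and ?P = "\<lambda>x. (g x, rank (points lam) g x)"
  note bij = row_sorted_bij[OF g]
  have "bij_betw (inv_into ?X ?P) (diagram lam) ?X"
    by (rule bij_betw_inv_into[OF bij])
  then have "bij_betw (row_sorted_tableau lam g) (diagram lam) ?X"
    by (subst bij_betw_cong[of _ _ "inv_into ?X ?P"]) (auto simp: row_sorted_tableau_def)
  then show tab: "row_sorted_tableau lam g \<in> tableaux lam"
    by (simp add: tableaux_def row_sorted_tableau_def points_def)
  show dg: "x \<in> ?X \<Longrightarrow> ?P x \<in> diagram lam" for x by (rule bij_betw_apply[OF bij])
  show val: "x \<in> ?X \<Longrightarrow> row_sorted_tableau lam g (?P x) = x" for x
    using dg[of x] bij_betw_inv_into_left[OF bij, of x] by (simp add: row_sorted_tableau_def)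
  show "row_of lam (row_sorted_tableau lam g) = g"
  proof
    fix x
    show "row_of lam (row_sorted_tableau lam g) x = g x"
      using row_of_entry[OF tab dg[of x]] val[of x] g
      by (cases "x \<in> ?X") (auto simp: row_of_outside colorings_def)
  qed
qed

lemma tabloids_eq: "tabloids lam = tabloid_with lam ` tabloid_colorings lam"
proof (intro equalityI subsetI)
  fix T assume "T \<in> tabloids lam"
  then obtain t where "t \<in> tableaux lam" "T = tabloid_of lam t"
    by (auto simp: tabloids_def tabloid_of_def quotient_def)
  then show "T \<in> tabloid_with lam ` tabloid_colorings lam"
    by (auto simp: tabloid_of_eq row_of_colorings)
next
  fix T assume "T \<in> tabloid_with lam ` tabloid_colorings lam"
  then obtain g where g: "g \<in> tabloid_colorings lam" "T = tabloid_with lam g" by blast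
  then have "T = tabloid_of lam (row_sorted_tableau lam g)"
    by (simp add: tabloid_of_eq row_sorted_tableau)
  then show "T \<in> tabloids lam"
    using row_sorted_tableau(1)[OF g(1)] by (auto simp: tabloids_def tabloid_of_def quotient_def)
qed

lemma inj_tabloid_with: "inj_on (tabloid_with lam) (tabloid_colorings lam)"
proof (rule inj_onI)
  fix f g assume fg: "f \<in> tabloid_colorings lam" "g \<in> tabloid_colorings lam"
    "tabloid_with lam f = tabloid_with lam g"
  have "row_sorted_tableau lam f \<in> tabloid_with lam f"
    using row_sorted_tableau[OF fg(1)] by (simp add: tabloid_with_def)
  then show "f = g"
    using row_sorted_tableau[OF fg(1)] unfolding fg(3) by (simp add: tabloid_with_def)
qed

lemma coloring_range:
  assumes g: "g \<in> tabloid_colorings lam" and x: "x \<in> points lam"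
  shows "g x \<in> {1..length lam}"
  using row_sorted_tableau(3)[OF g x] by (simp add: diagram_def)

lemma finite_tabloid_colorings: "finite (tabloid_colorings lam)"
proof (rule finite_subset)
  show "tabloid_colorings lam \<subseteq>
      {f. \<forall>x. (x \<in> points lam \<longrightarrow> f x \<in> {1..length lam}) \<and> (x \<notin> points lam \<longrightarrow> f x = 0)}"
  proof
    fix g assume g: "g \<in> tabloid_colorings lam"
    then have "g x = 0" if "x \<notin> points lam" for x
      using that unfolding colorings_def by blast
    then show "g \<in> {f. \<forall>x. (x \<in> points lam \<longrightarrow> f x \<in> {1..length lam}) \<and> (x \<notin> points lam \<longrightarrow> f x = 0)}"
      using coloring_range[OF g] by blast
  qed
  show "finite \<dots>" by (rule finite_set_of_finite_funs) auto
qed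

lemma finite_tabloids: "finite (tabloids lam)"
  by (simp add: tabloids_eq finite_tabloid_colorings)

lemma tabloid_colorings_nonempty: "tabloid_colorings lam \<noteq> {}"
proof -
  have "card (diagram lam) = card (points lam)" by (simp add: card_diagram)
  from finite_same_card_bij[OF finite_diagram points(1) this]
  obtain t where t: "bij_betw t (diagram lam) (points lam)" ..
  let ?t = "\<lambda>q. if q \<in> diagram lam then t q else 0"
  have "bij_betw ?t (diagram lam) (points lam)"
    using t by (subst bij_betw_cong[of _ _ t]) auto
  then have "?t \<in> tableaux lam" by (simp add: tableaux_def points_def)
  then show ?thesis using row_of_colorings by blast
qed

subsection \<open>The action of permutations\<close>

lemma coloring_comp:
  assumes \<pi>: "\<pi> permutes X" and f: "f \<in> colorings X \<mu>"
  shows "f \<circ> \<pi> \<in> colorings X \<mu>"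
  unfolding colorings_def
proof (intro CollectI conjI allI impI)
  show "(f \<circ> \<pi>) x = 0" if "x \<notin> X" for x
    using that f permutes_not_in[OF \<pi>] by (simp add: colorings_def)
  fix i
  have "row X (f \<circ> \<pi>) i = inv' \<pi> ` row X f i"
  proof (intro equalityI subsetI)
    fix x assume "x \<in> row X (f \<circ> \<pi>) i"
    then have "\<pi> x \<in> row X f i" using permutes_in_image[OF \<pi>] by (simp add: row_def)
    then show "x \<in> inv' \<pi> ` row X f i"
      using permutes_inverses(2)[OF \<pi>, of x] by (metis imageI)
  next
    fix x assume "x \<in> inv' \<pi> ` row X f i"
    then show "x \<in> row X (f \<circ> \<pi>) i"
      using permutes_in_image[OF permutes_inv[OF \<pi>]] permutes_inverses(1)[OF \<pi>]
      by (auto simp: row_def)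
  qed
  then show "card (row X (f \<circ> \<pi>) i) = \<mu> i"
    using f permutes_inj[OF permutes_inv[OF \<pi>]]
    by (simp add: card_image inj_on_subset colorings_def)
qed

lemma coloring_comp_iff:
  assumes \<pi>: "\<pi> permutes X"
  shows "f \<circ> \<pi> \<in> colorings X \<mu> \<longleftrightarrow> f \<in> colorings X \<mu>"
proof
  assume "f \<circ> \<pi> \<in> colorings X \<mu>"
  from coloring_comp[OF permutes_inv[OF \<pi>] this]
  show "f \<in> colorings X \<mu>" by (simp add: comp_assoc permutes_inv_o[OF \<pi>])
qed (rule coloring_comp[OF \<pi>])

lemma tableaux_comp:
  assumes \<pi>: "\<pi> permutes points lam" and t: "t \<in> tableaux lam"
  shows "\<pi> \<circ> t \<in> tableaux lam"
proof -
  have "\<pi> 0 = 0" by (rule permutes_not_in[OF \<pi>]) simp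
  then show ?thesis
    using bij_betw_trans[OF tableaux_bij[OF t] permutes_imp_bij[OF \<pi>]] t
    by (simp add: tableaux_def points_def)
qed

lemma row_of_comp:
  assumes \<pi>: "\<pi> permutes points lam" and t: "t \<in> tableaux lam"
  shows "row_of lam (\<pi> \<circ> t) = row_of lam t \<circ> inv' \<pi>"
proof
  fix x
  show "row_of lam (\<pi> \<circ> t) x = (row_of lam t \<circ> inv' \<pi>) x"
  proof (cases "x \<in> points lam")
    case True
    then have "inv' \<pi> x \<in> points lam"
      using permutes_in_image[OF permutes_inv[OF \<pi>]] by blast
    then obtain i j where ij: "(i, j) \<in> diagram lam" "t (i, j) = inv' \<pi> x"
      using tableaux_entryE[OF t] by metis
    then have "(\<pi> \<circ> t) (i, j) = x" using permutes_inverses(1)[OF \<pi>] by simp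
    then show ?thesis
      using row_of_entry[OF tableaux_comp[OF \<pi> t] ij(1)] row_of_entry[OF t ij(1)] ij(2) by simp
  next
    case False
    then have "inv' \<pi> x \<notin> points lam"
      using permutes_in_image[OF permutes_inv[OF \<pi>]] by blast
    then show ?thesis using False row_of_outside by simp
  qed
qed

lemma tabloid_with_act:
  assumes \<pi>: "\<pi> permutes points lam"
  shows "(\<lambda>t. \<pi> \<circ> t) ` tabloid_with lam f = tabloid_with lam (f \<circ> inv' \<pi>)"
proof (intro equalityI subsetI)
  fix s assume "s \<in> (\<lambda>t. \<pi> \<circ> t) ` tabloid_with lam f"
  then show "s \<in> tabloid_with lam (f \<circ> inv' \<pi>)"
    using tableaux_comp[OF \<pi>] row_of_comp[OF \<pi>] by (auto simp: tabloid_with_def)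
next
  fix s assume s: "s \<in> tabloid_with lam (f \<circ> inv' \<pi>)"
  let ?t = "inv' \<pi> \<circ> s"
  have inv: "inv' \<pi> permutes points lam" by (rule permutes_inv[OF \<pi>])
  have "row_of lam ?t = f"
    using s row_of_comp[OF inv, of s]
    by (simp add: tabloid_with_def permutes_inv_inv[OF \<pi>] comp_assoc permutes_inv_o[OF \<pi>])
  then have "?t \<in> tabloid_with lam f"
    using s tableaux_comp[OF inv] by (simp add: tabloid_with_def)
  moreover have "s = \<pi> \<circ> ?t" by (simp add: comp_assoc[symmetric] permutes_inv_o[OF \<pi>])
  ultimately show "s \<in> (\<lambda>t. \<pi> \<circ> t) ` tabloid_with lam f" by blast
qed

lemma coords_add: "coords lam (v + w) f = coords lam v f + coords lam w f"
  by (simp add: coords_def)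

lemma coords_diff: "coords lam (v - w) f = coords lam v f - coords lam w f"
  by (simp add: coords_def)

lemma coords_scale: "coords lam (fscale c v) f = c * coords lam v f"
  by (simp add: coords_def fscale_def)

lemma coords_zero: "coords lam 0 f = 0"
  by (simp add: coords_def)

lemma coords_inject:
  assumes "v \<in> perm_module lam" "w \<in> perm_module lam" "coords lam v = coords lam w"
  shows "v = w"
proof
  fix T
  show "v T = w T"
  proof (cases "T \<in> tabloids lam")
    case True
    then obtain f where "f \<in> tabloid_colorings lam" "T = tabloid_with lam f"
      by (auto simp: tabloids_eq)
    then show ?thesis using fun_cong[OF assms(3), of f] by (simp add: coords_def)
  qed (use assms(1,2) in \<open>simp add: perm_module_def free_space_def\<close>)
qed

lemma coords_delta:
  assumes "h \<in> tabloid_colorings lam"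
  shows "coords lam (delta (tabloid_with lam h)) f = (if f = h then 1 else 0)"
  using inj_onD[OF inj_tabloid_with, of lam f h] assms by (auto simp: coords_def delta_def)

lemma coords_sum: "coords lam (sum v I) f = (\<Sum>i\<in>I. coords lam (v i) f)"
proof (induction I rule: infinite_finite_induct)
  case (infinite I)
  show ?case unfolding sum.infinite[OF infinite] by (rule coords_zero)
next
  case empty
  show ?case unfolding sum.empty by (rule coords_zero)
next
  case (insert i I)
  then show ?case unfolding sum.insert[OF insert.hyps] by (simp only: coords_add)
qed

lemma coords_act:
  assumes \<pi>: "\<pi> permutes points lam"
  shows "coords lam (perm_module_act lam \<pi> v) f = coords lam v (f \<circ> \<pi>)"
proof -
  let ?C = "tabloid_colorings lam"
  have inv: "inv' \<pi> permutes points lam" by (rule permutes_inv[OF \<pi>])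
  have "perm_module_act lam \<pi> v =
      (\<Sum>h\<in>?C. fscale (v (tabloid_with lam h)) (delta (tabloid_with lam (h \<circ> inv' \<pi>))))"
    unfolding perm_module_act_def lin_ext_def tabloids_eq
    by (simp add: sum.reindex[OF inj_tabloid_with] tabloid_with_act[OF \<pi>])
  then have "coords lam (perm_module_act lam \<pi> v) f =
      (\<Sum>h\<in>?C. v (tabloid_with lam h) * (if f = h \<circ> inv' \<pi> then 1 else 0))"
    using coloring_comp[OF inv] by (simp add: coords_sum coords_scale coords_delta)
  also have "\<dots> = (\<Sum>h\<in>?C. if h = f \<circ> \<pi> then v (tabloid_with lam h) else 0)"
  proof (intro sum.cong refl)
    fix h
    have "f = h \<circ> inv' \<pi> \<longleftrightarrow> h = f \<circ> \<pi>"
      using permutes_inv_o[OF \<pi>] by (auto simp: comp_assoc)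
    then show "v (tabloid_with lam h) * (if f = h \<circ> inv' \<pi> then 1 else 0) =
        (if h = f \<circ> \<pi> then v (tabloid_with lam h) else 0)" by simp
  qed
  also have "\<dots> = coords lam v (f \<circ> \<pi>)"
    by (simp add: finite_tabloid_colorings coords_def)
  finally show ?thesis .
qed

subsection \<open>Polytabloids\<close>

lemma column_stabilizerD:
  "\<pi> \<in> column_stabilizer lam t \<Longrightarrow> \<pi> permutes points lam"
  "\<pi> \<in> column_stabilizer lam t \<Longrightarrow> \<pi> ` col_entries lam t j = col_entries lam t j"
  by (simp_all add: column_stabilizer_def sym_group_carrier points_def)

lemma finite_column_stabilizer: "finite (column_stabilizer lam t)"
  by (rule finite_subset[of _ "{\<pi>. \<pi> permutes points lam}"])
    (auto dest: column_stabilizerD simp: finite_permutations)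

lemma coords_polytabloid:
  assumes t: "t \<in> tableaux lam"
  shows "coords lam (polytabloid lam t) f =
    (\<Sum>\<pi>\<in>column_stabilizer lam t. of_int (sign \<pi>) * (if f = row_of lam t \<circ> inv' \<pi> then 1 else 0))"
  unfolding polytabloid_def coords_sum coords_scale
proof (intro sum.cong refl arg_cong2[of _ _ _ _ "(*)"])
  fix \<pi> assume "\<pi> \<in> column_stabilizer lam t"
  then have \<pi>: "\<pi> permutes points lam" by (rule column_stabilizerD)
  show "coords lam (delta (tabloid_of lam (\<pi> \<circ> t))) f = (if f = row_of lam t \<circ> inv' \<pi> then 1 else 0)"
    using tableaux_comp[OF \<pi> t] row_of_colorings[OF tableaux_comp[OF \<pi> t]]
    by (simp add: tabloid_of_eq coords_delta row_of_comp[OF \<pi> t])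
qed

text \<open>
  Left multiplication by the transposition permutes the column stabiliser and reverses signs.
\<close>

lemma coords_polytabloid_transpose:
  assumes t: "t \<in> tableaux lam" and xy: "x \<in> col_entries lam t j" "y \<in> col_entries lam t j" "x \<noteq> y"
  shows "coords lam (polytabloid lam t) (f \<circ> transpose x y) =
    - (coords lam (polytabloid lam t) f :: 'f::field)"
proof -
  let ?C = "column_stabilizer lam t" and ?\<tau> = "transpose x y"
  have pts: "x \<in> points lam" "y \<in> points lam"
    using xy tableaux_point[OF t] by (auto simp: col_entries_def)
  have \<tau>: "?\<tau> permutes points lam" by (rule permutes_swap_id[OF pts])
  have col: "z \<in> col_entries lam t k \<Longrightarrow> ?\<tau> z \<in> col_entries lam t k" for z k
  proof -
    assume z: "z \<in> col_entries lam t k"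
    have "k = j" if "z \<in> {x, y}"
    proof -
      have "z \<in> col_entries lam t j" using that xy by auto
      with z obtain a b where "(a, k) \<in> diagram lam" "(b, j) \<in> diagram lam" "t (a, k) = t (b, j)"
        by (auto simp: col_entries_def)
      with bij_betw_imp_inj_on[OF tableaux_bij[OF t]] show "k = j" by (auto dest: inj_onD)
    qed
    then show ?thesis using z xy by (auto simp: transpose_def)
  qed
  have \<tau>C: "?\<tau> \<circ> \<pi> \<in> ?C" if "\<pi> \<in> ?C" for \<pi>
  proof -
    have "?\<tau> ` col_entries lam t k = col_entries lam t k" for k
    proof
      show "?\<tau> ` col_entries lam t k \<subseteq> col_entries lam t k" using col by blast
      show "col_entries lam t k \<subseteq> ?\<tau> ` col_entries lam t k"
      proof
        fix z assume "z \<in> col_entries lam t k"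
        then have "?\<tau> (?\<tau> z) \<in> ?\<tau> ` col_entries lam t k" using col by blast
        then show "z \<in> ?\<tau> ` col_entries lam t k" by simp
      qed
    qed
    then show ?thesis
      using column_stabilizerD[OF that] permutes_compose[OF column_stabilizerD(1)[OF that] \<tau>]
      by (simp add: column_stabilizer_def sym_group_carrier points_def image_comp[symmetric] del: o_apply)
  qed
  have "coords lam (polytabloid lam t) (f \<circ> ?\<tau>) =
      (\<Sum>\<pi>\<in>?C. of_int (sign \<pi>) * (if f \<circ> ?\<tau> = row_of lam t \<circ> inv' \<pi> then 1 else (0::'f)))"
    by (rule coords_polytabloid[OF t])
  also have "\<dots> = (\<Sum>\<pi>\<in>?C. - (of_int (sign \<pi>) * (if f = row_of lam t \<circ> inv' \<pi> then 1 else 0)))"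
  proof (rule sum.reindex_bij_witness[of _ "\<lambda>\<pi>. ?\<tau> \<circ> \<pi>" "\<lambda>\<pi>. ?\<tau> \<circ> \<pi>"])
    fix \<pi> assume \<pi>: "\<pi> \<in> ?C"
    note p\<pi> = column_stabilizerD(1)[OF \<pi>]
    show "?\<tau> \<circ> (?\<tau> \<circ> \<pi>) = \<pi>" by (simp add: comp_assoc[symmetric])
    then show "?\<tau> \<circ> (?\<tau> \<circ> \<pi>) = \<pi>" .
    have sgn: "sign (?\<tau> \<circ> \<pi>) = - sign \<pi>"
      using xy(3) p\<pi> \<tau>
      by (subst sign_compose) (auto simp: sign_swap_id permutes_imp_permutation[of "points lam"] permutation_swap_id)
    have "inv' (?\<tau> \<circ> \<pi>) = inv' \<pi> \<circ> ?\<tau>"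
      using permutes_bij[OF p\<pi>] permutes_bij[OF \<tau>] by (simp add: o_inv_distrib)
    then have inv: "row_of lam t \<circ> inv' (?\<tau> \<circ> \<pi>) = row_of lam t \<circ> inv' \<pi> \<circ> ?\<tau>"
      by (simp only: comp_assoc)
    have cancel: "h \<circ> ?\<tau> \<circ> ?\<tau> = h" for h :: "nat \<Rightarrow> nat"
      by (simp add: fun_eq_iff)
    have "f = row_of lam t \<circ> inv' (?\<tau> \<circ> \<pi>) \<longleftrightarrow> f \<circ> ?\<tau> = row_of lam t \<circ> inv' \<pi>"
      unfolding inv
    proof
      assume "f = row_of lam t \<circ> inv' \<pi> \<circ> ?\<tau>"
      then show "f \<circ> ?\<tau> = row_of lam t \<circ> inv' \<pi>" by (simp only: cancel)
    next
      assume "f \<circ> ?\<tau> = row_of lam t \<circ> inv' \<pi>"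
      from arg_cong[OF this, of "\<lambda>h. h \<circ> ?\<tau>"]
      show "f = row_of lam t \<circ> inv' \<pi> \<circ> ?\<tau>" by (simp only: cancel)
    qed
    then show "- (of_int (sign (?\<tau> \<circ> \<pi>)) * (if f = row_of lam t \<circ> inv' (?\<tau> \<circ> \<pi>) then 1 else 0)) =
        of_int (sign \<pi>) * (if f \<circ> ?\<tau> = row_of lam t \<circ> inv' \<pi> then 1 else (0::'f))"
      by (simp add: sgn)
  qed (use \<tau>C in auto)
  also have "\<dots> = - coords lam (polytabloid lam t) f"
    by (simp add: coords_polytabloid[OF t] sum_negf)
  finally show ?thesis .
qed

lemma diagram_above:
  assumes "sorted_wrt (\<ge>) lam" "(Suc i, j) \<in> diagram lam" "i > 0"
  shows "(i, j) \<in> diagram lam"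
  using sorted_wrt_nth_less[OF assms(1), of "i - 1" i] assms(2,3)
  by (auto simp: diagram_def part_def)

text \<open>
  If the coefficient at \<open>g\<close> is nonzero, then some term of the sum is. This gives a column of \<open>t\<close> with
  two points \<open>x\<close> and \<open>y\<close> of row \<open>i\<close> in \<open>g\<close>: one is moved to row \<open>i + 1\<close>, and the column also has
  its point in row \<open>i\<close>. The transposition of \<open>x\<close> and \<open>y\<close> fixes \<open>g\<close> but negates the polytabloid, so
  the coefficient equals its own negative.
\<close>

lemma raise_polytabloid:
  fixes g :: "nat \<Rightarrow> nat"
  assumes char: "(2::'f::field) \<noteq> 0" and lam: "sorted_wrt (\<ge>) lam" and t: "t \<in> tableaux lam" and i: "i > 0" and a: "a > 0"
  shows "raise (points lam) i a (coords lam (polytabloid lam t :: tabloid \<Rightarrow> 'f)) g = 0"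
proof (rule ccontr)
  let ?X = "points lam" and ?e = "coords lam (polytabloid lam t :: tabloid \<Rightarrow> 'f)"
  assume nz: "raise ?X i a ?e g \<noteq> 0"
  then obtain S where S: "S \<in> subsets (row ?X g i) a" and eS: "?e (recolor S (Suc i) g) \<noteq> 0"
    unfolding raise_def by (meson sum.neutral)
  from eS obtain \<pi> where \<pi>: "\<pi> \<in> column_stabilizer lam t"
    and eq: "recolor S (Suc i) g = row_of lam t \<circ> inv' \<pi>"
  proof -
    have "\<exists>\<pi>\<in>column_stabilizer lam t. recolor S (Suc i) g = row_of lam t \<circ> inv' \<pi>"
    proof (rule ccontr)
      assume "\<not> ?thesis"
      then have "?e (recolor S (Suc i) g) = 0"
        unfolding coords_polytabloid[OF t] by (intro sum.neutral) auto
      then show False using eS by contradiction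
    qed
    then show thesis using that by blast
  qed
  note p\<pi> = column_stabilizerD(1)[OF \<pi>]
  obtain x where x: "x \<in> S" using S a by (fastforce simp: subsets_def)
  then have gx: "x \<in> ?X" "g x = i" using S by (auto simp: subsets_def row_def)
  then have "inv' \<pi> x \<in> ?X" using permutes_in_image[OF permutes_inv[OF p\<pi>]] by blast
  then obtain k j where kj: "(k, j) \<in> diagram lam" "t (k, j) = inv' \<pi> x"
    using tableaux_entryE[OF t] by metis
  have "k = row_of lam t (inv' \<pi> x)" using row_of_entry[OF t kj(1)] kj(2) by simp
  also have "\<dots> = Suc i" using fun_cong[OF eq, of x] x by (simp add: recolor_def)
  finally have k: "k = Suc i" .
  show False
  proof -
    have True: "(i, j) \<in> diagram lam"
      using diagram_above[OF lam _ i] kj(1) k by simp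
    define y where "y = \<pi> (t (i, j))"
    have cols: "x \<in> col_entries lam t j" "y \<in> col_entries lam t j"
    proof -
      have "inv' \<pi> x \<in> col_entries lam t j"
        using kj(1) unfolding kj(2)[symmetric] col_entries_def by blast
      then have "\<pi> (inv' \<pi> x) \<in> col_entries lam t j" using column_stabilizerD(2)[OF \<pi>] by blast
      then show "x \<in> col_entries lam t j" by (simp add: permutes_inverses(1)[OF p\<pi>])
      have "t (i, j) \<in> col_entries lam t j" using True by (auto simp: col_entries_def)
      then show "y \<in> col_entries lam t j" using column_stabilizerD(2)[OF \<pi>] y_def by blast
    qed
    have "recolor S (Suc i) g y = i"
      using fun_cong[OF eq, of y] row_of_entry[OF t True]
      by (simp add: y_def permutes_inverses(2)[OF p\<pi>])
    then have y: "y \<notin> S" "g y = i" by (auto simp: recolor_def split: if_splits)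
    have xy: "x \<noteq> y" using x y by auto
    have yX: "y \<in> ?X" using cols(2) tableaux_point[OF t] by (auto simp: col_entries_def)
    let ?\<tau> = "transpose x y"
    have \<tau>: "?\<tau> permutes ?X" by (rule permutes_swap_id[OF gx(1) yX])
    have "g \<circ> ?\<tau> = g" using gx(2) y(2) by (auto simp: transpose_def)
    then have "raise ?X i a ?e g = raise ?X i a (\<lambda>f. ?e (f \<circ> ?\<tau>)) g"
      using raise_permute[OF \<tau>, of i a ?e g] by simp
    also have "\<dots> = - raise ?X i a ?e g"
      by (simp add: coords_polytabloid_transpose[OF t cols xy] raise_def sum_negf)
    finally have "2 * raise ?X i a ?e g = 0" by (metis add.right_inverse mult_2)
    then show False using char nz by simp
  qed
qed

section \<open>The kernel intersection theorem\<close>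

text \<open>
  The number with digits \<open>g 0, \<dots>, g N\<close> in base \<open>R\<close>. Comparing keys is comparing colourings
  lexicographically, largest point first: a tabloid is high if its large points are in low rows.
\<close>

definition lex_key :: "nat \<Rightarrow> nat \<Rightarrow> (nat \<Rightarrow> nat) \<Rightarrow> nat" where
  "lex_key R N g = (\<Sum>x\<le>N. g x * R ^ x)"

lemma lex_key_bound:
  assumes "\<And>x. g x < R"
  shows "lex_key R N g < R ^ Suc N"
proof (induction N)
  case 0
  then show ?case using assms[of 0] by (simp add: lex_key_def)
next
  case (Suc N)
  have "lex_key R (Suc N) g < R ^ Suc N + g (Suc N) * R ^ Suc N"
    using Suc by (simp add: lex_key_def)
  also have "\<dots> = Suc (g (Suc N)) * R ^ Suc N" by simp
  also have "\<dots> \<le> R * R ^ Suc N" using assms[of "Suc N"] by (intro mult_le_mono1) simp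
  finally show ?case by simp
qed

lemma lex_key_less:
  assumes "\<And>x. g x < R" "x \<le> N" "g x < h x" "\<And>y. x < y \<Longrightarrow> g y = h y"
  shows "lex_key R N g < lex_key R N h"
  using assms(2)
proof (induction N)
  case 0
  then show ?case using assms by (auto simp: lex_key_def)
next
  case (Suc N)
  show ?case
  proof (cases "x = Suc N")
    case True
    have "lex_key R (Suc N) g < R ^ Suc N + g (Suc N) * R ^ Suc N"
      using lex_key_bound[of g R N] assms(1) by (simp add: lex_key_def)
    also have "\<dots> = Suc (g (Suc N)) * R ^ Suc N" by simp
    also have "\<dots> \<le> h (Suc N) * R ^ Suc N" using assms(3) True by (intro mult_le_mono1) simp
    also have "\<dots> \<le> lex_key R (Suc N) h" by (simp add: lex_key_def)
    finally show ?thesis .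
  next
    case False
    then show ?thesis using Suc assms(4)[of "Suc N"] by (simp add: lex_key_def)
  qed
qed

text \<open>
  For the colouring of a tabloid of partition shape, this means that the tableau with increasing
  rows is standard.
\<close>

definition ballot :: "nat set \<Rightarrow> (nat \<Rightarrow> nat) \<Rightarrow> bool" where
  "ballot X f \<longleftrightarrow> (\<forall>z. \<forall>i>0. card {x \<in> X. x \<le> z \<and> f x = Suc i} \<le> card {x \<in> X. x \<le> z \<and> f x = i})"

lemma ballot_le:
  assumes "ballot X f" "0 < i" "i \<le> k"
  shows "card {x \<in> X. x \<le> z \<and> f x = k} \<le> card {x \<in> X. x \<le> z \<and> f x = i}"
  using assms(3)
proof (induction k rule: dec_induct)
  case (step k)
  have "card {x \<in> X. x \<le> z \<and> f x = Suc k} \<le> card {x \<in> X. x \<le> z \<and> f x = k}"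
    using assms(1,2) step(1) by (auto simp: ballot_def)
  then show ?case using step by linarith
qed simp

text \<open>
  Columns of the row-sorted tableau increase: if \<open>y\<close> were in row \<open>f x\<close> or below, then row \<open>f x\<close>
  would have at least \<open>rank y\<close> points up to \<open>y\<close>, and hence more than that up to \<open>x\<close>.
\<close>

lemma ballot_column_strict:
  assumes X: "finite X" and f: "ballot X f" and xy: "x \<in> X" "y < x" "0 < f x"
    and rank: "rank X f y = rank X f x"
  shows "f y < f x"
proof (rule ccontr)
  assume "\<not> f y < f x"
  then have "rank X f y \<le> card {z \<in> X. z \<le> y \<and> f z = f x}"
    unfolding rank_def using ballot_le[OF f xy(3)] by simp
  also have "\<dots> < rank X f x"
    unfolding rank_def
  proof (rule psubset_card_mono)
    have "x \<in> {z \<in> X. z \<le> x \<and> f z = f x} - {z \<in> X. z \<le> y \<and> f z = f x}" using xy by auto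
    moreover have "{z \<in> X. z \<le> y \<and> f z = f x} \<subseteq> {z \<in> X. z \<le> x \<and> f z = f x}" using xy by auto
    ultimately show "{z \<in> X. z \<le> y \<and> f z = f x} \<subset> {z \<in> X. z \<le> x \<and> f z = f x}" by blast
  qed (use X in simp)
  finally show False using rank by simp
qed

abbreviation tabloid_key :: "nat list \<Rightarrow> (nat \<Rightarrow> nat) \<Rightarrow> nat" where
  "tabloid_key lam \<equiv> lex_key (Suc (length lam)) (sum_list lam)"

lemma coloring_le_length:
  assumes "f \<in> tabloid_colorings lam"
  shows "f x < Suc (length lam)"
  using coloring_range[OF assms, of x] assms by (cases "x \<in> points lam") (auto simp: colorings_def)

lemma tabloid_key_inj:
  assumes fg: "f \<in> tabloid_colorings lam" "g \<in> tabloid_colorings lam" "f \<noteq> g"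
  shows "tabloid_key lam f \<noteq> tabloid_key lam g"
proof -
  let ?D = "{x. f x \<noteq> g x}"
  have "f x = g x" if "x \<notin> points lam" for x
    using fg(1,2) that by (simp add: colorings_def)
  then have sub: "?D \<subseteq> points lam" by blast
  then have fin: "finite ?D" by (rule finite_subset) simp
  moreover have "?D \<noteq> {}" using fg(3) by auto
  ultimately have x: "Max ?D \<in> ?D" by (rule Max_in)
  define x where "x = Max ?D"
  have xN: "x \<le> sum_list lam" using x sub by (auto simp: x_def points_def)
  have above: "f y = g y" if "x < y" for y
    using Max_ge[OF fin, of y] that unfolding x_def by (metis (mono_tags) leD mem_Collect_eq)
  have neq: "f x \<noteq> g x" using x by (simp add: x_def)
  have "tabloid_key lam f < tabloid_key lam g" if "f x < g x"
    using lex_key_less[of f _ x _ g, OF coloring_le_length[OF fg(1)] xN that above] .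
  moreover have "tabloid_key lam g < tabloid_key lam f" if "g x < f x"
    using lex_key_less[of g _ x _ f, OF coloring_le_length[OF fg(2)] xN that above[symmetric]] .
  ultimately show ?thesis using neq by (cases "f x < g x") auto
qed

text \<open>
  Suppose that, among the points up to \<open>z\<close>, the set \<open>B\<close> of those in row \<open>i + 1\<close> is larger than the
  set \<open>U\<close> of those in row \<open>i\<close>. Then \<open>sum_avoiding_subsets_zero\<close> applies to the colouring with \<open>B\<close>
  moved up to row \<open>i\<close>, with \<open>U\<close> excluded. The term for \<open>S = B\<close> is the leading coefficient. Any other \<open>S\<close>
  sends a point beyond \<open>z\<close> down to row \<open>i + 1\<close>, which gives a higher tabloid with coefficient 0.
\<close>

lemma leading_coloring_ballot:
  fixes m :: "(nat \<Rightarrow> nat) \<Rightarrow> 'f::field"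
  assumes kernel: "\<And>i a g. 0 < i \<Longrightarrow> 0 < a \<Longrightarrow> raise (points lam) i a m g = 0"
    and f: "f \<in> tabloid_colorings lam" "m f \<noteq> 0"
    and leading: "\<And>h. m h \<noteq> 0 \<Longrightarrow> tabloid_key lam h \<le> tabloid_key lam f"
  shows "ballot (points lam) f"
  unfolding ballot_def
proof (intro allI impI, rule ccontr)
  let ?X = "points lam"
  fix z i :: nat
  define B where "B = {x \<in> ?X. x \<le> z \<and> f x = Suc i}"
  define U where "U = {x \<in> ?X. x \<le> z \<and> f x = i}"
  assume i: "0 < i" and "\<not> card {x \<in> ?X. x \<le> z \<and> f x = Suc i} \<le> card {x \<in> ?X. x \<le> z \<and> f x = i}"
  then have lt: "card U < card B" by (simp add: B_def U_def)
  define h where "h = recolor B i f"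
  have rowh: "row ?X h i = row ?X f i \<union> B"
    unfolding h_def by (rule row_recolor_target) (auto simp: B_def)
  have finB: "finite B" by (simp add: B_def)
  have "0 = (\<Sum>S\<in>subsets (row ?X h i - U) (card B). m (recolor S (Suc i) h))"
    by (rule sum_avoiding_subsets_zero[symmetric])
      (use kernel[OF i] lt rowh in \<open>auto simp: U_def row_def\<close>)
  also have "\<dots> = (\<Sum>S\<in>{B}. m (recolor S (Suc i) h))"
  proof (rule sum.mono_neutral_right)
    show "finite (subsets (row ?X h i - U) (card B))" by (simp add: finite_subsets finite_row)
    show "{B} \<subseteq> subsets (row ?X h i - U) (card B)"
      unfolding rowh by (auto simp: subsets_def B_def U_def)
    show "\<forall>S\<in>subsets (row ?X h i - U) (card B) - {B}. m (recolor S (Suc i) h) = 0"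
    proof (intro ballI, rule ccontr)
      fix S assume S: "S \<in> subsets (row ?X h i - U) (card B) - {B}"
        and nz: "m (recolor S (Suc i) h) \<noteq> 0"
      have SB: "S \<subseteq> row ?X f i \<union> B - U" "card S = card B" "S \<noteq> B"
        using S by (auto simp: subsets_def rowh)
      have finS: "finite S" using SB(1) finB by (auto intro: finite_subset simp: finite_row)
      have "S - B \<noteq> {}"
        using SB card_subset_eq[OF finB, of S] by blast
      then have mx: "Max (S - B) \<in> S - B" using finS by (intro Max_in) auto
      define x where "x = Max (S - B)"
      have x: "x \<in> ?X" "f x = i" "x > z" "x \<in> S"
        using mx SB(1) by (auto simp: x_def U_def row_def)
      have "tabloid_key lam f < tabloid_key lam (recolor S (Suc i) h)"
      proof (rule lex_key_less)
        show "f y < Suc (length lam)" for y by (rule coloring_le_length[OF f(1)])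
        show "x \<le> sum_list lam" using x by (simp add: points_def)
        show "f x < recolor S (Suc i) h x" using x by (simp add: recolor_def)
        show "f y = recolor S (Suc i) h y" if y: "x < y" for y
        proof -
          have "y \<notin> B" using x y by (auto simp: B_def)
          moreover have "y \<notin> S"
            using y Max_ge[of "S - B" y] finS \<open>y \<notin> B\<close> unfolding x_def by (meson DiffI finite_Diff leD)
          ultimately show ?thesis by (simp add: recolor_def h_def)
        qed
      qed
      with leading[OF nz] show False by simp
    qed
  qed
  also have "recolor B (Suc i) h = f"
    by (auto simp: h_def recolor_def B_def)
  then have "(\<Sum>S\<in>{B}. m (recolor S (Suc i) h)) = m f" by simp
  finally show False using f(2) by simp
qed

text \<open>
  Look at the largest point \<open>x\<close> moved by \<open>\<pi>\<close>. The smaller point \<open>inv' \<pi> x\<close> stands in the same column of a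
  standard tableau, so it is in a higher row, and \<open>x\<close> takes its place.
\<close>

lemma polytabloid_lower_terms:
  assumes f: "f \<in> tabloid_colorings lam" and ballot: "ballot (points lam) f"
    and \<pi>: "\<pi> \<in> column_stabilizer lam (row_sorted_tableau lam f)" "\<pi> \<noteq> id"
  shows "tabloid_key lam (f \<circ> inv' \<pi>) < tabloid_key lam f"
proof -
  let ?X = "points lam" and ?t = "row_sorted_tableau lam f"
  note t = row_sorted_tableau[OF f]
  note p\<pi> = column_stabilizerD(1)[OF \<pi>(1)]
  have inv: "inv' \<pi> permutes ?X" by (rule permutes_inv[OF p\<pi>])
  let ?D = "{x. inv' \<pi> x \<noteq> x}"
  have sub: "?D \<subseteq> ?X" using permutes_not_in[OF inv] by blast
  then have fin: "finite ?D" by (rule finite_subset) simp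
  have "?D \<noteq> {}"
  proof
    assume "?D = {}"
    then have "inv' \<pi> = id" by auto
    then show False using \<pi>(2) permutes_inv_inv[OF p\<pi>] by simp
  qed
  with fin have mx: "Max ?D \<in> ?D" by (rule Max_in)
  define x where "x = Max ?D"
  define y where "y = inv' \<pi> x"
  have x: "x \<in> ?X" using mx sub by (auto simp: x_def)
  have yX: "y \<in> ?X" using permutes_in_image[OF inv] x by (simp add: y_def)
  have neq: "y \<noteq> x" using mx by (simp add: x_def y_def)
  have "y \<in> ?D" using neq permutes_inj[OF inv] by (auto simp: y_def inj_eq)
  then have yx: "y < x" using Max_ge[OF fin, of y] neq by (simp add: x_def)
  have above: "inv' \<pi> z = z" if "x < z" for z
    using Max_ge[OF fin, of z] that unfolding x_def by (metis (mono_tags) leD mem_Collect_eq)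
  have "x \<in> col_entries lam ?t (rank ?X f x)"
    using t(2)[OF x] t(3)[OF x] unfolding col_entries_def by force
  then have "x \<in> \<pi> ` col_entries lam ?t (rank ?X f x)"
    using column_stabilizerD(2)[OF \<pi>(1)] by simp
  then have "y \<in> col_entries lam ?t (rank ?X f x)"
    using permutes_inverses(2)[OF p\<pi>] by (auto simp: y_def)
  then obtain k where k: "(k, rank ?X f x) \<in> diagram lam" "?t (k, rank ?X f x) = y"
    by (auto simp: col_entries_def)
  have "(k, rank ?X f x) = (f y, rank ?X f y)"
    by (rule inj_onD[OF bij_betw_imp_inj_on[OF tableaux_bij[OF t(1)]]]) (use k t(2,3)[OF yX] in auto)
  then have "f y < f x"
    using ballot_column_strict[OF _ ballot x yx] coloring_range[OF f x] by simp
  then show ?thesis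
    using x coloring_le_length[OF coloring_comp[OF inv f]]
    by (intro lex_key_less[of _ _ x]) (auto simp: y_def above points_def)
qed

lemma coords_polytabloid_leading:
  assumes f: "f \<in> tabloid_colorings lam" and ballot: "ballot (points lam) f"
  defines "e \<equiv> coords lam (polytabloid lam (row_sorted_tableau lam f) :: tabloid \<Rightarrow> 'f::field)"
  shows "e f = 1" and "h \<noteq> f \<Longrightarrow> e h \<noteq> 0 \<Longrightarrow> tabloid_key lam h < tabloid_key lam f"
proof -
  let ?C = "column_stabilizer lam (row_sorted_tableau lam f)"
  note t = row_sorted_tableau[OF f]
  have e: "e h = (\<Sum>\<pi>\<in>?C. of_int (sign \<pi>) * (if h = f \<circ> inv' \<pi> then 1 else 0))" for h
    unfolding e_def coords_polytabloid[OF t(1)] t(4) ..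
  have id: "id \<in> ?C" by (simp add: column_stabilizer_def sym_group_carrier permutes_id)
  have "e f = (\<Sum>\<pi>\<in>{id}. of_int (sign \<pi>) * (if f = f \<circ> inv' \<pi> then 1 else 0))"
    unfolding e
  proof (rule sum.mono_neutral_right[OF finite_column_stabilizer])
    show "\<forall>\<pi>\<in>?C - {id}. of_int (sign \<pi>) * (if f = f \<circ> inv' \<pi> then 1 else (0::'f)) = 0"
    proof
      fix \<pi> assume "\<pi> \<in> ?C - {id}"
      then have "tabloid_key lam (f \<circ> inv' \<pi>) < tabloid_key lam f"
        using polytabloid_lower_terms[OF f ballot, of \<pi>] by simp
      then have "f \<noteq> f \<circ> inv' \<pi>" by (metis less_irrefl)
      then show "of_int (sign \<pi>) * (if f = f \<circ> inv' \<pi> then 1 else (0::'f)) = 0" by simp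
    qed
  qed (use id in simp)
  then show "e f = 1" by simp
  assume h: "h \<noteq> f" "e h \<noteq> 0"
  have "\<exists>\<pi>\<in>?C. h = f \<circ> inv' \<pi>"
  proof (rule ccontr)
    assume "\<not> ?thesis"
    then have "e h = 0" unfolding e by (intro sum.neutral) auto
    then show False using h(2) by contradiction
  qed
  then obtain \<pi> where \<pi>: "\<pi> \<in> ?C" "h = f \<circ> inv' \<pi>" by blast
  with h(1) have "\<pi> \<noteq> id" by auto
  then show "tabloid_key lam h < tabloid_key lam f"
    using polytabloid_lower_terms[OF f ballot] \<pi> by simp
qed

lemma polytabloid_perm_module:
  assumes "t \<in> tableaux lam"
  shows "polytabloid lam t \<in> perm_module lam"
  unfolding polytabloid_def perm_module_def
proof (intro fun_space.subspace_sum fun_space.subspace_scale subspace_free_space delta_free_space)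
  fix \<pi> assume "\<pi> \<in> column_stabilizer lam t"
  then have "\<pi> \<circ> t \<in> tableaux lam" using tableaux_comp assms by (blast dest: column_stabilizerD)
  then show "tabloid_of lam (\<pi> \<circ> t) \<in> tabloids lam"
    by (simp add: tabloids_eq tabloid_of_eq row_of_colorings)
qed

text \<open>
  The hard inclusion of James' theorem. The leading tabloid of \<open>v\<close> belongs to a standard tableau.
  Subtracting a multiple of the polytabloid of that tableau, which is itself in the kernel, removes
  the leading term and leaves lower ones. The bound \<open>b\<close> on the keys carries the induction.
\<close>

theorem kernel_intersection_subset:
  fixes v :: "tabloid \<Rightarrow> 'f::field"
  assumes char: "(2::'f) \<noteq> 0" and lam: "sorted_wrt (\<ge>) lam"
    and v: "v \<in> perm_module lam"
    and kernel: "\<And>i a g. 0 < i \<Longrightarrow> 0 < a \<Longrightarrow> raise (points lam) i a (coords lam v) g = 0"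
  shows "v \<in> specht_module lam"
proof -
  have main: "v \<in> specht_module lam"
    if "v \<in> perm_module lam"
      "\<And>i a g. 0 < i \<Longrightarrow> 0 < a \<Longrightarrow> raise (points lam) i a (coords lam v) g = 0"
      "\<And>f. coords lam v f \<noteq> 0 \<Longrightarrow> tabloid_key lam f < b" for b and v :: "tabloid \<Rightarrow> 'f"
    using that
  proof (induction b arbitrary: v)
    case 0
    have "v = 0"
    proof (rule coords_inject[OF 0(1)])
      show "0 \<in> perm_module lam" by (simp add: perm_module_def free_space_def)
      show "coords lam v = coords lam 0" using 0(3) by (auto simp: coords_zero fun_eq_iff)
    qed
    then show ?case by (simp only: specht_module_def fun_space.span_zero)
  next
    case (Suc b)
    show ?case
    proof (cases "\<exists>f. coords lam v f \<noteq> 0 \<and> tabloid_key lam f = b")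
      case False
      show ?thesis
      proof (rule Suc.IH[OF Suc.prems(1,2)])
        fix f assume "coords lam v f \<noteq> 0"
        then show "tabloid_key lam f < b" using Suc.prems(3)[of f] False by (auto simp: less_Suc_eq)
      qed
    next
      case True
      then obtain f where f: "coords lam v f \<noteq> 0" "tabloid_key lam f = b" by blast
      have support: "h \<in> tabloid_colorings lam" if "coords lam v h \<noteq> 0" for h
        using that by (auto simp: coords_def split: if_splits)
      note fC = support[OF f(1)]
      have ballot: "ballot (points lam) f"
        by (rule leading_coloring_ballot[OF Suc.prems(2) fC f(1)])
          (use Suc.prems(3) f(2) in \<open>auto simp: less_Suc_eq_le\<close>)
      define e :: "tabloid \<Rightarrow> 'f" where "e = polytabloid lam (row_sorted_tableau lam f)"
      define c where "c = coords lam v f"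
      have coords: "coords lam (v - fscale c e) h = coords lam v h - c * coords lam e h" for h
        by (simp only: coords_diff coords_scale)
      note lead = coords_polytabloid_leading[OF fC ballot, where 'f = 'f, folded e_def]
      note t = row_sorted_tableau(1)[OF fC]
      have "v - fscale c e \<in> specht_module lam"
      proof (rule Suc.IH)
        show "v - fscale c e \<in> perm_module lam"
          using Suc.prems(1) polytabloid_perm_module[OF t] unfolding perm_module_def e_def
          by (intro fun_space.subspace_diff fun_space.subspace_scale subspace_free_space)
        show "raise (points lam) i a (coords lam (v - fscale c e)) g = 0" if "0 < i" "0 < a" for i a g
          unfolding coords raise_diff raise_scale
          using Suc.prems(2)[OF that] raise_polytabloid[OF char lam t that] by (simp add: e_def)
        show "tabloid_key lam h < b" if h: "coords lam (v - fscale c e) h \<noteq> 0" for h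
        proof (cases "h = f")
          case True
          then show ?thesis using h lead(1) unfolding coords by (simp add: c_def)
        next
          case False
          show ?thesis
          proof (cases "coords lam e h = 0")
            case True
            then have nz: "coords lam v h \<noteq> 0" using h unfolding coords by simp
            then have "tabloid_key lam h \<noteq> b"
              using tabloid_key_inj[OF support[OF nz] fC False] f(2) by simp
            then show ?thesis using Suc.prems(3)[OF nz] by simp
          next
            case nz: False
            then show ?thesis using lead(2)[OF False nz] f(2) by simp
          qed
        qed
      qed
      moreover have "fscale c e \<in> specht_module lam"
        unfolding specht_module_def e_def
        using t by (intro fun_space.span_scale fun_space.span_base imageI)
      ultimately have "(v - fscale c e) + fscale c e \<in> specht_module lam"
        unfolding specht_module_def by (rule fun_space.span_add)
      then show ?thesis by (simp only: diff_add_cancel)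
    qed
  qed
  show ?thesis
  proof (rule main[OF v kernel])
    fix f assume "coords lam v f \<noteq> 0"
    then have "f \<in> tabloid_colorings lam" by (auto simp: coords_def split: if_splits)
    then show "tabloid_key lam f < Suc (Max (tabloid_key lam ` tabloid_colorings lam))"
      using finite_tabloid_colorings[of lam] by (simp add: less_Suc_eq_le)
  qed
qed

lemma raise_specht:
  fixes v :: "tabloid \<Rightarrow> 'f::field"
  assumes char: "(2::'f) \<noteq> 0" and lam: "sorted_wrt (\<ge>) lam"
    and v: "v \<in> specht_module lam" and ia: "0 < i" "0 < a"
  shows "raise (points lam) i a (coords lam v) g = 0"
proof -
  let ?K = "{v :: tabloid \<Rightarrow> 'f. raise (points lam) i a (coords lam v) g = 0}"
  have "fun_space.subspace ?K"
    unfolding fun_space.subspace_def mem_Collect_eq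
  proof (intro conjI ballI allI; (unfold mem_Collect_eq)?)
    have "coords lam (0 :: tabloid \<Rightarrow> 'f) = (\<lambda>_. 0)" by (rule ext) (rule coords_zero)
    then show "raise (points lam) i a (coords lam (0 :: tabloid \<Rightarrow> 'f)) g = 0"
      by (simp add: raise_def)
  next
    fix x y :: "tabloid \<Rightarrow> 'f"
    assume "raise (points lam) i a (coords lam x) g = 0" "raise (points lam) i a (coords lam y) g = 0"
    moreover have "coords lam (x + y) = (\<lambda>f. coords lam x f + coords lam y f)"
      by (rule ext) (rule coords_add)
    ultimately show "raise (points lam) i a (coords lam (x + y)) g = 0"
      by (simp only: raise_add add_0)
  next
    fix c and x :: "tabloid \<Rightarrow> 'f"
    assume "raise (points lam) i a (coords lam x) g = 0"
    moreover have "coords lam (fscale c x) = (\<lambda>f. c * coords lam x f)"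
      by (rule ext) (rule coords_scale)
    ultimately show "raise (points lam) i a (coords lam (fscale c x)) g = 0"
      by (simp only: raise_scale mult_zero_right)
  qed
  then have "specht_module lam \<subseteq> ?K"
    unfolding specht_module_def
    by (intro fun_space.span_minimal) (auto intro: raise_polytabloid[OF char lam _ ia])
  then show ?thesis using v by auto
qed

section \<open>Cocycles with values in a Specht module\<close>

lemma FG_hom_expand:
  assumes X: "finite X" and \<phi>: "\<phi> \<in> FG_hom G (free_space X) \<rho> W \<sigma>" and v: "v \<in> free_space X"
  shows "\<phi> v = lin_ext X (\<lambda>x. \<phi> (delta x)) v"
proof -
  have sub: "fun_space.subspace (free_space X)" by (rule subspace_free_space)
  have add: "\<phi> (v + w) = \<phi> v + \<phi> w" if "v \<in> free_space X" "w \<in> free_space X" for v w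
    using \<phi> that by (simp add: FG_hom_def)
  have scale: "\<phi> (fscale c v) = fscale c (\<phi> v)" if "v \<in> free_space X" for c v
    using \<phi> that by (simp add: FG_hom_def)
  have zero: "\<phi> 0 = 0"
    using scale[OF fun_space.subspace_0[OF sub], of 0] by simp
  have "\<phi> (\<Sum>x\<in>Y. fscale (v x) (delta x)) = (\<Sum>x\<in>Y. fscale (v x) (\<phi> (delta x)))"
    if "finite Y" "Y \<subseteq> X" for Y
    using that
  proof (induction Y rule: finite_induct)
    case empty
    show ?case unfolding sum.empty by (rule zero)
  next
    case (insert y Y)
    have d: "delta x \<in> free_space X" if "x \<in> insert y Y" for x
      using insert.prems that by (intro delta_free_space) auto
    have Y: "(\<Sum>x\<in>Y. fscale (v x) (delta x)) \<in> free_space X"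
      using d by (intro fun_space.subspace_sum[OF sub] fun_space.subspace_scale[OF sub]) auto
    have "\<phi> (\<Sum>x\<in>insert y Y. fscale (v x) (delta x)) =
        \<phi> (fscale (v y) (delta y)) + \<phi> (\<Sum>x\<in>Y. fscale (v x) (delta x))"
      unfolding sum.insert[OF insert.hyps]
      by (rule add[OF fun_space.subspace_scale[OF sub d[OF insertI1]] Y])
    also have "\<phi> (\<Sum>x\<in>Y. fscale (v x) (delta x)) = (\<Sum>x\<in>Y. fscale (v x) (\<phi> (delta x)))"
      using insert.prems by (intro insert.IH) auto
    also have "\<phi> (fscale (v y) (delta y)) = fscale (v y) (\<phi> (delta y))"
      by (rule scale[OF d[OF insertI1]])
    finally show ?case unfolding sum.insert[OF insert.hyps] .
  qed
  from this[OF X order.refl] show ?thesis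
    using free_space_expand[OF X v] by (simp only: lin_ext_def)
qed

text \<open>
  The passage from the bar resolution to homogeneous cocycles, functions of two group elements.
\<close>

lemma (in group) cocycle_pairs:
  assumes fin: "finite (carrier G)" and \<phi>: "\<phi> \<in> ext1_cocycles G W \<sigma>"
    and abc: "a \<in> carrier G" "b \<in> carrier G" "c \<in> carrier G"
  shows "\<phi> (delta [a, b]) \<in> W"
    and "\<phi> (delta [c \<otimes> a, c \<otimes> b]) = \<sigma> c (\<phi> (delta [a, b]))"
    and "\<phi> (delta [a, c]) = \<phi> (delta [a, b]) + \<phi> (delta [b, c])"
proof -
  have hom: "\<phi> \<in> FG_hom G (bar_space G 1) (bar_act G 1) W \<sigma>"
    and cocycle: "\<And>v. v \<in> bar_space G 2 \<Longrightarrow> \<phi> (bar_diff G 2 v) = 0"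
    using \<phi> by (auto simp: ext1_cocycles_def)
  have basis: "[x, y] \<in> bar_basis G 1" if "x \<in> carrier G" "y \<in> carrier G" for x y
    using that by (simp add: bar_basis_def)
  have space: "delta [x, y] \<in> bar_space G 1" if "x \<in> carrier G" "y \<in> carrier G" for x y
    using basis[OF that] by (simp add: bar_space_def delta_free_space)
  show "\<phi> (delta [a, b]) \<in> W"
    using hom space abc by (auto simp: FG_hom_def)
  have "bar_act G 1 c (delta [a, b]) = delta [c \<otimes> a, c \<otimes> b]"
    unfolding bar_act_def
    using lin_ext_delta[OF finite_bar_basis[OF fin] basis[OF abc(1,2)],
        where b = "\<lambda>xs. delta (map ((\<otimes>) c) xs)"] by simp
  then show "\<phi> (delta [c \<otimes> a, c \<otimes> b]) = \<sigma> c (\<phi> (delta [a, b]))"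
    using hom space[OF abc(1,2)] abc(3) unfolding FG_hom_def by (metis (mono_tags, lifting) mem_Collect_eq)
  have basis2: "[a, b, c] \<in> bar_basis G 2" using abc by (simp add: bar_basis_def)
  have "bar_diff G 2 (delta [a, b, c]) =
      (\<Sum>i\<le>2. fscale ((-1) ^ i) (delta (take i [a, b, c] @ drop (Suc i) [a, b, c])))"
    unfolding bar_diff_def by (rule lin_ext_delta[OF finite_bar_basis[OF fin] basis2])
  also have "\<dots> = (delta [b, c] + fscale (-1) (delta [a, c])) + delta [a, b]"
    by (simp add: eval_nat_numeral)
  finally have eq: "bar_diff G 2 (delta [a, b, c]) =
      (delta [b, c] + fscale (-1) (delta [a, c])) + delta [a, b]" .
  have "delta [a, b, c] \<in> bar_space G 2"
    unfolding bar_space_def by (rule delta_free_space[OF basis2])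
  from cocycle[OF this] have "\<phi> ((delta [b, c] + fscale (-1) (delta [a, c])) + delta [a, b]) = 0"
    unfolding eq .
  also have "\<phi> ((delta [b, c] + fscale (-1) (delta [a, c])) + delta [a, b]) =
      (\<phi> (delta [b, c]) + fscale (-1) (\<phi> (delta [a, c]))) + \<phi> (delta [a, b])"
  proof -
    have sub: "fun_space.subspace (bar_space G 1)"
      by (simp add: bar_space_def subspace_free_space)
    have add: "\<phi> (v + w) = \<phi> v + \<phi> w" if "v \<in> bar_space G 1" "w \<in> bar_space G 1" for v w
      using hom that by (simp add: FG_hom_def)
    have scale: "\<phi> (fscale k v) = fscale k (\<phi> v)" if "v \<in> bar_space G 1" for k v
      using hom that by (simp add: FG_hom_def)
    note s = space[OF abc(2,3)] space[OF abc(1,3)] space[OF abc(1,2)]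
    note s2 = fun_space.subspace_scale[OF sub s(2), of "-1"]
    show ?thesis
      by (simp only: add[OF fun_space.subspace_add[OF sub s(1) s2] s(3)] add[OF s(1) s2] scale[OF s(2)])
  qed
  finally have zero: "(\<phi> (delta [b, c]) + fscale (-1) (\<phi> (delta [a, c]))) + \<phi> (delta [a, b]) = 0" .
  show "\<phi> (delta [a, c]) = \<phi> (delta [a, b]) + \<phi> (delta [b, c])"
  proof
    fix x
    from fun_cong[OF zero, of x]
    show "\<phi> (delta [a, c]) x = (\<phi> (delta [a, b]) + \<phi> (delta [b, c])) x"
      by (simp add: fscale_def algebra_simps eq_neg_iff_add_eq_0)
  qed
qed

lemma specht_subset_perm_module: "specht_module lam \<subseteq> perm_module lam"
  unfolding specht_module_def perm_module_def
  by (rule fun_space.span_minimal)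
    (auto intro: polytabloid_perm_module[unfolded perm_module_def] simp: subspace_free_space)

definition base_coloring :: "nat list \<Rightarrow> nat \<Rightarrow> nat" where
  "base_coloring lam = (SOME f. f \<in> tabloid_colorings lam)"

text \<open>
  An arbitrary choice of a permutation that carries the base tabloid to the tabloid \<open>f\<close>. It depends
  on \<open>f\<close> only, which makes \<open>primitive\<close> linear in the cocycle.
\<close>

definition transporter :: "nat list \<Rightarrow> (nat \<Rightarrow> nat) \<Rightarrow> (nat \<Rightarrow> nat)" where
  "transporter lam f = (SOME \<pi>. \<pi> permutes points lam \<and> f \<circ> \<pi> = base_coloring lam)"

lemma transporter:
  assumes "f \<in> tabloid_colorings lam"
  shows "transporter lam f permutes points lam" "f \<circ> transporter lam f = base_coloring lam"
proof -
  have "base_coloring lam \<in> tabloid_colorings lam"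
    unfolding base_coloring_def using tabloid_colorings_nonempty by (simp add: some_in_eq)
  from colorings_conjugate[OF points(1) assms this]
  have "\<exists>\<pi>. \<pi> permutes points lam \<and> f \<circ> \<pi> = base_coloring lam" by blast
  from someI_ex[OF this]
  show "transporter lam f permutes points lam" "f \<circ> transporter lam f = base_coloring lam"
    by (simp_all add: transporter_def)
qed

text \<open>
  Shapiro's lemma made explicit: these are the coefficients of a vector \<open>m \<in> M\<^sup>\<lambda>\<close> such that the
  cocycle is \<open>\<pi> \<mapsto> \<pi> m - m\<close> (see \<open>value_eq_primitive\<close>).
\<close>

definition primitive ::
  "nat list \<Rightarrow> (((nat \<Rightarrow> nat) list \<Rightarrow> 'f::field) \<Rightarrow> tabloid \<Rightarrow> 'f) \<Rightarrow> (nat \<Rightarrow> nat) \<Rightarrow> 'f" where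
  "primitive lam \<phi> f = coords lam (\<phi> (delta [transporter lam f, id])) f"

abbreviation specht_cocycles ::
  "nat list \<Rightarrow> (((nat \<Rightarrow> nat) list \<Rightarrow> 'f::field) \<Rightarrow> tabloid \<Rightarrow> 'f) set" where
  "specht_cocycles lam \<equiv>
     ext1_cocycles (sym_group (sum_list lam)) (specht_module lam) (perm_module_act lam)"

abbreviation specht_coboundaries ::
  "nat list \<Rightarrow> (((nat \<Rightarrow> nat) list \<Rightarrow> 'f::field) \<Rightarrow> tabloid \<Rightarrow> 'f) set" where
  "specht_coboundaries lam \<equiv>
     ext1_coboundaries (sym_group (sum_list lam)) (specht_module lam) (perm_module_act lam)"

lemma carrier_points: "\<pi> \<in> carrier (sym_group (sum_list lam)) \<longleftrightarrow> \<pi> permutes points lam"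
  by (simp add: sym_group_carrier points_def)

lemma finite_carrier_sym_group: "finite (carrier (sym_group n))"
proof -
  have "carrier (sym_group n) = {\<pi>. \<pi> permutes {1..n}}" by (simp add: sym_group_def)
  then show ?thesis by (simp add: finite_permutations)
qed

lemma perm_module_act_add:
  "perm_module_act lam \<pi> (v + w) = perm_module_act lam \<pi> v + perm_module_act lam \<pi> w"
  by (simp only: perm_module_act_def lin_ext_add)

lemma perm_module_act_scale:
  "perm_module_act lam \<pi> (fscale c v) = fscale c (perm_module_act lam \<pi> v)"
  by (simp only: perm_module_act_def lin_ext_scale)

lemma perm_module_act_closed:
  assumes \<pi>: "\<pi> permutes points lam"
  shows "perm_module_act lam \<pi> v \<in> perm_module lam"
  unfolding perm_module_act_def perm_module_def
proof (intro lin_ext_free_space delta_free_space)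
  fix T assume "T \<in> tabloids lam"
  then show "(\<lambda>t. \<pi> \<circ> t) ` T \<in> tabloids lam"
    using coloring_comp[OF permutes_inv[OF \<pi>]] by (auto simp: tabloids_eq tabloid_with_act[OF \<pi>])
qed

locale specht_cocycle =
  fixes lam :: "nat list" and \<phi> :: "((nat \<Rightarrow> nat) list \<Rightarrow> 'f::field) \<Rightarrow> tabloid \<Rightarrow> 'f"
  assumes char: "(2::'f) \<noteq> 0" and lam: "sorted_wrt (\<ge>) lam"
    and \<phi>: "\<phi> \<in> specht_cocycles lam"
begin

abbreviation cval :: "(nat \<Rightarrow> nat) \<Rightarrow> (nat \<Rightarrow> nat) \<Rightarrow> (nat \<Rightarrow> nat) \<Rightarrow> 'f" where
  "cval a b \<equiv> coords lam (\<phi> (delta [a, b]))"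

lemma value_specht:
  assumes "a permutes points lam" "b permutes points lam"
  shows "\<phi> (delta [a, b]) \<in> specht_module lam"
  using group.cocycle_pairs(1)[OF sym_group_is_group finite_carrier_sym_group \<phi>, of a b a] assms
  by (simp add: carrier_points)

lemma value_act:
  assumes "a permutes points lam" "b permutes points lam" "c permutes points lam"
  shows "cval (c \<circ> a) (c \<circ> b) f = cval a b (f \<circ> c)"
  using group.cocycle_pairs(2)[OF sym_group_is_group finite_carrier_sym_group \<phi>, of a b c] assms
  by (simp add: carrier_points sym_group_mult coords_act)

lemma value_trans:
  assumes "a permutes points lam" "b permutes points lam" "c permutes points lam"
  shows "cval a c f = cval a b f + cval b c f"
  using group.cocycle_pairs(3)[OF sym_group_is_group finite_carrier_sym_group \<phi>, of a b c] assms
  by (simp add: carrier_points coords_add[symmetric])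

lemma value_self:
  assumes "a permutes points lam"
  shows "cval a a f = 0"
  using value_trans[OF assms assms assms, of f] by (metis add.right_neutral add_left_cancel)

text \<open>
  Equivariance under the transposition shows that the value is equal to the one with the two
  arguments exchanged, and additivity shows that it is the negative of that one.
\<close>

lemma value_transpose_zero:
  assumes a: "a permutes points lam" and xy: "x \<in> points lam" "y \<in> points lam" "f x = f y"
  shows "cval (transpose x y \<circ> a) a f = 0"
proof -
  let ?\<tau> = "transpose x y"
  have \<tau>: "?\<tau> permutes points lam" by (rule permutes_swap_id[OF xy(1,2)])
  have \<tau>a: "?\<tau> \<circ> a permutes points lam" by (rule permutes_compose[OF a \<tau>])
  have "f \<circ> ?\<tau> = f" using xy(3) by (auto simp: transpose_def)
  moreover have "?\<tau> \<circ> (?\<tau> \<circ> a) = a" by (simp add: fun_eq_iff)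
  ultimately have "cval (?\<tau> \<circ> a) a f = cval a (?\<tau> \<circ> a) f"
    using value_act[OF \<tau>a a \<tau>, of f] by simp
  moreover have "cval a a f = cval a (?\<tau> \<circ> a) f + cval (?\<tau> \<circ> a) a f"
    by (rule value_trans[OF a \<tau>a a])
  moreover have "cval a a f = 0" using value_self[OF a, of f] by simp
  ultimately have "2 * cval (?\<tau> \<circ> a) a f = 0" by simp
  then show ?thesis using char by simp
qed

text \<open>
  The stabiliser of a tabloid is generated by the transpositions in it, so the homomorphism to the
  field that the cocycle induces on it is zero. Multiplying \<open>h\<close> by the transposition of \<open>x\<close> and \<open>h x\<close>
  reduces the number of moved points.
\<close>

lemma value_stabilizer_zero:
  assumes h: "h permutes points lam" "f \<circ> h = f" and a: "a permutes points lam"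
  shows "cval (h \<circ> a) a f = 0"
  using h
proof (induction "card {x. h x \<noteq> x}" arbitrary: h rule: less_induct)
  case less
  show ?case
  proof (cases "h = id")
    case True
    then show ?thesis using value_self[OF a, of f] by simp
  next
    case False
    then obtain x where x: "h x \<noteq> x" by (metis eq_id_iff)
    define y where "y = h x"
    let ?\<tau> = "transpose x y"
    have xX: "x \<in> points lam" using permutes_not_in[OF less.prems(1)] x by blast
    then have yX: "y \<in> points lam" using permutes_in_image[OF less.prems(1)] by (simp add: y_def)
    have fxy: "f x = f y" using fun_cong[OF less.prems(2), of x] by (simp add: y_def)
    have \<tau>: "?\<tau> permutes points lam" by (rule permutes_swap_id[OF xX yX])
    let ?h = "?\<tau> \<circ> h"
    have h: "?h permutes points lam" by (rule permutes_compose[OF less.prems(1) \<tau>])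
    have "f \<circ> ?\<tau> = f" using fxy by (auto simp: transpose_def)
    then have fh: "f \<circ> ?h = f" using less.prems(2) by (simp add: comp_assoc[symmetric])
    have "{x. ?h x \<noteq> x} \<subset> {x. h x \<noteq> x}"
    proof
      show "{x. ?h x \<noteq> x} \<subseteq> {x. h x \<noteq> x}"
      proof
        fix z assume "z \<in> {x. ?h x \<noteq> x}"
        moreover have "?h z = z" if "h z = z"
        proof -
          have "z \<noteq> x" using that x by auto
          moreover have "z \<noteq> y"
            using that x permutes_inj[OF less.prems(1)] by (auto simp: y_def inj_eq)
          ultimately show ?thesis using that by (simp add: transpose_def)
        qed
        ultimately show "z \<in> {x. h x \<noteq> x}" by blast
      qed
      have "?h x = x" by (simp add: y_def)
      then show "{x. ?h x \<noteq> x} \<noteq> {x. h x \<noteq> x}" using x by blast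
    qed
    moreover have "finite {x. h x \<noteq> x}"
      by (rule finite_subset[of _ "points lam"]) (use permutes_not_in[OF less.prems(1)] in auto)
    ultimately have "card {x. ?h x \<noteq> x} < card {x. h x \<noteq> x}" by (rule psubset_card_mono[rotated])
    then have IH: "cval (?h \<circ> a) a f = 0" using less.hyps h fh by blast
    have ha: "?h \<circ> a permutes points lam" by (rule permutes_compose[OF a h])
    have "h \<circ> a = ?\<tau> \<circ> (?h \<circ> a)" by (simp add: fun_eq_iff)
    then have "cval (h \<circ> a) a f = cval (?\<tau> \<circ> (?h \<circ> a)) (?h \<circ> a) f + cval (?h \<circ> a) a f"
      using value_trans[OF permutes_compose[OF ha \<tau>] ha a] by simp
    then show ?thesis using IH value_transpose_zero[where f = f, OF ha xX yX fxy] by simp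
  qed
qed

text \<open>
  Going from \<open>f\<close> to \<open>f \<circ> b\<close> replaces the transporter \<open>s\<close> of \<open>f\<close> by \<open>b \<circ> t\<close>, where \<open>t\<close> is the transporter
  of \<open>f \<circ> b\<close>. The two differ by an element \<open>h\<close> of the stabiliser, which contributes nothing.
\<close>

lemma value_eq_primitive:
  assumes b: "b permutes points lam"
  shows "cval id b f = primitive lam \<phi> (f \<circ> b) - primitive lam \<phi> f"
proof (cases "f \<in> tabloid_colorings lam")
  case False
  then show ?thesis
    using coloring_comp_iff[OF b] by (simp add: primitive_def coords_def)
next
  case True
  let ?s = "transporter lam f" and ?t = "transporter lam (f \<circ> b)"
  have id: "id permutes points lam" by (rule permutes_id)
  have fb: "f \<circ> b \<in> tabloid_colorings lam" by (rule coloring_comp[OF b True])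
  note s = transporter[OF True] and t = transporter[OF fb]
  have bt: "b \<circ> ?t permutes points lam" by (rule permutes_compose[OF t(1) b])
  define h where "h = b \<circ> ?t \<circ> inv' ?s"
  have h: "h permutes points lam"
    unfolding h_def by (rule permutes_compose[OF permutes_inv[OF s(1)] bt])
  have "f \<circ> h = base_coloring lam \<circ> inv' ?s" using t(2) by (simp add: h_def comp_assoc[symmetric])
  also have "\<dots> = f" unfolding s(2)[symmetric] by (simp add: comp_assoc permutes_inv_o[OF s(1)])
  finally have fh: "f \<circ> h = f" .
  have hs: "h \<circ> ?s = b \<circ> ?t" by (simp add: h_def comp_assoc permutes_inv_o[OF s(1)])
  have "primitive lam \<phi> (f \<circ> b) = cval (b \<circ> ?t) (b \<circ> id) f"
    unfolding primitive_def using value_act[OF t(1) id b] by simp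
  also have "\<dots> = cval (b \<circ> ?t) ?s f + cval ?s b f"
    using value_trans[OF bt s(1) b] by simp
  also have "cval (b \<circ> ?t) ?s f = 0"
    using value_stabilizer_zero[OF h fh s(1)] by (simp add: hs)
  also have "cval ?s b f = cval ?s id f + cval id b f"
    by (rule value_trans[OF s(1) id b])
  finally show ?thesis unfolding primitive_def[of lam \<phi> f]
    by (simp only: add_0_left add_diff_cancel_left')
qed

lemma raise_primitive_invariant:
  assumes "0 < i" "0 < a" "\<pi> permutes points lam"
  shows "raise (points lam) i a (primitive lam \<phi>) (g \<circ> \<pi>) = raise (points lam) i a (primitive lam \<phi>) g"
proof -
  have "raise (points lam) i a (primitive lam \<phi>) (g \<circ> \<pi>) - raise (points lam) i a (primitive lam \<phi>) g
      = raise (points lam) i a (cval id \<pi>) g"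
  proof -
    have "cval id \<pi> = (\<lambda>f. primitive lam \<phi> (f \<circ> \<pi>) - primitive lam \<phi> f)"
      by (rule ext) (rule value_eq_primitive[OF assms(3)])
    then show ?thesis by (simp only: raise_permute[OF assms(3)] raise_diff)
  qed
  also have "\<dots> = 0"
    by (rule raise_specht[OF char lam value_specht[OF permutes_id assms(3)] assms(1,2)])
  finally show ?thesis by simp
qed

lemma invariant_images_primitive:
  "invariant_images (points lam) (content lam) (primitive lam \<phi>)"
  using raise_primitive_invariant tabloid_colorings_nonempty by unfold_locales auto

text \<open>
  The vector \<open>m\<close> with coefficients \<open>primitive\<close> lies in the Specht module. The cocycle is the
  coboundary of the equivariant map \<open>\<psi>\<close> on the bar resolution in degree 0 that sends \<open>[a]\<close> to \<open>a m\<close>.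
\<close>

lemma coboundary_if_primitive_killed:
  assumes kernel: "\<And>i a g. 0 < i \<Longrightarrow> 0 < a \<Longrightarrow> raise (points lam) i a (primitive lam \<phi>) g = 0"
  shows "\<phi> \<in> specht_coboundaries lam"
proof -
  let ?G = "sym_group (sum_list lam)" and ?\<sigma> = "perm_module_act lam :: _ \<Rightarrow> (tabloid \<Rightarrow> 'f) \<Rightarrow> _"
  interpret group ?G by (rule sym_group_is_group)
  note fin = finite_bar_basis[OF finite_carrier_sym_group, of "sum_list lam"]
  have idp: "id permutes points lam" by (rule permutes_id)
  define m :: "tabloid \<Rightarrow> 'f" where
    "m = (\<Sum>h\<in>tabloid_colorings lam. fscale (primitive lam \<phi> h) (delta (tabloid_with lam h)))"
  have m: "coords lam m f = primitive lam \<phi> f" for f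
  proof -
    have "coords lam m f = (\<Sum>h\<in>tabloid_colorings lam. if h = f then primitive lam \<phi> h else 0)"
      unfolding m_def coords_sum coords_scale
      by (intro sum.cong refl) (auto simp: coords_delta)
    then show ?thesis
      by (auto simp: finite_tabloid_colorings primitive_def coords_def)
  qed
  have "m \<in> perm_module lam"
    unfolding m_def perm_module_def
    by (intro fun_space.subspace_sum fun_space.subspace_scale subspace_free_space delta_free_space)
      (simp add: tabloids_eq)
  then have m_specht: "m \<in> specht_module lam"
  proof (rule kernel_intersection_subset[OF char lam])
    have "coords lam m = primitive lam \<phi>" using m by (rule ext)
    then show "0 < i \<Longrightarrow> 0 < a \<Longrightarrow> raise (points lam) i a (coords lam m) g = 0" for i a g
      using kernel by simp
  qed
  have sub: "fun_space.subspace (specht_module lam :: (tabloid \<Rightarrow> 'f) set)"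
    unfolding specht_module_def by (rule fun_space.subspace_span)
  have act_m: "?\<sigma> a m = m + \<phi> (delta [id, a])" if a: "a permutes points lam" for a
  proof (rule coords_inject)
    show "?\<sigma> a m \<in> perm_module lam" by (rule perm_module_act_closed[OF a])
    show "m + \<phi> (delta [id, a]) \<in> perm_module lam"
      using fun_space.subspace_add[OF sub m_specht value_specht[OF idp a]] specht_subset_perm_module by blast
    show "coords lam (?\<sigma> a m) = coords lam (m + \<phi> (delta [id, a]))"
      by (rule ext) (simp add: coords_act[OF a] coords_add m value_eq_primitive[OF a])
  qed
  have act_specht: "?\<sigma> a m \<in> specht_module lam" if a: "a permutes points lam" for a
    unfolding act_m[OF a] by (rule fun_space.subspace_add[OF sub m_specht value_specht[OF idp a]])
  have act_act: "?\<sigma> g (?\<sigma> a m) = ?\<sigma> (g \<circ> a) m"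
    if g: "g permutes points lam" and a: "a permutes points lam" for g a
  proof (rule coords_inject)
    have ga: "g \<circ> a permutes points lam" by (rule permutes_compose[OF a g])
    show "?\<sigma> g (?\<sigma> a m) \<in> perm_module lam" by (rule perm_module_act_closed[OF g])
    show "?\<sigma> (g \<circ> a) m \<in> perm_module lam" by (rule perm_module_act_closed[OF ga])
    show "coords lam (?\<sigma> g (?\<sigma> a m)) = coords lam (?\<sigma> (g \<circ> a) m)"
      by (rule ext) (simp add: coords_act[OF g] coords_act[OF a] coords_act[OF ga] comp_assoc)
  qed
  let ?B = "bar_basis ?G 0"
  have B: "xs \<in> ?B \<longleftrightarrow> (\<exists>a. xs = [a] \<and> a permutes points lam)" for xs
    by (auto simp: bar_basis_def length_Suc_conv carrier_points)
  define \<psi> where "\<psi> v = (if v \<in> bar_space ?G 0 then lin_ext ?B (\<lambda>xs. ?\<sigma> (hd xs) m) v else 0)" for v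
  have sub0: "fun_space.subspace (bar_space ?G 0 :: ((nat \<Rightarrow> nat) list \<Rightarrow> 'f) set)"
    by (simp add: bar_space_def subspace_free_space)
  have hom: "\<psi> \<in> FG_hom ?G (bar_space ?G 0) (bar_act ?G 0) (specht_module lam) ?\<sigma>"
    unfolding FG_hom_def mem_Collect_eq
  proof (intro conjI ballI allI impI)
    fix v :: "(nat \<Rightarrow> nat) list \<Rightarrow> 'f" assume v: "v \<in> bar_space ?G 0"
    show "\<psi> v \<in> specht_module lam"
      unfolding \<psi>_def if_P[OF v] lin_ext_def
      by (intro fun_space.subspace_sum[OF sub] fun_space.subspace_scale[OF sub]) (auto simp: B act_specht)
    show "\<psi> (v + w) = \<psi> v + \<psi> w" if w: "w \<in> bar_space ?G 0" for w
      unfolding \<psi>_def if_P[OF v] if_P[OF w] if_P[OF fun_space.subspace_add[OF sub0 v w]] by (rule lin_ext_add)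
    show "\<psi> (fscale c v) = fscale c (\<psi> v)" for c
      unfolding \<psi>_def if_P[OF v] if_P[OF fun_space.subspace_scale[OF sub0 v]] by (rule lin_ext_scale)
    fix g assume gc: "g \<in> carrier ?G"
    then have g: "g permutes points lam" by (simp add: carrier_points)
    have "\<psi> (bar_act ?G 0 g v) = lin_ext ?B (\<lambda>xs. ?\<sigma> (hd xs) m) (bar_act ?G 0 g v)"
      unfolding \<psi>_def if_P[OF bar_act_space[OF gc]] ..
    also have "\<dots> = lin_ext ?B (\<lambda>xs. lin_ext ?B (\<lambda>xs. ?\<sigma> (hd xs) m) (delta (map ((\<otimes>\<^bsub>?G\<^esub>) g) xs))) v"
      unfolding bar_act_def by (rule lin_ext_comp)
    also have "\<dots> = lin_ext ?B (\<lambda>xs. ?\<sigma> g (?\<sigma> (hd xs) m)) v"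
    proof (rule lin_ext_cong)
      fix xs assume xs: "xs \<in> ?B"
      then obtain a where a: "xs = [a]" "a permutes points lam" by (auto simp: B)
      have "lin_ext ?B (\<lambda>xs. ?\<sigma> (hd xs) m) (delta (map ((\<otimes>\<^bsub>?G\<^esub>) g) xs)) =
          ?\<sigma> (hd (map ((\<otimes>\<^bsub>?G\<^esub>) g) xs)) m"
        by (rule lin_ext_delta[OF fin bar_basis_map[OF xs gc]])
      then show "lin_ext ?B (\<lambda>xs. ?\<sigma> (hd xs) m) (delta (map ((\<otimes>\<^bsub>?G\<^esub>) g) xs)) = ?\<sigma> g (?\<sigma> (hd xs) m)"
        by (simp add: a(1) sym_group_mult act_act[OF g a(2)])
    qed
    also have "\<dots> = ?\<sigma> g (lin_ext ?B (\<lambda>xs. ?\<sigma> (hd xs) m) v)"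
      unfolding perm_module_act_def[of lam g] by (rule lin_ext_comp[symmetric])
    finally show "\<psi> (bar_act ?G 0 g v) = ?\<sigma> g (\<psi> v)" unfolding \<psi>_def if_P[OF v] .
  qed (simp add: \<psi>_def)
  have hom1: "\<phi> \<in> FG_hom ?G (free_space (bar_basis ?G 1)) (bar_act ?G 1) (specht_module lam) ?\<sigma>"
    using \<phi> by (simp add: ext1_cocycles_def bar_space_def)
  have "\<phi> = (\<lambda>v. if v \<in> bar_space ?G 1 then \<psi> (bar_diff ?G 1 v) else 0)"
  proof
    fix v
    show "\<phi> v = (if v \<in> bar_space ?G 1 then \<psi> (bar_diff ?G 1 v) else 0)"
    proof (cases "v \<in> bar_space ?G 1")
      case False
      then show ?thesis using hom1 by (simp add: FG_hom_def bar_space_def)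
    next
      case True
      have d: "bar_diff ?G 1 v \<in> bar_space ?G 0" using bar_diff_space[of ?G 0 v] by simp
      have "\<psi> (bar_diff ?G 1 v) = lin_ext ?B (\<lambda>xs. ?\<sigma> (hd xs) m) (bar_diff ?G 1 v)"
        unfolding \<psi>_def if_P[OF d] ..
      also have "\<dots> = lin_ext (bar_basis ?G 1) (\<lambda>xs. lin_ext ?B (\<lambda>xs. ?\<sigma> (hd xs) m)
          (\<Sum>i\<le>1. fscale ((-1) ^ i) (delta (take i xs @ drop (Suc i) xs)))) v"
        unfolding bar_diff_def by (rule lin_ext_comp)
      also have "\<dots> = lin_ext (bar_basis ?G 1) (\<lambda>xs. \<phi> (delta xs)) v"
      proof (rule lin_ext_cong)
        fix xs assume "xs \<in> bar_basis ?G 1"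
        then obtain a b where ab: "xs = [a, b]" "a permutes points lam" "b permutes points lam"
          by (auto simp: bar_basis_def length_Suc_conv carrier_points)
        have mem: "[a] \<in> ?B" "[b] \<in> ?B" using ab by (auto simp: B)
        have sum: "(\<Sum>i\<le>1. fscale ((-1) ^ i) (delta (take i xs @ drop (Suc i) xs))) =
            delta [b] + fscale (-1) (delta [a] :: _ \<Rightarrow> 'f)"
          by (simp add: ab(1))
        have "lin_ext ?B (\<lambda>xs. ?\<sigma> (hd xs) m)
            (\<Sum>i\<le>1. fscale ((-1) ^ i) (delta (take i xs @ drop (Suc i) xs))) =
            ?\<sigma> b m + fscale (-1) (?\<sigma> a m)"
          unfolding sum lin_ext_add lin_ext_scale lin_ext_delta[OF fin mem(1)] lin_ext_delta[OF fin mem(2)]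
          by (simp only: list.sel)
        also have "\<dots> = \<phi> (delta xs)"
        proof
          fix T
          have "\<phi> (delta [id, b]) = \<phi> (delta [id, a]) + \<phi> (delta [a, b])"
            using cocycle_pairs(3)[OF finite_carrier_sym_group \<phi>, of id a b] ab idp
            by (simp add: carrier_points)
          then show "(?\<sigma> b m + fscale (-1) (?\<sigma> a m)) T = \<phi> (delta xs) T"
            by (simp add: act_m ab fscale_def)
        qed
        finally show "lin_ext ?B (\<lambda>xs. ?\<sigma> (hd xs) m)
            (\<Sum>i\<le>1. fscale ((-1) ^ i) (delta (take i xs @ drop (Suc i) xs))) = \<phi> (delta xs)" .
      qed
      also have "\<dots> = \<phi> v"
        by (rule FG_hom_expand[OF fin hom1, symmetric]) (use True in \<open>simp add: bar_space_def\<close>)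
      finally show ?thesis unfolding if_P[OF True] ..
    qed
  qed
  then show ?thesis unfolding ext1_coboundaries_def using hom by blast
qed

end

text \<open>
  A colouring outside the content \<open>shift i a \<mu>\<close> receives no contribution from tabloids of content
  \<open>\<mu>\<close>, so the scalars describe the images completely.
\<close>

lemma (in invariant_images) killed_if_values_zero:
  assumes support: "\<And>f. m f \<noteq> 0 \<Longrightarrow> f \<in> colorings X \<mu>"
    and zero: "\<And>i a. 0 < i \<Longrightarrow> 0 < a \<Longrightarrow> a \<le> \<mu> (Suc i) \<Longrightarrow> val i a = 0"
    and ia: "0 < i" "0 < a"
  shows "raise X i a m g = 0"
proof (rule ccontr)
  assume nz: "raise X i a m g \<noteq> 0"
  then obtain S where S: "S \<in> subsets (row X g i) a" and "m (recolor S (Suc i) g) \<noteq> 0"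
    unfolding raise_def by (meson sum.neutral)
  then have h: "recolor S (Suc i) g \<in> colorings X \<mu>" (is "?h \<in> _") by (intro support)
  have SX: "S \<subseteq> row X g i" "card S = a" using S by (auto simp: subsets_def)
  have Sh: "S \<subseteq> row X ?h (Suc i)" using SX by (auto simp: row_def recolor_def)
  have "a \<le> card (row X ?h (Suc i))"
    unfolding SX(2)[symmetric] by (rule card_mono[OF finite_row[OF X] Sh])
  then have a: "a \<le> \<mu> (Suc i)" using h by (simp add: colorings_def)
  have "recolor S i ?h = g" using SX by (auto simp: recolor_def row_def fun_eq_iff)
  then have "g \<in> colorings X (shift i a \<mu>)"
    using recolor_colorings[OF X h Sh, of i] SX(2) by (simp add: shift_def)
  from raise_eq_val[OF ia this] zero[OF ia a] nz show False by simp
qed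

text \<open>
  The scalars indexed by \<open>R\<close> are linear functionals on the space of cocycles, and a cocycle on which
  they all vanish is a coboundary.
\<close>

theorem H1_dim_specht_le:
  fixes R :: "(nat \<times> nat) set"
  assumes char: "(2::'f::field) \<noteq> 0" and lam: "sorted_wrt (\<ge>) lam"
    and R: "finite R"
    and determined: "\<And>m :: (nat \<Rightarrow> nat) \<Rightarrow> 'f. invariant_images (points lam) (content lam) m \<Longrightarrow>
      (\<And>i a. (i, a) \<in> R \<Longrightarrow> raise_value (points lam) (content lam) i a m = 0) \<Longrightarrow>
      (\<And>i a. 0 < i \<Longrightarrow> 0 < a \<Longrightarrow> a \<le> content lam (Suc i) \<Longrightarrow>
        raise_value (points lam) (content lam) i a m = 0)"
  shows "H1_dim (sym_group (sum_list lam)) (specht_module lam :: (tabloid \<Rightarrow> 'f) set) (perm_module_act lam)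
    \<le> card R"
proof -
  let ?Z = "specht_cocycles lam :: (((nat \<Rightarrow> nat) list \<Rightarrow> 'f) \<Rightarrow> tabloid \<Rightarrow> 'f) set"
  let ?B = "specht_coboundaries lam :: (((nat \<Rightarrow> nat) list \<Rightarrow> 'f) \<Rightarrow> tabloid \<Rightarrow> 'f) set"
  let ?L = "\<lambda>(i, a) \<phi>. raise_value (points lam) (content lam) i a (primitive lam \<phi>) :: 'f"
  interpret group "sym_group (sum_list lam)" by (rule sym_group_is_group)
  have Z: "hom_space.subspace ?Z"
    by (rule subspace_ext1_cocycles)
      (simp_all only: specht_module_def fun_space.subspace_span perm_module_act_add perm_module_act_scale)
  have "specht_module lam \<subseteq> free_space (tabloids lam)"
    using specht_subset_perm_module by (simp add: perm_module_def)
  from ext1_cocycles_finite_dim[OF finite_carrier_sym_group finite_tabloids this]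
  obtain T where T: "finite T" "?Z \<subseteq> hom_space.span T" by blast
  have B: "?B \<subseteq> ?Z" by (rule ext1_coboundaries_subset[OF finite_carrier_sym_group])
  have cocycle: "specht_cocycle lam \<phi>" if "\<phi> \<in> ?Z" for \<phi>
    using char lam that by unfold_locales
  have "hom_space.dim ?Z \<le> hom_space.dim ?B + card R"
  proof (rule hom_space.dim_le_dim_plus_functionals[where L = ?L, OF R Z T B])
    show "?L t (\<phi> + \<phi>') = ?L t \<phi> + ?L t \<phi>'" for t \<phi> \<phi>'
    proof -
      have "primitive lam (\<phi> + \<phi>') = (\<lambda>f. primitive lam \<phi> f + primitive lam \<phi>' f)"
        by (rule ext) (simp only: primitive_def plus_fun_apply coords_add)
      then show ?thesis by (cases t) (simp add: raise_value_def raise_add)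
    qed
    show "?L t (hscale c \<phi>) = c * ?L t \<phi>" for t c \<phi>
    proof -
      have "primitive lam (hscale c \<phi>) = (\<lambda>f. c * primitive lam \<phi> f)"
        by (rule ext) (simp only: primitive_def hscale_def coords_scale)
      then show ?thesis by (cases t) (simp add: raise_value_def raise_scale)
    qed
    fix \<phi> assume \<phi>: "\<phi> \<in> ?Z" and zero: "\<And>t. t \<in> R \<Longrightarrow> ?L t \<phi> = 0"
    interpret specht_cocycle lam \<phi> by (rule cocycle[OF \<phi>])
    interpret inv: invariant_images "points lam" "content lam" "primitive lam \<phi>"
      by (rule invariant_images_primitive)
    show "\<phi> \<in> ?B"
    proof (rule coboundary_if_primitive_killed, rule inv.killed_if_values_zero)
      show "f \<in> tabloid_colorings lam" if "primitive lam \<phi> f \<noteq> 0" for f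
        using that by (auto simp: primitive_def coords_def split: if_splits)
      show "raise_value (points lam) (content lam) i a (primitive lam \<phi>) = 0"
        if "0 < i" "0 < a" "a \<le> content lam (Suc i)" for i a
        by (rule determined[OF invariant_images_primitive _ that]) (use zero in fastforce)
    qed
  qed
  then show ?thesis by (simp add: H1_dim_def)
qed

section \<open>James partitions\<close>

lemma lp_bounds:
  assumes "p \<ge> 2" "x > 0"
  shows "p ^ lp p x \<le> x" "x < p ^ Suc (lp p x)"
proof -
  obtain k where k: "p ^ k \<le> x" "x < p ^ (k + 1)"
    using ex_power_ivl1[of p x] assms by auto
  have pos: "p ^ j > 0" for j using assms(1) by simp
  have "lp p x = k"
    unfolding lp_def
  proof (rule Greatest_equality)
    have "x div p ^ k < p" using k(2) pos by (simp add: div_less_iff_less_mult mult.commute)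
    moreover have "x div p ^ k > 0" using k(1) pos by (simp add: div_greater_zero_iff)
    ultimately show "digit p x k \<noteq> 0" by (simp add: digit_def)
    fix i assume i: "digit p x i \<noteq> 0"
    show "i \<le> k"
    proof (rule ccontr)
      assume "\<not> i \<le> k"
      then have "p ^ (k + 1) \<le> p ^ i" using assms(1) by (intro power_increasing) auto
      then have "x div p ^ i = 0" using k(2) by (intro div_less) linarith
      with i show False by (simp add: digit_def)
    qed
  qed
  with k show "p ^ lp p x \<le> x" "x < p ^ Suc (lp p x)" by simp_all
qed

lemma lp_le_iff:
  assumes "p \<ge> 2" "x > 0"
  shows "k \<le> lp p x \<longleftrightarrow> p ^ k \<le> x"
proof
  assume "k \<le> lp p x"
  then have "p ^ k \<le> p ^ lp p x" using assms by (intro power_increasing) auto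
  then show "p ^ k \<le> x" using lp_bounds(1)[OF assms] by linarith
next
  assume "p ^ k \<le> x"
  then have "p ^ k < p ^ Suc (lp p x)" using lp_bounds(2)[OF assms] by linarith
  then show "k \<le> lp p x" using assms(1) by (simp add: power_strict_increasing_iff less_Suc_eq_le del: power_Suc)
qed

lemma valp_dvd:
  assumes p: "prime p" and x: "x > 0"
  shows "p ^ valp p x dvd x" "\<not> p ^ Suc (valp p x) dvd x"
proof -
  have pos: "p ^ j > 0" for j using p by (simp add: prime_gt_0_nat)
  have "\<not> is_unit p" using p by auto
  then obtain w where w: "x = p ^ multiplicity p x * w" "\<not> p dvd w"
    using multiplicity_decompose'[of x p] x by blast
  define k where "k = multiplicity p x"
  note w = w[folded k_def]
  have "valp p x = k"
    unfolding valp_def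
  proof (rule Least_equality)
    have "x div p ^ k = w" using w(1) pos[of k] by simp
    then show "digit p x k \<noteq> 0" using w(2) by (simp add: digit_def dvd_eq_mod_eq_0)
    fix i assume i: "digit p x i \<noteq> 0"
    show "k \<le> i"
    proof (rule ccontr)
      assume "\<not> k \<le> i"
      then have "k = i + Suc (k - Suc i)" by simp
      then have "p ^ k = p ^ (i + Suc (k - Suc i))" by (rule arg_cong)
      then have "p ^ k = p ^ i * (p * p ^ (k - Suc i))" by (simp only: power_add power_Suc)
      then have "x div p ^ i = p * p ^ (k - Suc i) * w"
        using w(1) pos[of i] by (simp add: mult.assoc)
      with i show False by (simp add: digit_def mult.assoc)
    qed
  qed
  moreover have "\<not> p ^ Suc k dvd x"
  proof
    assume "p ^ Suc k dvd x"
    then have "p ^ k * p dvd p ^ k * w"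
      by (subst w(1)[symmetric]) (simp add: mult.commute)
    then show False using w(2) pos[of k] by simp
  qed
  ultimately show "p ^ valp p x dvd x" "\<not> p ^ Suc (valp p x) dvd x" using w(1) by simp_all
qed

text \<open>
  The defining congruence for \<open>j = p\<^sup>k\<close> says that \<open>p\<close> divides \<open>(\<lambda>\<^sub>i + p\<^sup>k) div p\<^sup>k\<close>, so the digit
  of \<open>\<lambda>\<^sub>i\<close> at position \<open>k\<close> is \<open>p - 1\<close>. This holds at all positions up to \<open>l\<^sub>p(\<lambda>\<^sub>i\<^sub>+\<^sub>1)\<close>.
\<close>

lemma james_dvd:
  assumes p: "prime p" "CHAR('f::field) = p" and pos: "\<And>x. x \<in> set lam \<Longrightarrow> x > 0"
    and james: "james_partition p lam" and i: "1 \<le> i" "i < length lam"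
  shows "p ^ Suc (lp p (part lam (i + 1))) dvd part lam i + 1"
proof -
  have p2: "p \<ge> 2" using p(1) by (rule prime_ge_2_nat)
  let ?A = "part lam i" and ?B = "part lam (i + 1)"
  have B: "?B > 0" using pos i by (simp add: part_def)
  have "p ^ k dvd ?A + 1" if "k \<le> Suc (lp p ?B)" for k
    using that
  proof (induction k)
    case (Suc k)
    then have "p ^ k \<le> ?B" using lp_le_iff[OF p2 B, of k] by simp
    moreover have pk: "p ^ k > 0" using p2 by simp
    then have "1 \<le> p ^ k" by linarith
    ultimately have "p dvd ((?A + p ^ k) choose p ^ k)"
      using james i unfolding james_partition_def by blast
    then have "(of_nat ((?A + p ^ k) choose p ^ k) :: 'f) = 0"
      by (simp add: of_nat_eq_0_iff_char_dvd p(2))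
    then have "(of_nat ((?A + p ^ k) div p ^ k) :: 'f) = 0"
      by (simp only: choose_prime_power[OF p])
    then have dvd: "p dvd (?A + p ^ k) div p ^ k"
      by (simp only: of_nat_eq_0_iff_char_dvd p(2))
    obtain w where w: "?A + 1 = p ^ k * w" using Suc by (auto elim: dvdE)
    then have "?A + p ^ k = p ^ k * w + (p ^ k - 1)" using pk by linarith
    also have "\<dots> div p ^ k = w" using pk by (subst div_mult_self4) simp_all
    finally have "p dvd w" using dvd by simp
    then show ?case unfolding w by (simp add: mult.commute mult_dvd_mono)
  qed simp
  then show ?thesis by blast
qed

text \<open>
  Rows that are adjacent to the row above without lying in its segment.
\<close>

definition special :: "nat \<Rightarrow> nat list \<Rightarrow> nat \<Rightarrow> bool" where
  "special p lam t \<longleftrightarrow> 2 < t \<and> t \<le> length lam \<and> segment p lam t = {t} \<and>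
     part lam (t - 1) = p ^ valp p (part lam (t - 2) + 1) - 1"

text \<open>
  The rows whose parameters suffice: the last rows of segments, except the special ones.
\<close>

definition free_row :: "nat \<Rightarrow> nat list \<Rightarrow> nat \<Rightarrow> bool" where
  "free_row p lam t \<longleftrightarrow> 2 \<le> t \<and> t \<le> length lam \<and> \<not> special p lam t \<and>
     (t < length lam \<longrightarrow> lp p (part lam (t + 1)) \<noteq> lp p (part lam t))"

locale james =
  fixes p :: nat and lam :: "nat list"
  assumes p: "prime p" and sorted: "sorted_wrt (\<ge>) lam"
    and pos: "\<And>x. x \<in> set lam \<Longrightarrow> x > 0"
    and james: "james_partition p lam"
begin

abbreviation L :: "nat \<Rightarrow> nat" where
  "L t \<equiv> lp p (part lam t)"

lemma p2: "p \<ge> 2"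
  using p by (rule prime_ge_2_nat)

lemma part_pos: "1 \<le> t \<Longrightarrow> t \<le> length lam \<Longrightarrow> part lam t > 0"
  using pos by (simp add: part_def)

lemma part_antimono:
  assumes "1 \<le> s" "s \<le> t" "t \<le> length lam"
  shows "part lam t \<le> part lam s"
  using sorted_wrt_nth_less[OF sorted, of "s - 1" "t - 1"] assms
  by (cases "s = t") (auto simp: part_def)

lemma L_antimono:
  assumes "1 \<le> s" "s \<le> t" "t \<le> length lam"
  shows "L t \<le> L s"
proof -
  have "p ^ L t \<le> part lam t" using assms by (intro lp_bounds p2 part_pos) auto
  also have "\<dots> \<le> part lam s" by (rule part_antimono[OF assms])
  finally show ?thesis using assms part_pos[of s] by (subst lp_le_iff[OF p2]) auto
qed

text \<open>
  Downward induction on the rows shows that all leading scalars vanish: the scalar of a free row by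
  hypothesis, that of a special row by \<open>val_zero_special\<close>, and otherwise the next row is in the same
  segment. The leading scalar of a row determines the others.
\<close>

lemma all_values_zero:
  fixes m :: "(nat \<Rightarrow> nat) \<Rightarrow> 'f::field"
  assumes char: "CHAR('f) = p"
    and m: "invariant_images (points lam) (content lam) m"
    and zero: "\<And>t. free_row p lam t \<Longrightarrow> raise_value (points lam) (content lam) (t - 1) (p ^ L t) m = 0"
    and ia: "0 < i" "0 < a" "a \<le> content lam (Suc i)"
  shows "raise_value (points lam) (content lam) i a m = 0"
proof -
  interpret invariant_images "points lam" "content lam" m by (rule m)
  note dvd = james_dvd[OF p char pos james]
  have cont: "content lam t = part lam t" if "1 \<le> t" "t \<le> length lam" for t
    using that by (simp add: content_def)
  have leading: "val (t - 1) (p ^ L t) = 0" if "2 \<le> t" "t \<le> length lam" for t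
    using that
  proof (induction "length lam - t" arbitrary: t rule: less_induct)
    case less
    note t = less.prems
    have bounds: "p ^ L t \<le> part lam t" "part lam t < p ^ Suc (L t)"
      using lp_bounds[OF p2 part_pos[of t]] t by simp_all
    consider "free_row p lam t" | "special p lam t" | "t < length lam" "L (t + 1) = L t"
      using t by (auto simp: free_row_def)
    then show ?case
    proof cases
      case 1
      then show ?thesis by (rule zero)
    next
      case 2
      define k where "k = t - 2"
      define v where "v = valp p (part lam k + 1)"
      have tk: "t = Suc (Suc k)" "0 < k" using 2 by (auto simp: special_def k_def)
      have B: "part lam (Suc k) = p ^ v - 1" using 2 by (simp add: special_def tk v_def)
      have Bpos: "part lam (Suc k) > 0" using t tk by (intro part_pos) auto
      have "L t \<noteq> L (Suc k)"
      proof -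
        have "Suc k \<notin> segment p lam t" using 2 tk(1) by (simp add: special_def)
        then show ?thesis using t(2) unfolding tk(1) segment_def by simp
      qed
      then have "L t < L (Suc k)" using L_antimono[of "Suc k" t] t tk by simp
      moreover have "L (Suc k) < v"
      proof -
        have "p ^ L (Suc k) < p ^ v"
          using lp_bounds(1)[OF p2 Bpos] B Bpos by linarith
        then show ?thesis using p2 by (simp add: power_less_imp_less_exp)
      qed
      ultimately have "Suc (L t) < v" by simp
      then have "val (Suc k) (p ^ L t) = 0"
        using t tk B Bpos bounds valp_dvd[OF p, of "part lam k + 1"]
        by (intro val_zero_special[OF p char, where v = v]) (auto simp: cont v_def)
      then show ?thesis by (simp add: tk)
    next
      case 3
      define k where "k = t - 1"
      have tk: "t = Suc k" "0 < k" using t by (auto simp: k_def)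
      have "val (t + 1 - 1) (p ^ L (t + 1)) = 0"
        by (rule less.hyps) (use 3(1) t in auto)
      then have next_zero: "val (Suc k) (p ^ L t) = 0"
        unfolding 3(2) by (simp flip: tk(1))
      have "part lam t + 1 = p ^ Suc (L t)"
      proof (rule antisym)
        show "part lam t + 1 \<le> p ^ Suc (L t)" using bounds by simp
        show "p ^ Suc (L t) \<le> part lam t + 1" using dvd[of t] 3 t by (intro dvd_imp_le) auto
      qed
      then have B: "content lam (Suc k) + 1 = p ^ Suc (L t)"
        using t cont[of t] by (simp flip: tk(1))
      have "p ^ L (t + 1) \<le> part lam (t + 1)"
        by (rule lp_bounds(1)[OF p2 part_pos]) (use 3(1) in simp_all)
      then have C: "p ^ L t \<le> content lam (Suc (Suc k))"
        unfolding 3(2) using 3(1) by (simp add: cont tk(1))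
      have A: "p ^ Suc (L t) dvd content lam k + 1"
        using dvd[of k] tk(2) t(2) by (simp add: cont tk(1))
      have "val k (p ^ L t) = 0"
        by (rule val_zero_same_segment[OF p char tk(2) A B C next_zero])
      then show ?thesis by (simp add: tk)
    qed
  qed
  have le: "Suc i \<le> length lam" using ia by (auto simp: content_def split: if_splits)
  interpret row_sequence p "content lam i" "content lam (Suc i)" "L (Suc i)" "val i"
  proof (rule row_sequence_val[OF p char ia(1)])
    show "p ^ Suc (L (Suc i)) dvd content lam i + 1"
      using dvd[of i] le ia(1) by (simp add: cont)
    show "p ^ L (Suc i) \<le> content lam (Suc i)" "content lam (Suc i) < p ^ Suc (L (Suc i))"
      using lp_bounds[OF p2 part_pos[of "Suc i"]] le by (simp_all add: cont)
  qed
  show ?thesis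
    using all_zero[OF _ ia(2,3)] leading[of "Suc i"] le ia(1) by simp
qed

text \<open>
  The rows up to \<open>t\<close> at which a new \<open>p\<close>-segment starts, apart from row 1. This set is the same for
  all rows of a \<open>p\<close>-segment, so it serves as an invariant that tells \<open>p\<close>-segments apart.
\<close>

definition breaks :: "nat \<Rightarrow> nat set" where
  "breaks t = {u \<in> {2..t}. L u \<noteq> L (u - 1) \<and> \<not> special p lam u}"

lemma breaks_segment:
  assumes "1 \<le> s" "s \<le> t" "t \<le> length lam" "L s = L t"
  shows "breaks s = breaks t"
proof -
  have "L u = L (u - 1)" if "s < u" "u \<le> t" for u
  proof -
    have u: "1 \<le> u - 1" "s \<le> u - 1" "u - 1 \<le> u" "u \<le> length lam" "u - 1 \<le> length lam"
      using assms that by auto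
    show ?thesis
      using L_antimono[OF assms(1) u(2,5)] L_antimono[OF u(1,3,4)] L_antimono[of u t] assms that by simp
  qed
  then have "u \<in> breaks s \<longleftrightarrow> u \<in> breaks t" for u
    using assms(2) by (cases "u \<le> s") (auto simp: breaks_def)
  then show ?thesis by blast
qed

lemma breaks_adjacent:
  assumes "adjacent p lam s t"
  shows "breaks s = breaks t"
proof (cases "t \<in> segment p lam s")
  case True
  then have L: "L s = L t" and st: "1 \<le> s" "s \<le> length lam" "1 \<le> t" "t \<le> length lam"
    using assms by (auto simp: segment_def adjacent_def)
  show ?thesis
  proof (cases "s \<le> t")
    case True
    show ?thesis by (rule breaks_segment[OF st(1) True st(4) L])
  next
    case False
    then have "t \<le> s" by simp
    from breaks_segment[OF st(3) this st(2) L[symmetric]] show ?thesis ..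
  qed
next
  case False
  then have st: "t = Suc s" and sp: "special p lam t"
    using assms by (auto simp: adjacent_def special_def numeral_2_eq_2)
  have "2 < t" using sp by (simp only: special_def)
  then have eq: "{2..t} = insert t {2..s}" by (auto simp: st)
  show ?thesis unfolding breaks_def eq using sp by blast
qed

lemma breaks_equivclp: "equivclp (adjacent p lam) s t \<Longrightarrow> breaks s = breaks t"
  by (induction rule: equivclp_induct) (auto dest: breaks_adjacent)

lemma card_breaks_le: "card (breaks ` {1..length lam}) \<le> card (p_segments p lam)"
proof -
  let ?E = "{(s, t). s \<in> {1..length lam} \<and> t \<in> {1..length lam} \<and> equivclp (adjacent p lam) s t}"
  have fin: "finite (p_segments p lam)"
    by (rule finite_subset[of _ "Pow {1..length lam}"]) (auto simp: p_segments_def quotient_def)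
  have "breaks ` {1..length lam} \<subseteq> (\<lambda>S. breaks (SOME s. s \<in> S)) ` p_segments p lam"
  proof
    fix b assume "b \<in> breaks ` {1..length lam}"
    then obtain s where s: "s \<in> {1..length lam}" "b = breaks s" by blast
    let ?S = "?E `` {s}"
    have S: "?S \<in> p_segments p lam" using s(1) by (auto simp: p_segments_def quotient_def)
    have "s \<in> ?S" using s(1) by simp
    then have "(SOME s. s \<in> ?S) \<in> ?S" by (rule someI[of "\<lambda>s. s \<in> ?S"])
    then have "equivclp (adjacent p lam) s (SOME s. s \<in> ?S)" by blast
    then have "b = breaks (SOME s. s \<in> ?S)" using s(2) breaks_equivclp by blast
    then show "b \<in> (\<lambda>S. breaks (SOME s. s \<in> S)) ` p_segments p lam" using S by blast
  qed
  then show ?thesis by (rule surj_card_le[OF fin])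
qed

text \<open>
  The first row \<open>u\<close> of the segment of \<open>t\<close> lies strictly below \<open>s\<close>, because \<open>s\<close> is last in its
  own segment. It is not special: a special row is a segment by itself, and then \<open>t = u\<close> would not
  be free. So \<open>u\<close> is a break between \<open>s\<close> and \<open>t\<close>.
\<close>

lemma breaks_free_less:
  assumes s: "free_row p lam s" and t: "free_row p lam t" and st: "s < t"
  shows "breaks s \<noteq> breaks t"
proof -
  define u where "u = (LEAST u. s < u \<and> L u = L t)"
  have u: "s < u \<and> L u = L t" unfolding u_def by (rule LeastI[of _ t]) (use st in simp)
  have ut: "u \<le> t" unfolding u_def by (rule Least_le) (use st in simp)
  have t_range: "2 \<le> t" "t \<le> length lam" using t by (auto simp: free_row_def)
  have "L (u - 1) \<noteq> L u"
  proof (cases "u = Suc s")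
    case True
    then show ?thesis using s ut t_range by (auto simp: free_row_def)
  next
    case False
    then have "s < u - 1" "u - 1 < u" using u by auto
    then show ?thesis using not_less_Least[of "u - 1" "\<lambda>u. s < u \<and> L u = L t"] u unfolding u_def by auto
  qed
  moreover have "\<not> special p lam u"
  proof
    assume sp: "special p lam u"
    have "t \<in> segment p lam u" using u t_range by (auto simp: segment_def)
    then have "t = u" using sp by (auto simp: special_def)
    then show False using sp t by (simp add: free_row_def)
  qed
  ultimately have "u \<in> breaks t"
    using u ut s by (auto simp: breaks_def free_row_def)
  moreover have "u \<notin> breaks s" using u by (auto simp: breaks_def)
  ultimately show ?thesis by blast
qed

lemma inj_breaks_free: "inj_on breaks {t. free_row p lam t}"
proof (rule inj_onI)
  fix s t assume "s \<in> {t. free_row p lam t}" "t \<in> {t. free_row p lam t}" "breaks s = breaks t"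
  then show "s = t"
    using breaks_free_less[of s t] breaks_free_less[of t s] by (cases s t rule: linorder_cases) auto
qed

lemma finite_free: "finite {t. free_row p lam t}"
  by (rule finite_subset[of _ "{1..length lam}"]) (auto simp: free_row_def)

lemma free_subset: "{t. free_row p lam t} \<subseteq> {1..length lam}"
  by (auto simp: free_row_def)

lemma card_free_le: "card {t. free_row p lam t} \<le> card (p_segments p lam)"
proof -
  have "card {t. free_row p lam t} = card (breaks ` {t. free_row p lam t})"
    by (rule card_image[OF inj_breaks_free, symmetric])
  also have "\<dots> \<le> card (breaks ` {1..length lam})"
    by (intro card_mono image_mono free_subset) simp
  also note card_breaks_le
  finally show ?thesis .
qed

text \<open>
  Row 2 starts a new segment, and it cannot be special. So \<open>2\<close> is a break for every free row, but not
  for row 1.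
\<close>

lemma card_free_le_pred:
  assumes len: "length lam \<ge> 2" and L: "L 1 > L 2"
  shows "card {t. free_row p lam t} \<le> card (p_segments p lam) - 1"
proof -
  have "card {t. free_row p lam t} = card (breaks ` {t. free_row p lam t})"
    by (rule card_image[OF inj_breaks_free, symmetric])
  also have "\<dots> \<le> card (breaks ` {1..length lam} - {breaks 1})"
  proof (intro card_mono subsetI)
    fix b assume "b \<in> breaks ` {t. free_row p lam t}"
    then obtain t where t: "free_row p lam t" "b = breaks t" by blast
    have "2 \<in> breaks t" using t(1) L by (auto simp: breaks_def free_row_def special_def)
    moreover have "2 \<notin> breaks 1" by (simp add: breaks_def)
    ultimately have "b \<noteq> breaks 1" using t(2) by auto
    then show "b \<in> breaks ` {1..length lam} - {breaks 1}" using t free_subset by auto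
  qed simp
  also have "\<dots> = card (breaks ` {1..length lam}) - 1"
    using len by (subst card_Diff_singleton) auto
  also have "\<dots> \<le> card (p_segments p lam) - 1"
    using card_breaks_le by (rule diff_le_mono)
  finally show ?thesis .
qed

end

theorem theorem25:
  fixes p n :: nat and lam :: "nat list"
  assumes "prime p" and "p \<ge> 3"
    and "CHAR('f::field) = p"
    and "partition_of n lam"
    and "length lam \<ge> 2"
    and "james_partition p lam"
  shows "(lp p (part lam 1) = lp p (part lam 2) \<longrightarrow>
           H1_dim (sym_group n) (specht_module lam :: (tabloid \<Rightarrow> 'f) set) (perm_module_act lam)
             \<le> card (p_segments p lam)) \<and>
         (lp p (part lam 1) > lp p (part lam 2) \<longrightarrow>
           H1_dim (sym_group n) (specht_module lam :: (tabloid \<Rightarrow> 'f) set) (perm_module_act lam)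
             \<le> card (p_segments p lam) - 1)"
proof -
  have n: "n = sum_list lam" and sorted: "sorted_wrt (\<ge>) lam"
    using assms(4) by (auto simp: partition_of_def)
  interpret james p lam
    by unfold_locales (use assms in \<open>auto simp: partition_of_def\<close>)
  have two: "(2::'f) \<noteq> 0"
  proof
    assume "(2::'f) = 0"
    then have "(of_nat 2 :: 'f) = 0" by simp
    then have "p dvd 2" by (simp only: of_nat_eq_0_iff_char_dvd assms(3))
    then show False using assms(2) by (auto dest: dvd_imp_le)
  qed
  let ?R = "(\<lambda>t. (t - 1, p ^ L t)) ` {t. free_row p lam t}"
  have "H1_dim (sym_group n) (specht_module lam :: (tabloid \<Rightarrow> 'f) set) (perm_module_act lam) \<le> card ?R"
    unfolding n
  proof (rule H1_dim_specht_le[OF two sorted])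
    show "finite ?R" using finite_free by simp
    fix m :: "(nat \<Rightarrow> nat) \<Rightarrow> 'f" and i a
    assume m: "invariant_images (points lam) (content lam) m"
      and zero: "\<And>i a. (i, a) \<in> ?R \<Longrightarrow> raise_value (points lam) (content lam) i a m = 0"
      and ia: "0 < i" "0 < a" "a \<le> content lam (Suc i)"
    show "raise_value (points lam) (content lam) i a m = 0"
      by (rule all_values_zero[OF assms(3) m _ ia]) (use zero in blast)
  qed
  also have "card ?R \<le> card {t. free_row p lam t}"
    by (rule card_image_le[OF finite_free])
  finally have H: "H1_dim (sym_group n) (specht_module lam :: (tabloid \<Rightarrow> 'f) set) (perm_module_act lam)
    \<le> card {t. free_row p lam t}" .
  show ?thesis
    using H card_free_le card_free_le_pred[OF assms(5)] by (auto intro: order.trans)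
qed

end
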